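(* Let $D\subset\mathbb{R}^N$, $N\in\{1,2,3\}$, be a bounded domain with Lipschitz boundary $\partial D$ and outward normal $n$, and let $T>0$. Let $f\in W^{1,\infty}(\mathbb{R})$ have Lipschitz constant $L_f$, with $f(0)=f(1)=0$ and $f(s)\ge0$ for every $0<s<1$. For $i=1,2$ let $\alpha_i,\beta_i\in L^\infty((0,T)\times D)$, $V_i\in L^\infty((0,T);W^{1,\infty}(D))$ and $u_i^0\in W^{2-2/p,p}(D)$ for some fixed $2<p<3$, where $0\le u_i^0\le1$ and there exist $\alpha_0,\beta_0>0$ such that $\alpha_i\ge\alpha_0$ and $\beta_i\ge\beta_0$ a.e. in $(0,T)\times D$. Let $u_i$ be the solution of $$\partial_t u_i+\nabla\cdot(-\nabla u_i+f(u_i)\nabla V_i)=\alpha_i f(u_i)-\beta_i u_i\ \text{ in }(0,T)\times D,\qquad(-\nabla u_i+f(u_i)\nabla V_i)\cdot n=0\ \text{ on }(0,T)\times\partial D,$$ with initial condition $u_i(0)=u_i^0$. Then there exist constants $C,\tilde C>0$ such that $$\|u_1-u_2\|_{L^2((0,T);H^1(D))}^2\le Ce^{\tilde CT}\Big(\|\alpha_1-\alpha_2\|_{L^\infty((0,T)\times D)}^2+\|\beta_1-\beta_2\|_{L^\infty((0,T)\times D)}^2+\|V_1-V_2\|_{L^\infty((0,T);W^{1,\infty}(D))}^2+\|u_1^0-u_2^0\|_{L^2(D)}^2\Big).$$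
   Context: Solutions are weak solutions: $u\in L^2((0,T);H^1(D))$ with $\partial_t u\in L^2((0,T);H^1(D)^* )$ is a weak solution for data $(\alpha,\beta,V)$ if $$\int_D\partial_t u\,\varphi\,dx-\int_D(-\nabla u+f(u)\nabla V)\cdot\nabla\varphi\,dx+\int_D\beta(t,x)\,u\,\varphi\,dx-\int_D\alpha(t,x)f(u)\varphi\,dx=0$$ for all $\varphi\in H^1(D)$ and a.e. $0\le t\le T$, where $\int_D\partial_t u\,\varphi\,dx$ is understood as the duality pairing between $H^1(D)^*$ and $H^1(D)$. Under the stated hypotheses on the data, the weak solution with prescribed initial condition exists, is unique, and satisfies $0\le u\le1$ a.e. *)

theory Defs
  imports "HOL-Analysis.Analysis" "HOL-Probability.Essential_Supremum"
begin

text \<open>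
  Elements of function spaces are represented by functions that are total on the underlying type;
  they are only looked at on the domain, through its Lebesgue measure \<open>lebesgue_on D\<close>, and so up to
  null sets. All norms below are meant for members of the corresponding space; outside of it their
  values carry no meaning.
\<close>

section \<open>Lipschitz domains\<close>

text \<open>
  Near every boundary point, \<open>D\<close> is the strict epigraph, in a direction \<open>e\<close>, of a Lipschitz function
  \<open>h\<close> on the hyperplane orthogonal to \<open>e\<close> (a single point when the dimension is 1).
\<close>

definition lipschitz_boundary :: "'a::euclidean_space set \<Rightarrow> bool" where
  "lipschitz_boundary D \<longleftrightarrow>
    (\<forall>z\<in>frontier D. \<exists>U e h L. open U \<and> z \<in> U \<and> norm e = 1 \<and>
       L-lipschitz_on {y. y \<bullet> e = 0} (h :: 'a \<Rightarrow> real) \<and>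
       D \<inter> U = {y \<in> U. h (y - (y \<bullet> e) *\<^sub>R e) < y \<bullet> e})"

definition bounded_lipschitz_domain :: "'a::euclidean_space set \<Rightarrow> bool" where
  "bounded_lipschitz_domain D \<longleftrightarrow>
    open D \<and> connected D \<and> D \<noteq> {} \<and> bounded D \<and> lipschitz_boundary D"

section \<open>Lebesgue spaces\<close>

definition Lp :: "real \<Rightarrow> 'b measure \<Rightarrow> ('b \<Rightarrow> 'c::euclidean_space) set" where
  "Lp p M = {f \<in> borel_measurable M. integrable M (\<lambda>x. norm (f x) powr p)}"

definition Lp_norm :: "real \<Rightarrow> 'b measure \<Rightarrow> ('b \<Rightarrow> 'c::euclidean_space) \<Rightarrow> real" where
  "Lp_norm p M f = (LINT x|M. norm (f x) powr p) powr (1 / p)"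

definition Linf :: "'b measure \<Rightarrow> ('b \<Rightarrow> 'c::euclidean_space) set" where
  "Linf M = {f \<in> borel_measurable M. \<exists>c. AE x in M. norm (f x) \<le> c}"

definition Linf_norm :: "'b measure \<Rightarrow> ('b \<Rightarrow> 'c::euclidean_space) \<Rightarrow> real" where
  "Linf_norm M f = real_of_ereal (esssup M (\<lambda>x. ereal (norm (f x))))"

section \<open>Weak gradients and Sobolev spaces\<close>

fun Ck :: "nat \<Rightarrow> ('a::euclidean_space \<Rightarrow> real) \<Rightarrow> bool" where
  "Ck 0 f \<longleftrightarrow> continuous_on UNIV f"
| "Ck (Suc k) f \<longleftrightarrow> f differentiable_on UNIV \<and>
     (\<forall>b\<in>Basis. Ck k (\<lambda>x. frechet_derivative f (at x) b))"

definition test_functions :: "'a::euclidean_space set \<Rightarrow> ('a \<Rightarrow> real) set" where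
  "test_functions D = {\<phi>. (\<forall>k. Ck k \<phi>) \<and>
     compact (closure {x. \<phi> x \<noteq> 0}) \<and> closure {x. \<phi> x \<noteq> 0} \<subseteq> D}"

definition locally_integrable :: "'a::euclidean_space set \<Rightarrow> ('a \<Rightarrow> 'c::euclidean_space) \<Rightarrow> bool" where
  "locally_integrable D f \<longleftrightarrow> (\<forall>K. compact K \<longrightarrow> K \<subseteq> D \<longrightarrow> integrable (lebesgue_on K) f)"

definition has_weak_grad ::
    "'a::euclidean_space set \<Rightarrow> ('a \<Rightarrow> real) \<Rightarrow> ('a \<Rightarrow> 'a) \<Rightarrow> bool" where
  "has_weak_grad D u g \<longleftrightarrow> locally_integrable D u \<and> locally_integrable D g \<and>
    (\<forall>\<phi>\<in>test_functions D. \<forall>b\<in>Basis.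
       (LINT x|lebesgue_on D. u x * frechet_derivative \<phi> (at x) b) =
       - (LINT x|lebesgue_on D. (g x \<bullet> b) * \<phi> x))"

text \<open>On an open set the weak gradient is unique up to null sets.\<close>

definition weak_grad :: "'a::euclidean_space set \<Rightarrow> ('a \<Rightarrow> real) \<Rightarrow> 'a \<Rightarrow> 'a" where
  "weak_grad D u = (SOME g. has_weak_grad D u g)"

definition W1p :: "real \<Rightarrow> 'a::euclidean_space set \<Rightarrow> ('a \<Rightarrow> real) set" where
  "W1p p D = {u \<in> Lp p (lebesgue_on D). \<exists>g \<in> Lp p (lebesgue_on D). has_weak_grad D u g}"

definition W1inf :: "'a::euclidean_space set \<Rightarrow> ('a \<Rightarrow> real) set" where
  "W1inf D = {u \<in> Linf (lebesgue_on D). \<exists>g \<in> Linf (lebesgue_on D). has_weak_grad D u g}"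

definition W1inf_norm :: "'a::euclidean_space set \<Rightarrow> ('a \<Rightarrow> real) \<Rightarrow> real" where
  "W1inf_norm D u = Linf_norm (lebesgue_on D) u + Linf_norm (lebesgue_on D) (weak_grad D u)"

abbreviation H1 :: "'a::euclidean_space set \<Rightarrow> ('a \<Rightarrow> real) set" where
  "H1 \<equiv> W1p 2"

definition H1_norm :: "'a::euclidean_space set \<Rightarrow> ('a \<Rightarrow> real) \<Rightarrow> real" where
  "H1_norm D u =
    sqrt ((Lp_norm 2 (lebesgue_on D) u)\<^sup>2 + (Lp_norm 2 (lebesgue_on D) (weak_grad D u))\<^sup>2)"

text \<open>
  The Sobolev--Slobodeckij space of order \<open>\<sigma>\<close> with \<open>1 < \<sigma> < 2\<close>: functions in \<open>W1p p D\<close> whose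
  gradient has a finite Gagliardo seminorm of order \<open>\<sigma> - 1\<close>.
\<close>

definition slobodeckij :: "real \<Rightarrow> real \<Rightarrow> 'a::euclidean_space set \<Rightarrow> ('a \<Rightarrow> real) set" where
  "slobodeckij \<sigma> p D = {u \<in> W1p p D.
     integrable (lebesgue_on (D \<times> D))
       (\<lambda>(x, y). norm (weak_grad D u x - weak_grad D u y) powr p /
                 norm (x - y) powr (real DIM('a) + (\<sigma> - 1) * p))}"

text \<open>
  The dual of \<open>H1 D\<close>. A functional is a map on all functions, of which only the values on \<open>H1 D\<close>
  matter; boundedness and linearity make it respect almost everywhere equality there.
\<close>

definition H1_dual :: "'a::euclidean_space set \<Rightarrow> (('a \<Rightarrow> real) \<Rightarrow> real) set" where
  "H1_dual D = {l.
     (\<forall>u\<in>H1 D. \<forall>v\<in>H1 D. l (\<lambda>x. u x + v x) = l u + l v) \<and>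
     (\<forall>c. \<forall>u\<in>H1 D. l (\<lambda>x. c * u x) = c * l u) \<and>
     (\<exists>B. \<forall>u\<in>H1 D. \<bar>l u\<bar> \<le> B * H1_norm D u)}"

definition H1_dual_norm :: "'a::euclidean_space set \<Rightarrow> (('a \<Rightarrow> real) \<Rightarrow> real) \<Rightarrow> real" where
  "H1_dual_norm D l = (SUP u\<in>{u \<in> H1 D. H1_norm D u \<le> 1}. \<bar>l u\<bar>)"

section \<open>Bochner spaces on a time interval\<close>

text \<open>
  \<open>X\<close> is a space of real-valued functions (on \<open>D\<close>, or on \<open>H1 D\<close> for the dual space) and \<open>nrm\<close> its
  norm. Strong measurability: almost everywhere limit, in norm, of simple functions.
\<close>

definition simple_into :: "('b \<Rightarrow> real) set \<Rightarrow> real \<Rightarrow> (real \<Rightarrow> 'b \<Rightarrow> real) \<Rightarrow> bool" where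
  "simple_into X T s \<longleftrightarrow> finite (s ` {0<..<T}) \<and> s ` {0<..<T} \<subseteq> X \<and>
     (\<forall>y. {t \<in> {0<..<T}. s t = y} \<in> sets lebesgue)"

definition strongly_measurable ::
    "('b \<Rightarrow> real) set \<Rightarrow> (('b \<Rightarrow> real) \<Rightarrow> real) \<Rightarrow> real \<Rightarrow> (real \<Rightarrow> 'b \<Rightarrow> real) \<Rightarrow> bool" where
  "strongly_measurable X nrm T u \<longleftrightarrow>
     (AE t in lebesgue_on {0<..<T}. u t \<in> X) \<and>
     (\<exists>s. (\<forall>k. simple_into X T (s k)) \<and>
        (AE t in lebesgue_on {0<..<T}. (\<lambda>k. nrm (\<lambda>x. s k t x - u t x)) \<longlonglongrightarrow> 0))"

definition Bochner_L2 ::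
    "('b \<Rightarrow> real) set \<Rightarrow> (('b \<Rightarrow> real) \<Rightarrow> real) \<Rightarrow> real \<Rightarrow> (real \<Rightarrow> 'b \<Rightarrow> real) set" where
  "Bochner_L2 X nrm T =
     {u. strongly_measurable X nrm T u \<and> (\<lambda>t. nrm (u t)) \<in> Lp 2 (lebesgue_on {0<..<T})}"

definition Bochner_L2_norm ::
    "(('b \<Rightarrow> real) \<Rightarrow> real) \<Rightarrow> real \<Rightarrow> (real \<Rightarrow> 'b \<Rightarrow> real) \<Rightarrow> real" where
  "Bochner_L2_norm nrm T u = Lp_norm 2 (lebesgue_on {0<..<T}) (\<lambda>t. nrm (u t))"

definition Bochner_Linf ::
    "('b \<Rightarrow> real) set \<Rightarrow> (('b \<Rightarrow> real) \<Rightarrow> real) \<Rightarrow> real \<Rightarrow> (real \<Rightarrow> 'b \<Rightarrow> real) set" where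
  "Bochner_Linf X nrm T =
     {u. strongly_measurable X nrm T u \<and> (\<lambda>t. nrm (u t)) \<in> Linf (lebesgue_on {0<..<T})}"

definition Bochner_Linf_norm ::
    "(('b \<Rightarrow> real) \<Rightarrow> real) \<Rightarrow> real \<Rightarrow> (real \<Rightarrow> 'b \<Rightarrow> real) \<Rightarrow> real" where
  "Bochner_Linf_norm nrm T u = Linf_norm (lebesgue_on {0<..<T}) (\<lambda>t. nrm (u t))"

section \<open>Weak solutions\<close>

text \<open>
  \<open>w\<close> is the distributional time derivative of \<open>u\<close> with values in the dual of \<open>H1 D\<close>, where \<open>u t\<close> is
  embedded into the dual through the inner product of \<open>L\<^sup>2(D)\<close>; the identity of dual elements
  \<open>\<integral> u(t) \<eta>'(t) dt = - \<integral> w(t) \<eta>(t) dt\<close> is tested against all \<open>\<phi>\<close>.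
\<close>

definition has_time_derivative ::
    "'a::euclidean_space set \<Rightarrow> real \<Rightarrow> (real \<Rightarrow> 'a \<Rightarrow> real) \<Rightarrow> (real \<Rightarrow> ('a \<Rightarrow> real) \<Rightarrow> real) \<Rightarrow> bool"
  where
  "has_time_derivative D T u w \<longleftrightarrow>
     (\<forall>\<eta>\<in>test_functions {0<..<T}. \<forall>\<phi>\<in>H1 D.
        (LINT t|lebesgue_on {0<..<T}. (LINT x|lebesgue_on D. u t x * \<phi> x) * deriv \<eta> t) =
        - (LINT t|lebesgue_on {0<..<T}. w t \<phi> * \<eta> t))"

definition weak_solution ::
    "'a::euclidean_space set \<Rightarrow> real \<Rightarrow> (real \<Rightarrow> real) \<Rightarrow> (real \<Rightarrow> 'a \<Rightarrow> real) \<Rightarrow> (real \<Rightarrow> 'a \<Rightarrow> real) \<Rightarrow>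
     (real \<Rightarrow> 'a \<Rightarrow> real) \<Rightarrow> (real \<Rightarrow> 'a \<Rightarrow> real) \<Rightarrow> bool" where
  "weak_solution D T f \<alpha> \<beta> V u \<longleftrightarrow>
     u \<in> Bochner_L2 (H1 D) (H1_norm D) T \<and>
     (\<exists>w \<in> Bochner_L2 (H1_dual D) (H1_dual_norm D) T. has_time_derivative D T u w \<and>
       (\<forall>\<phi>\<in>H1 D. AE t in lebesgue_on {0<..<T}.
          w t \<phi>
          - (LINT x|lebesgue_on D.
               (- weak_grad D (u t) x + f (u t x) *\<^sub>R weak_grad D (V t) x) \<bullet> weak_grad D \<phi> x)
          + (LINT x|lebesgue_on D. \<beta> t x * u t x * \<phi> x)
          - (LINT x|lebesgue_on D. \<alpha> t x * f (u t x) * \<phi> x) = 0))"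

text \<open>
  The initial value is attained by the representative of \<open>u\<close> in \<open>C([0,T]; L\<^sup>2(D))\<close>.
\<close>

definition has_initial_value ::
    "'a::euclidean_space set \<Rightarrow> real \<Rightarrow> (real \<Rightarrow> 'a \<Rightarrow> real) \<Rightarrow> ('a \<Rightarrow> real) \<Rightarrow> bool" where
  "has_initial_value D T u u0 \<longleftrightarrow>
     (\<exists>v. (\<forall>t\<in>{0..T}. v t \<in> Lp 2 (lebesgue_on D)) \<and>
          (\<forall>t\<in>{0..T}. ((\<lambda>s. Lp_norm 2 (lebesgue_on D) (\<lambda>x. v s x - v t x)) \<longlongrightarrow> 0)
                        (at t within {0..T})) \<and>
          (AE t in lebesgue_on {0<..<T}. AE x in lebesgue_on D. v t x = u t x) \<and>
          (AE x in lebesgue_on D. v 0 x = u0 x))"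

definition admissible_data ::
    "'a::euclidean_space set \<Rightarrow> real \<Rightarrow> real \<Rightarrow> real \<Rightarrow> real \<Rightarrow>
     (real \<Rightarrow> 'a \<Rightarrow> real) \<Rightarrow> (real \<Rightarrow> 'a \<Rightarrow> real) \<Rightarrow> (real \<Rightarrow> 'a \<Rightarrow> real) \<Rightarrow> ('a \<Rightarrow> real) \<Rightarrow> bool"
  where
  "admissible_data D T p \<alpha>0 \<beta>0 \<alpha> \<beta> V u0 \<longleftrightarrow>
     (\<lambda>(t, x). \<alpha> t x) \<in> Linf (lebesgue_on ({0<..<T} \<times> D)) \<and>
     (\<lambda>(t, x). \<beta> t x) \<in> Linf (lebesgue_on ({0<..<T} \<times> D)) \<and>
     (AE (t, x) in lebesgue_on ({0<..<T} \<times> D). \<alpha>0 \<le> \<alpha> t x) \<and>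
     (AE (t, x) in lebesgue_on ({0<..<T} \<times> D). \<beta>0 \<le> \<beta> t x) \<and>
     V \<in> Bochner_Linf (W1inf D) (W1inf_norm D) T \<and>
     u0 \<in> slobodeckij (2 - 2 / p) p D \<and>
     (AE x in lebesgue_on D. 0 \<le> u0 x \<and> u0 x \<le> 1)"

text \<open>The data norms on which the constants of a stability estimate may depend are at most \<open>M\<close>.\<close>

definition data_bounded ::
    "'a::euclidean_space set \<Rightarrow> real \<Rightarrow> real \<Rightarrow>
     (real \<Rightarrow> 'a \<Rightarrow> real) \<Rightarrow> (real \<Rightarrow> 'a \<Rightarrow> real) \<Rightarrow> (real \<Rightarrow> 'a \<Rightarrow> real) \<Rightarrow> bool" where
  "data_bounded D T M \<alpha> \<beta> V \<longleftrightarrow>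
     Linf_norm (lebesgue_on ({0<..<T} \<times> D)) (\<lambda>(t, x). \<alpha> t x) \<le> M \<and>
     Linf_norm (lebesgue_on ({0<..<T} \<times> D)) (\<lambda>(t, x). \<beta> t x) \<le> M \<and>
     Bochner_Linf_norm (W1inf_norm D) T V \<le> M"

end

theory Submission
  imports Defs
begin

text \<open>
  The difference \<open>d = u\<^sub>1 - u\<^sub>2\<close> is tested with itself. Since \<open>f\<close> is Lipschitz with \<open>f 0 = 0\<close>, all terms
  in which the data differ are bounded by the difference of the data times \<open>\<bar>u\<^sub>2\<bar>\<close>; an \<open>L\<^sup>2\<close> energy
  estimate for \<open>u\<^sub>2\<close> alone controls them, in place of the bounds \<open>0 \<le> u\<^sub>2 \<le> 1\<close>. Gronwall's inequality then gives the claim.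

  The chain rule for \<open>\<parallel>d(t)\<parallel>\<^sup>2\<close> is replaced by an inequality: with the representative \<open>v\<close> of \<open>d\<close> that is
  continuous in \<open>L\<^sup>2\<close>, one has \<open>\<parallel>v(s)\<parallel>\<^sup>2 - \<parallel>v(s-h)\<parallel>\<^sup>2 \<le> 2 (v(s) - v(s-h), v(s))\<close>. Here \<open>v(s) = d(s)\<close> is
  approximated by functions that are simple in time, for which the difference quotients of \<open>v\<close>
  converge weakly to the time derivative, and \<open>h\<close> tends to \<open>0\<close> under the time integral.
\<close>

section \<open>Square-integrable and essentially bounded functions\<close>

text \<open>The weak form provides, for each fixed test function, an identity outside a null set of
  times that depends on that function, while the energy argument inserts the time-dependent value
  d(t) itself. Strong measurability bridges this: d(t) is a limit of members of a countable set, and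
  the functionals involved are bounded on H1. The second obstacle is that the increment v(s) -
  v(s-h) is controlled only in the dual norm, through the time derivative; Young's inequality with a
  small weight on the squared dual norm turns the H1 error of the simple approximation into an error
  that vanishes with it. The energy of the second solution starts below the volume of D and grows at
  most like exp(2CT); it enters the estimate for d as a source, and a second Gronwall factor
  exp(2CT) follows. With the factors 1 + T and T, each at most exp(T), this is the origin of the
  rate 4C + 2, where C depends only on the Lipschitz constant of f and on the common bound M of the
  data norms.\<close>

lemma complete_measure_lebesgue_on:
  assumes "S \<in> sets lebesgue"
  shows "complete_measure (lebesgue_on S)"
proof
  fix A B :: "'a set" assume "B \<subseteq> A" "A \<in> null_sets (lebesgue_on S)"
  then have "A \<subseteq> S" "A \<in> null_sets lebesgue"
    using assms by (auto simp: null_sets_restrict_space)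
  then have "B \<in> null_sets lebesgue" "B \<subseteq> S"
    using \<open>B \<subseteq> A\<close> completion.complete2 by blast+
  then show "B \<in> sets (lebesgue_on S)"
    using assms by (auto simp: sets_restrict_space)
qed

text \<open>Weak gradients, representatives and slices are determined only up to null sets;
  completeness lets measurability survive such a change.\<close>

lemma (in complete_measure) borel_measurable_AE_cong:
  fixes f g :: "'a \<Rightarrow> 'b::topological_space"
  assumes f: "f \<in> borel_measurable M" and ae: "AE x in M. f x = g x"
  shows "g \<in> borel_measurable M"
proof (rule measurableI)
  fix A :: "'b set" assume A: "A \<in> sets borel"
  have "f -` A \<inter> space M \<in> sets M" using measurable_sets[OF f A] .
  moreover have "AE x in M. x \<in> f -` A \<inter> space M \<longleftrightarrow> x \<in> g -` A \<inter> space M"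
    using ae by eventually_elim auto
  ultimately show "g -` A \<inter> space M \<in> sets M"
    by (intro in_sets_AE[where B="g -` A \<inter> space M"]) auto
qed auto

lemma (in complete_measure) borel_measurable_AE_limit:
  fixes f :: "nat \<Rightarrow> 'a \<Rightarrow> 'b::{banach, second_countable_topology}"
  assumes f: "\<And>i. f i \<in> borel_measurable M" and ae: "AE x in M. (\<lambda>i. f i x) \<longlonglongrightarrow> g x"
  shows "g \<in> borel_measurable M"
proof (rule borel_measurable_AE_cong)
  show "(\<lambda>x. lim (\<lambda>i. f i x)) \<in> borel_measurable M" using f by measurable
  show "AE x in M. lim (\<lambda>i. f i x) = g x"
    using ae by eventually_elim (rule limI)
qed

section \<open>Square-integrable functions: products, Cauchy-Schwarz, triangle inequality\<close>

lemma Lp2_iff: "f \<in> Lp 2 M \<longleftrightarrow> f \<in> borel_measurable M \<and> integrable M (\<lambda>x. (norm (f x))\<^sup>2)"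
  unfolding Lp_def by simp

lemma Lp_norm_nonneg [simp]: "0 \<le> Lp_norm p M f"
  unfolding Lp_norm_def by simp

lemma Lp2_norm_power2: "(Lp_norm 2 M f)\<^sup>2 = (LINT x|M. (norm (f x))\<^sup>2)"
proof -
  have "0 \<le> (LINT x|M. (norm (f x))\<^sup>2)" by simp
  then have "((LINT x|M. (norm (f x))\<^sup>2) powr (1/2))\<^sup>2 = (LINT x|M. (norm (f x))\<^sup>2)"
    by (simp add: powr_half_sqrt)
  then show ?thesis unfolding Lp_norm_def by simp
qed

lemma Lp2_zero: "(\<lambda>x. 0) \<in> Lp 2 M"
  by (simp add: Lp2_iff)

lemma Lp2_scaleR:
  fixes f :: "'b \<Rightarrow> 'c::euclidean_space"
  shows "f \<in> Lp 2 M \<Longrightarrow> (\<lambda>x. c *\<^sub>R f x) \<in> Lp 2 M"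
  by (auto simp: Lp2_iff power_mult_distrib)

lemma Lp2_cmult:
  fixes f :: "'b \<Rightarrow> real"
  shows "f \<in> Lp 2 M \<Longrightarrow> (\<lambda>x. c * f x) \<in> Lp 2 M"
  using Lp2_scaleR[of f M c] by simp

lemma Lp2_integrable_norm_mult:
  fixes f :: "'b \<Rightarrow> 'c::euclidean_space" and g :: "'b \<Rightarrow> 'd::euclidean_space"
  assumes "f \<in> Lp 2 M" "g \<in> Lp 2 M"
  shows "integrable M (\<lambda>x. norm (f x) * norm (g x))"
proof (rule Bochner_Integration.integrable_bound)
  show "integrable M (\<lambda>x. (norm (f x))\<^sup>2 + (norm (g x))\<^sup>2)"
    using assms by (auto simp: Lp2_iff)
  show "(\<lambda>x. norm (f x) * norm (g x)) \<in> borel_measurable M"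
    using assms by (auto simp: Lp2_iff)
  have "a * b \<le> a\<^sup>2 + b\<^sup>2" if "0 \<le> a" "0 \<le> b" for a b :: real
  proof -
    have "2 * (a * b) \<le> a\<^sup>2 + b\<^sup>2" using sum_squares_bound[of a b] by simp
    moreover have "0 \<le> a * b" using that by simp
    ultimately show ?thesis by linarith
  qed
  then show "AE x in M. norm (norm (f x) * norm (g x)) \<le> norm ((norm (f x))\<^sup>2 + (norm (g x))\<^sup>2)"
    by (auto simp: abs_mult)
qed

lemma Lp2_integrable_inner:
  fixes f g :: "'b \<Rightarrow> 'c::euclidean_space"
  assumes "f \<in> Lp 2 M" "g \<in> Lp 2 M"
  shows "integrable M (\<lambda>x. f x \<bullet> g x)"
  by (rule Bochner_Integration.integrable_bound[OF Lp2_integrable_norm_mult[OF assms]])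
    (use assms in \<open>auto simp: Lp2_iff abs_mult Cauchy_Schwarz_ineq2\<close>)

lemma Lp2_integrable_mult:
  fixes f g :: "'b \<Rightarrow> real"
  assumes "f \<in> Lp 2 M" "g \<in> Lp 2 M"
  shows "integrable M (\<lambda>x. f x * g x)"
  using Lp2_integrable_inner[OF assms] by simp

lemma Lp2_add:
  fixes f g :: "'b \<Rightarrow> 'c::euclidean_space"
  assumes "f \<in> Lp 2 M" "g \<in> Lp 2 M"
  shows "(\<lambda>x. f x + g x) \<in> Lp 2 M"
proof -
  have "integrable M (\<lambda>x. (norm (f x))\<^sup>2 + 2 * (f x \<bullet> g x) + (norm (g x))\<^sup>2)"
    using assms Lp2_integrable_inner[OF assms] by (auto simp: Lp2_iff)
  moreover have "(norm (f x + g x))\<^sup>2 = (norm (f x))\<^sup>2 + 2 * (f x \<bullet> g x) + (norm (g x))\<^sup>2" for x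
    by (simp add: power2_norm_eq_inner inner_add_left inner_add_right inner_commute)
  ultimately show ?thesis using assms by (auto simp: Lp2_iff)
qed

lemma Lp2_diff:
  fixes f g :: "'b \<Rightarrow> 'c::euclidean_space"
  assumes "f \<in> Lp 2 M" "g \<in> Lp 2 M"
  shows "(\<lambda>x. f x - g x) \<in> Lp 2 M"
  using Lp2_add[OF assms(1) Lp2_scaleR[OF assms(2), of "-1"]] by simp

lemma Lp2_norm_scaleR:
  fixes f :: "'b \<Rightarrow> 'c::euclidean_space"
  shows "Lp_norm 2 M (\<lambda>x. c *\<^sub>R f x) = \<bar>c\<bar> * Lp_norm 2 M f"
proof (rule power2_eq_imp_eq)
  show "(Lp_norm 2 M (\<lambda>x. c *\<^sub>R f x))\<^sup>2 = (\<bar>c\<bar> * Lp_norm 2 M f)\<^sup>2"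
    by (simp add: Lp2_norm_power2 power_mult_distrib)
qed auto

lemma Lp2_norm_cmult: "Lp_norm 2 M (\<lambda>x. c * f x :: real) = \<bar>c\<bar> * Lp_norm 2 M f"
  using Lp2_norm_scaleR[of M c f] by simp

lemma Lp2_norm_minus_commute:
  fixes f g :: "'b \<Rightarrow> 'c::euclidean_space"
  shows "Lp_norm 2 M (\<lambda>x. f x - g x) = Lp_norm 2 M (\<lambda>x. g x - f x)"
  by (simp add: Lp_norm_def norm_minus_commute)

lemma Cauchy_Schwarz_norm:
  fixes f :: "'b \<Rightarrow> 'c::euclidean_space" and g :: "'b \<Rightarrow> 'd::euclidean_space"
  assumes "f \<in> Lp 2 M" "g \<in> Lp 2 M"
  shows "(LINT x|M. norm (f x) * norm (g x)) \<le> Lp_norm 2 M f * Lp_norm 2 M g"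
proof -
  define P where "P = (LINT x|M. norm (f x) * norm (g x))"
  define A where "A = Lp_norm 2 M f"
  define B where "B = Lp_norm 2 M g"
  have AB: "0 \<le> A" "0 \<le> B" "A\<^sup>2 = (LINT x|M. (norm (f x))\<^sup>2)" "B\<^sup>2 = (LINT x|M. (norm (g x))\<^sup>2)"
    by (auto simp: A_def B_def Lp2_norm_power2)
  have key: "2 * a * b * P \<le> a\<^sup>2 * A\<^sup>2 + b\<^sup>2 * B\<^sup>2" for a b
  proof -
    have "0 \<le> (LINT x|M. (a * norm (f x) - b * norm (g x))\<^sup>2)" by simp
    also have "\<dots> = (LINT x|M. a\<^sup>2 * (norm (f x))\<^sup>2 + b\<^sup>2 * (norm (g x))\<^sup>2 - (2 * a * b) * (norm (f x) * norm (g x)))"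
      by (rule Bochner_Integration.integral_cong) (auto simp: power2_eq_square algebra_simps)
    also have "\<dots> = a\<^sup>2 * A\<^sup>2 + b\<^sup>2 * B\<^sup>2 - 2 * a * b * P"
      using assms Lp2_integrable_norm_mult[OF assms] unfolding AB P_def Lp2_iff
      by (subst Bochner_Integration.integral_diff; (subst Bochner_Integration.integral_add)?; auto)
    finally show ?thesis by simp
  qed
  \<comment> \<open>The weights B + e and A + e stay positive even if a norm vanishes, so they can
    be cancelled; e then tends to 0.\<close>
  have "P \<le> (A + e) * (B + e)" if "e > 0" for e
  proof -
    have p: "0 < A + e" "0 < B + e" using AB that by auto
    have "2 * (B + e) * (A + e) * P \<le> (B+e)\<^sup>2 * A\<^sup>2 + (A+e)\<^sup>2 * B\<^sup>2" by (rule key)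
    also have "\<dots> \<le> (B+e)\<^sup>2 * (A+e)\<^sup>2 + (A+e)\<^sup>2 * (B+e)\<^sup>2"
      using AB that by (intro add_mono mult_left_mono power_mono) auto
    also have "\<dots> = 2 * (B + e) * (A + e) * ((A + e) * (B + e))" by (simp add: power2_eq_square)
    finally show ?thesis using p by simp
  qed
  then have "\<forall>\<^sub>F e in at_right 0. P \<le> (A + e) * (B + e)"
    by (auto simp: eventually_at_right_less intro: eventually_mono[OF eventually_at_right_less])
  moreover have "((\<lambda>e. (A + e) * (B + e)) \<longlongrightarrow> (A + 0) * (B + 0)) (at_right 0)"
    by (intro tendsto_intros)
  ultimately have "P \<le> (A + 0) * (B + 0)"
    using tendsto_lowerbound by (metis trivial_limit_at_right_real)
  then show ?thesis by (simp add: P_def A_def B_def)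
qed

lemma Cauchy_Schwarz_Lp2:
  fixes f g :: "'b \<Rightarrow> 'c::euclidean_space"
  assumes "f \<in> Lp 2 M" "g \<in> Lp 2 M"
  shows "\<bar>LINT x|M. f x \<bullet> g x\<bar> \<le> Lp_norm 2 M f * Lp_norm 2 M g"
proof -
  have "\<bar>LINT x|M. f x \<bullet> g x\<bar> \<le> (LINT x|M. norm (f x) * norm (g x))"
    using Lp2_integrable_norm_mult[OF assms] Lp2_integrable_inner[OF assms]
    by (intro order_trans[OF integral_abs_bound] integral_mono) (auto simp: Cauchy_Schwarz_ineq2)
  then show ?thesis using Cauchy_Schwarz_norm[OF assms] by simp
qed

lemma Cauchy_Schwarz_Lp2_real:
  fixes f g :: "'b \<Rightarrow> real"
  assumes "f \<in> Lp 2 M" "g \<in> Lp 2 M"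
  shows "\<bar>LINT x|M. f x * g x\<bar> \<le> Lp_norm 2 M f * Lp_norm 2 M g"
  using Cauchy_Schwarz_Lp2[OF assms] by simp

lemma Lp2_norm_triangle:
  fixes f g :: "'b \<Rightarrow> 'c::euclidean_space"
  assumes "f \<in> Lp 2 M" "g \<in> Lp 2 M"
  shows "Lp_norm 2 M (\<lambda>x. f x + g x) \<le> Lp_norm 2 M f + Lp_norm 2 M g"
proof (rule power2_le_imp_le)
  have "(Lp_norm 2 M (\<lambda>x. f x + g x))\<^sup>2 = (LINT x|M. (norm (f x))\<^sup>2 + 2 * (f x \<bullet> g x) + (norm (g x))\<^sup>2)"
    unfolding Lp2_norm_power2
    by (simp add: power2_norm_eq_inner inner_add_left inner_add_right inner_commute ac_simps)
  also have "\<dots> = (Lp_norm 2 M f)\<^sup>2 + 2 * (LINT x|M. f x \<bullet> g x) + (Lp_norm 2 M g)\<^sup>2"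
    using assms Lp2_integrable_inner[OF assms] by (simp add: Lp2_iff Lp2_norm_power2)
  also have "\<dots> \<le> (Lp_norm 2 M f + Lp_norm 2 M g)\<^sup>2"
    using Cauchy_Schwarz_Lp2[OF assms] by (simp add: power2_sum)
  finally show "(Lp_norm 2 M (\<lambda>x. f x + g x))\<^sup>2 \<le> (Lp_norm 2 M f + Lp_norm 2 M g)\<^sup>2" .
qed simp

lemma Lp2_norm_cong_AE:
  fixes f g :: "'b \<Rightarrow> 'c::euclidean_space"
  assumes "f \<in> borel_measurable M" "g \<in> borel_measurable M" "AE x in M. f x = g x"
  shows "Lp_norm 2 M f = Lp_norm 2 M g"
  unfolding Lp_norm_def by (intro arg_cong2[where f="(powr)"] integral_cong_AE) (use assms in auto)

lemma Lp2_bounded_scaleR: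
  fixes m :: "'b \<Rightarrow> real" and f :: "'b \<Rightarrow> 'c::euclidean_space"
  assumes "m \<in> borel_measurable M" "AE x in M. \<bar>m x\<bar> \<le> c" "f \<in> Lp 2 M"
  shows "(\<lambda>x. m x *\<^sub>R f x) \<in> Lp 2 M"
  unfolding Lp2_iff
proof
  show meas: "(\<lambda>x. m x *\<^sub>R f x) \<in> borel_measurable M" using assms by (auto simp: Lp2_iff)
  show "integrable M (\<lambda>x. (norm (m x *\<^sub>R f x))\<^sup>2)"
  proof (rule Bochner_Integration.integrable_bound)
    show "integrable M (\<lambda>x. c\<^sup>2 * (norm (f x))\<^sup>2)" using assms by (auto simp: Lp2_iff)
    show "AE x in M. norm ((norm (m x *\<^sub>R f x))\<^sup>2) \<le> norm (c\<^sup>2 * (norm (f x))\<^sup>2)"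
      using assms(2) by eventually_elim
        (auto simp: power_mult_distrib abs_mult intro!: mult_right_mono power_mono abs_le_square_iff[THEN iffD1])
  qed (rule borel_measurable_power, rule measurable_compose[OF meas borel_measurable_norm])
qed

lemma Lp2_bounded_mult:
  fixes m f :: "'b \<Rightarrow> real"
  assumes "m \<in> borel_measurable M" "AE x in M. \<bar>m x\<bar> \<le> c" "f \<in> Lp 2 M"
  shows "(\<lambda>x. m x * f x) \<in> Lp 2 M"
  using Lp2_bounded_scaleR[OF assms] by simp

lemma Lp2_bound:
  fixes f :: "'b \<Rightarrow> 'c::euclidean_space" and g :: "'b \<Rightarrow> 'd::euclidean_space"
  assumes "f \<in> Lp 2 M" "g \<in> borel_measurable M" "AE x in M. norm (g x) \<le> c * norm (f x)"
  shows "g \<in> Lp 2 M"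
  unfolding Lp2_iff
proof
  show "integrable M (\<lambda>x. (norm (g x))\<^sup>2)"
  proof (rule Bochner_Integration.integrable_bound)
    show "integrable M (\<lambda>x. c\<^sup>2 * (norm (f x))\<^sup>2)" using assms by (auto simp: Lp2_iff)
    show "AE x in M. norm ((norm (g x))\<^sup>2) \<le> norm (c\<^sup>2 * (norm (f x))\<^sup>2)"
      using assms(3)
      by eventually_elim (auto simp: power_mult_distrib[symmetric] intro!: power_mono)
  qed (use assms in auto)
qed (use assms in auto)

section \<open>Essential suprema\<close>

lemma Linf_AE_bound:
  assumes "f \<in> Linf M"
  shows "AE x in M. norm (f x) \<le> Linf_norm M f"
proof -
  let ?e = "esssup M (\<lambda>x. ereal (norm (f x)))"
  obtain c where c: "AE x in M. norm (f x) \<le> c" and f: "f \<in> borel_measurable M"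
    using assms by (auto simp: Linf_def)
  have "?e \<le> ereal c" using f c by (intro esssup_I) auto
  moreover have "AE x in M. ereal (norm (f x)) \<le> ?e" by (rule esssup_AE)
  ultimately show ?thesis
    unfolding Linf_norm_def
    by (cases ?e) auto
qed

text \<open>\<open>real_of_ereal\<close> sends infinite values to 0, so only a finite negative
  essential supremum could violate the claim. It would make a norm negative almost everywhere, hence
  the space null, and on a null space the essential supremum is minus infinity.\<close>

lemma Linf_norm_nonneg [simp]: "0 \<le> Linf_norm M f"
proof (cases "\<exists>r. esssup M (\<lambda>x. ereal (norm (f x))) = ereal r \<and> r < 0")
  case True
  then obtain r where r: "esssup M (\<lambda>x. ereal (norm (f x))) = ereal r" "r < 0" by auto
  then have f: "(\<lambda>x. ereal (norm (f x))) \<in> borel_measurable M"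
    unfolding esssup_def by (auto simp: top_ereal_def split: if_splits)
  have "AE x in M. ereal (norm (f x)) \<le> ereal r" using esssup_AE r by metis
  then have "AE x in M. False"
  proof eventually_elim
    case (elim x)
    then have "norm (f x) \<le> r" by simp
    then have "norm (f x) < 0" using r(2) by linarith
    then show ?case by (simp only: norm_not_less_zero)
  qed
  then have "emeasure M (space M) = 0"
    by (metis ae_filter_eq_bot_iff eventually_False)
  then have "esssup M (\<lambda>x. ereal (norm (f x))) = -\<infinity>" by (rule esssup_zero_space) fact
  then show ?thesis using r by simp
next
  case False
  then show ?thesis unfolding Linf_norm_def
    by (cases "esssup M (\<lambda>x. ereal (norm (f x)))") (auto simp: not_less)
qed

text \<open>The condition \<open>0 \<le> c\<close> covers spaces of measure zero, where the
  essential supremum is minus infinity and its real value is 0.\<close>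

lemma Linf_norm_le:
  assumes "f \<in> borel_measurable M" "AE x in M. norm (f x) \<le> c" "0 \<le> c"
  shows "Linf_norm M f \<le> c"
proof -
  have "esssup M (\<lambda>x. ereal (norm (f x))) \<le> ereal c" using assms by (intro esssup_I) auto
  then show ?thesis unfolding Linf_norm_def using assms(3)
    by (cases "esssup M (\<lambda>x. ereal (norm (f x)))") auto
qed

lemma Linf_add:
  fixes f g :: "'b \<Rightarrow> 'c::euclidean_space"
  assumes "f \<in> Linf M" "g \<in> Linf M"
  shows "(\<lambda>x. f x + g x) \<in> Linf M" "Linf_norm M (\<lambda>x. f x + g x) \<le> Linf_norm M f + Linf_norm M g"
proof -
  have m: "f \<in> borel_measurable M" "g \<in> borel_measurable M" using assms by (auto simp: Linf_def)
  have ae: "AE x in M. norm (f x + g x) \<le> Linf_norm M f + Linf_norm M g"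
    using Linf_AE_bound[OF assms(1)] Linf_AE_bound[OF assms(2)]
    by eventually_elim (intro norm_triangle_le, linarith)
  then show "(\<lambda>x. f x + g x) \<in> Linf M" using m by (auto simp: Linf_def)
  show "Linf_norm M (\<lambda>x. f x + g x) \<le> Linf_norm M f + Linf_norm M g"
    using ae m by (intro Linf_norm_le) auto
qed

lemma Linf_scaleR:
  fixes f :: "'b \<Rightarrow> 'c::euclidean_space"
  assumes "f \<in> Linf M"
  shows "(\<lambda>x. c *\<^sub>R f x) \<in> Linf M" "Linf_norm M (\<lambda>x. c *\<^sub>R f x) \<le> \<bar>c\<bar> * Linf_norm M f"
proof -
  have m: "f \<in> borel_measurable M" using assms by (auto simp: Linf_def)
  have ae: "AE x in M. norm (c *\<^sub>R f x) \<le> \<bar>c\<bar> * Linf_norm M f"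
    using Linf_AE_bound[OF assms(1)] by eventually_elim (simp add: mult_left_mono)
  then show "(\<lambda>x. c *\<^sub>R f x) \<in> Linf M" using m by (auto simp: Linf_def)
  show "Linf_norm M (\<lambda>x. c *\<^sub>R f x) \<le> \<bar>c\<bar> * Linf_norm M f"
    using ae m by (intro Linf_norm_le) auto
qed

lemma Linf_zero: "(\<lambda>x. 0) \<in> Linf M"
  by (auto simp: Linf_def)

lemma Linf_norm_cong_AE:
  assumes "f \<in> borel_measurable M" "g \<in> borel_measurable M" "AE x in M. f x = g x"
  shows "Linf_norm M f = Linf_norm M g"
  unfolding Linf_norm_def by (intro arg_cong[where f=real_of_ereal] esssup_AE_cong) (use assms in auto)

section \<open>Smooth test functions\<close>

lemma frechet_derivative_real:
  "(f has_real_derivative D) (at x) \<Longrightarrow> frechet_derivative f (at x) 1 = D"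
  using frechet_derivative_at[of f "(*) D" x] by (simp add: has_field_derivative_def) (metis mult.right_neutral)

section \<open>Calculus of k times continuously differentiable functions\<close>

lemma Ck_Suc_imp: "Ck (Suc k) f \<Longrightarrow> Ck k f"
proof (induction k arbitrary: f)
  case 0
  then show ?case by (auto intro: differentiable_imp_continuous_on)
next
  case (Suc k)
  then show ?case by (metis Ck.simps(2))
qed

text \<open>The recursion in \<open>Ck\<close> refers to the derivative picked by
  \<open>frechet_derivative\<close>; uniqueness of derivatives lets any explicit formula take its
  place.\<close>

lemma Ck_derivI:
  assumes "\<And>x. (f has_derivative f' x) (at x)" "\<And>b. b \<in> Basis \<Longrightarrow> Ck k (\<lambda>x. f' x b)"
  shows "Ck (Suc k) f"
proof -
  have "frechet_derivative f (at x) = f' x" for x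
    using frechet_derivative_at[OF assms(1)] by simp
  then show ?thesis using assms by (auto simp: differentiable_on_def differentiable_def)
qed

lemma Ck_real_derivI:
  assumes "\<And>x. (f has_real_derivative f' x) (at x)" "Ck k f'"
  shows "Ck (Suc k) f"
  by (rule Ck_derivI[where f'="\<lambda>x. (*) (f' x)"]) (use assms in \<open>auto simp: has_field_derivative_def\<close>)

lemma Ck_SucD:
  assumes "Ck (Suc k) f"
  shows "(f has_derivative frechet_derivative f (at x)) (at x)" "b \<in> Basis \<Longrightarrow> Ck k (\<lambda>x. frechet_derivative f (at x) b)"
  using assms by (auto simp: differentiable_on_def frechet_derivative_works)

lemma Ck_const: "Ck k (\<lambda>x. c)"
proof (induction k arbitrary: c)
  case (Suc k)
  show ?case by (rule Ck_derivI[where f'="\<lambda>x y. 0"]) (auto intro: Suc)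
qed simp

lemma Ck_add: "Ck k f \<Longrightarrow> Ck k g \<Longrightarrow> Ck k (\<lambda>x. f x + g x)"
proof (induction k arbitrary: f g)
  case (Suc k)
  show ?case
    by (rule Ck_derivI[where f'="\<lambda>x y. frechet_derivative f (at x) y + frechet_derivative g (at x) y"])
      (auto intro!: has_derivative_add Ck_SucD Suc)
qed (auto intro: continuous_on_add)

lemma Ck_mult: "Ck k f \<Longrightarrow> Ck k g \<Longrightarrow> Ck k (\<lambda>x. f x * g x)"
proof (induction k arbitrary: f g)
  case (Suc k)
  show ?case
    by (rule Ck_derivI[where f'="\<lambda>x y. f x * frechet_derivative g (at x) y + frechet_derivative f (at x) y * g x"])
      (auto intro!: has_derivative_mult Ck_add Ck_SucD Suc Ck_Suc_imp[OF Suc.prems(1)] Ck_Suc_imp[OF Suc.prems(2)])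
qed (auto intro: continuous_on_mult)

lemma Ck_diff: "Ck k f \<Longrightarrow> Ck k g \<Longrightarrow> Ck k (\<lambda>x. f x - g x)"
  using Ck_add[of k f "\<lambda>x. -1 * g x"] Ck_mult[OF Ck_const[of k "-1"], of g] by simp

lemma Ck_power: "Ck k f \<Longrightarrow> Ck k (\<lambda>x. f x ^ n)"
  by (induction n) (auto intro: Ck_const Ck_mult)

lemma Ck_prod: "finite I \<Longrightarrow> (\<And>i. i \<in> I \<Longrightarrow> Ck k (f i)) \<Longrightarrow> Ck k (\<lambda>x. \<Prod>i\<in>I. f i x)"
  by (induction I rule: finite_induct) (auto intro: Ck_const Ck_mult)

lemma Ck_affine:
  fixes \<psi> :: "real \<Rightarrow> real" and v :: "'a::euclidean_space"
  shows "Ck k \<psi> \<Longrightarrow> Ck k (\<lambda>x. \<psi> (x \<bullet> v + c))"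
proof (induction k arbitrary: \<psi>)
  case 0
  then have "continuous_on UNIV \<psi>" by simp
  moreover have "continuous_on UNIV (\<lambda>x. x \<bullet> v + c)" by (intro continuous_intros)
  ultimately show ?case using continuous_on_compose2[of UNIV \<psi> UNIV "\<lambda>x. x \<bullet> v + c"] by simp
next
  case (Suc k)
  let ?d = "\<lambda>y. frechet_derivative \<psi> (at y)"
  show ?case
  proof (rule Ck_derivI[where f'="\<lambda>x y. ?d (x \<bullet> v + c) (y \<bullet> v)"])
    fix x
    have "((\<lambda>x. x \<bullet> v + c) has_derivative (\<lambda>y. y \<bullet> v)) (at x)"
      by (auto intro!: derivative_eq_intros)
    from has_derivative_compose[OF this Ck_SucD(1)[OF Suc.prems]]
    show "((\<lambda>x. \<psi> (x \<bullet> v + c)) has_derivative (\<lambda>y. ?d (x \<bullet> v + c) (y \<bullet> v))) (at x)" .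
  next
    fix b :: 'a
    have "linear (?d y)" for y using Ck_SucD(1)[OF Suc.prems] has_derivative_linear by blast
    then have "?d y (b \<bullet> v) = ?d y 1 * (b \<bullet> v)" for y
      using linear_cmul[of "?d y" "b \<bullet> v" 1] by simp
    moreover have "Ck k (\<lambda>x. ?d (x \<bullet> v + c) 1)"
      using Suc.IH[OF Ck_SucD(2)[OF Suc.prems, of 1]] by simp
    ultimately show "Ck k (\<lambda>x. ?d (x \<bullet> v + c) (b \<bullet> v))"
      using Ck_mult[OF _ Ck_const] by simp
  qed
qed

section \<open>Smooth bump functions supported in boxes\<close>

definition flat_exp :: "real poly \<Rightarrow> real \<Rightarrow> real" where
  "flat_exp p x = (if x > 0 then poly p (1 / x) * exp (- (1 / x)) else 0)"

text \<open>The free exponent n absorbs the factor x that appears in each step of the induction on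
  the coefficients.\<close>

lemma poly_times_exp_minus_tendsto_0:
  "((\<lambda>x::real. x ^ n * poly p x * exp (- x)) \<longlongrightarrow> 0) at_top"
proof (induction p arbitrary: n)
  case (pCons a p)
  have "((\<lambda>x::real. a * (x ^ n / exp x) + x ^ Suc n * poly p x * exp (- x)) \<longlongrightarrow> a * 0 + 0) at_top"
    by (intro tendsto_intros tendsto_power_div_exp_0 pCons)
  moreover have "a * (x ^ n / exp x) + x ^ Suc n * poly p x * exp (- x) = x ^ n * poly (pCons a p) x * exp (- x)" for x
    by (simp add: exp_minus field_simps)
  ultimately show ?case by simp
qed simp

text \<open>Carrying a polynomial in 1/x along makes the functions p(1/x) exp(-1/x), extended by
  zero, closed under differentiation: as 1/x has derivative -1/x^2, the polynomial p becomes y^2 (p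
  - p')(y) in y = 1/x. At 0 the right-hand difference quotient is y p(y) exp(-y) with y tending to
  infinity.\<close>

lemma flat_exp_has_derivative:
  "(flat_exp p has_real_derivative flat_exp ([:0, 0, 1:] * (p - pderiv p)) x) (at x)"
proof -
  consider "x < 0" | "x = 0" | "x > 0" by linarith
  then show ?thesis
  proof cases
    case 1
    have "((\<lambda>x. 0) has_real_derivative 0) (at x)" by simp
    then have "(flat_exp p has_real_derivative 0) (at x)"
      by (rule has_field_derivative_transform_within_open[where S="{..<0}"])
        (use 1 in \<open>auto simp: flat_exp_def\<close>)
    then show ?thesis using 1 by (simp add: flat_exp_def)
  next
    case 3
    have "((\<lambda>x. poly p (1 / x) * exp (- (1 / x))) has_real_derivative
        flat_exp ([:0, 0, 1:] * (p - pderiv p)) x) (at x)"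
      using 3 unfolding flat_exp_def
      by (auto intro!: derivative_eq_intros DERIV_chain2[OF poly_DERIV] simp: field_simps power2_eq_square)
    then show ?thesis
      by (rule has_field_derivative_transform_within_open[where S="{0<..}"])
        (use 3 in \<open>auto simp: flat_exp_def\<close>)
  next
    case 2
    have "((\<lambda>h. flat_exp p h / h) \<longlongrightarrow> 0) (at_left 0)"
      by (rule Lim_transform_eventually[OF tendsto_const])
        (auto simp: flat_exp_def eventually_at_filter)
    moreover have "((\<lambda>h. flat_exp p h / h) \<longlongrightarrow> 0) (at_right 0)"
    proof -
      have "((\<lambda>h. (1/h) ^ 1 * poly p (1/h) * exp (- (1/h))) \<longlongrightarrow> 0) (at_right (0::real))"
        by (rule filterlim_compose[OF poly_times_exp_minus_tendsto_0])
          (simp add: inverse_eq_divide[symmetric] filterlim_inverse_at_top_right)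
      then show ?thesis
        by (rule Lim_transform_eventually) (auto simp: flat_exp_def eventually_at_filter)
    qed
    ultimately have "((\<lambda>h. flat_exp p h / h) \<longlongrightarrow> 0) (at 0)" by (rule filterlim_split_at)
    then show ?thesis using 2 by (simp add: DERIV_def flat_exp_def)
  qed
qed

lemma Ck_flat_exp: "Ck k (flat_exp p)"
proof (induction k arbitrary: p)
  case 0
  show ?case
    using DERIV_isCont[OF flat_exp_has_derivative] by (simp add: continuous_on_eq_continuous_at)
next
  case (Suc k)
  show ?case by (rule Ck_real_derivI[OF flat_exp_has_derivative Suc])
qed

definition box_bump :: "'a::euclidean_space \<Rightarrow> 'a \<Rightarrow> 'a \<Rightarrow> real" where
  "box_bump c d x = (\<Prod>b\<in>Basis. flat_exp 1 (x \<bullet> b - c \<bullet> b) * flat_exp 1 (d \<bullet> b - x \<bullet> b))"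

lemma flat_exp_1: "0 \<le> flat_exp 1 x" "flat_exp 1 x \<le> 1" "0 < flat_exp 1 x \<longleftrightarrow> 0 < x"
  by (auto simp: flat_exp_def)

lemma Ck_box_bump: "Ck k (box_bump c d)"
proof -
  have "Ck k (\<lambda>x. \<Prod>b\<in>Basis. flat_exp 1 (x \<bullet> b + (- (c \<bullet> b))) * flat_exp 1 (x \<bullet> (- b) + d \<bullet> b))"
    by (intro Ck_prod Ck_mult Ck_affine Ck_flat_exp) auto
  moreover have "box_bump c d = (\<lambda>x. \<Prod>b\<in>Basis. flat_exp 1 (x \<bullet> b + (- (c \<bullet> b))) * flat_exp 1 (x \<bullet> (- b) + d \<bullet> b))"
    by (auto simp: box_bump_def fun_eq_iff intro!: prod.cong)
  ultimately show ?thesis by simp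
qed

lemma box_bump_bounds: "0 \<le> box_bump c d x" "box_bump c d x \<le> 1"
  by (auto simp: box_bump_def flat_exp_1 intro!: prod_nonneg prod_le_1 mult_le_one)

lemma box_bump_pos_iff: "0 < box_bump c d x \<longleftrightarrow> x \<in> box c d"
proof
  assume pos: "0 < box_bump c d x"
  show "x \<in> box c d"
  proof (rule ccontr)
    assume "x \<notin> box c d"
    then obtain b where b: "b \<in> Basis" "\<not> c \<bullet> b < x \<bullet> b \<or> \<not> x \<bullet> b < d \<bullet> b"
      by (auto simp: mem_box)
    then have "flat_exp 1 (x \<bullet> b - c \<bullet> b) * flat_exp 1 (d \<bullet> b - x \<bullet> b) = 0"
      by (auto simp: flat_exp_def)
    then have "box_bump c d x = 0"
      unfolding box_bump_def using b(1) by (intro prod_zero) auto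
    then show False using pos by simp
  qed
next
  assume "x \<in> box c d"
  then show "0 < box_bump c d x"
    unfolding box_bump_def by (intro prod_pos) (auto simp: mem_box flat_exp_1)
qed

text \<open>The powers of 1 - \<open>box_bump\<close> tend to 0 exactly where the bump is positive.
  This gives smooth functions with values in [0, 1] that converge pointwise to the indicator of the
  open box while their support never leaves the closed box; they do the work of mollified
  indicators.\<close>

definition box_plateau :: "'a::euclidean_space \<Rightarrow> 'a \<Rightarrow> nat \<Rightarrow> 'a \<Rightarrow> real" where
  "box_plateau c d n x = 1 - (1 - box_bump c d x) ^ n"

lemma box_plateau_props:
  shows "Ck k (box_plateau c d n)" "0 \<le> box_plateau c d n x" "box_plateau c d n x \<le> 1"
    "x \<notin> box c d \<Longrightarrow> box_plateau c d n x = 0"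
    "(\<lambda>n. box_plateau c d n x) \<longlonglongrightarrow> indicator (box c d) x"
proof -
  note b = box_bump_bounds[of c d x]
  show "Ck k (box_plateau c d n)"
    unfolding box_plateau_def[abs_def] by (intro Ck_diff Ck_const Ck_power Ck_box_bump)
  show "0 \<le> box_plateau c d n x" "box_plateau c d n x \<le> 1"
    using b by (auto simp: box_plateau_def intro!: power_le_one)
  show z: "box_plateau c d n x = 0" if "x \<notin> box c d" for n
    using that b box_bump_pos_iff[of c d x] by (simp add: box_plateau_def)
  show "(\<lambda>n. box_plateau c d n x) \<longlonglongrightarrow> indicator (box c d) x"
  proof (cases "x \<in> box c d")
    case True
    then have "0 < box_bump c d x" by (simp add: box_bump_pos_iff)
    then have "\<bar>1 - box_bump c d x\<bar> < 1" using b(2) by linarith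
    then have "(\<lambda>n. (1 - box_bump c d x) ^ n) \<longlonglongrightarrow> 0"
      by (rule LIMSEQ_abs_realpow_zero2)
    then have "(\<lambda>n. 1 - (1 - box_bump c d x) ^ n) \<longlonglongrightarrow> 1 - 0" by (rule tendsto_diff[OF tendsto_const])
    then show ?thesis using True by (simp add: box_plateau_def)
  qed (use z in simp)
qed

lemma box_plateau_test_function:
  assumes "cbox c d \<subseteq> D"
  shows "box_plateau c d n \<in> test_functions D"
proof -
  have "{x. box_plateau c d n x \<noteq> 0} \<subseteq> cbox c d"
    using box_plateau_props(4) box_subset_cbox by blast
  then have "closure {x. box_plateau c d n x \<noteq> 0} \<subseteq> cbox c d" by (rule closure_minimal) (rule closed_cbox)
  then have "closure {x. box_plateau c d n x \<noteq> 0} \<subseteq> D" "compact (closure {x. box_plateau c d n x \<noteq> 0})"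
    using assms bounded_subset[OF bounded_cbox, of "closure {x. box_plateau c d n x \<noteq> 0}" c d]
    by (auto simp: compact_eq_bounded_closed)
  then show ?thesis by (auto simp: test_functions_def box_plateau_props)
qed

section \<open>Integration against test functions and the fundamental lemma\<close>

lemma test_function_support:
  assumes "\<phi> \<in> test_functions D"
  obtains K where "compact K" "K \<subseteq> D" "\<And>x. x \<notin> K \<Longrightarrow> \<phi> x = 0"
    "\<And>x b. x \<notin> K \<Longrightarrow> frechet_derivative \<phi> (at x) b = 0"
proof -
  let ?K = "closure {x. \<phi> x \<noteq> 0}"
  have z: "\<phi> x = 0" if "x \<notin> ?K" for x using that closure_subset[of "{x. \<phi> x \<noteq> 0}"] by auto
  \<comment> \<open>Off the closed support the function is zero on a neighbourhood, so one compact
    set serves the function and its derivatives.\<close>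
  have "frechet_derivative \<phi> (at x) b = 0" if "x \<notin> ?K" for x b
  proof -
    have "((\<lambda>x. 0) has_derivative (\<lambda>y. 0)) (at x)" by simp
    then have "(\<phi> has_derivative (\<lambda>y. 0)) (at x)"
    proof (rule has_derivative_transform_within_open)
      show "open (- ?K)" by (rule open_Compl) (rule closed_closure)
      show "x \<in> - ?K" using that by simp
      show "0 = \<phi> y" if "y \<in> - ?K" for y using z[of y] that by simp
    qed
    from frechet_derivative_at[OF this] show ?thesis by metis
  qed
  moreover have "compact ?K" "?K \<subseteq> D" using assms by (auto simp: test_functions_def)
  ultimately show ?thesis using z that by blast
qed

lemma test_function_continuous:
  assumes "\<phi> \<in> test_functions D"
  shows "continuous_on UNIV \<phi>" "b \<in> Basis \<Longrightarrow> continuous_on UNIV (\<lambda>x. frechet_derivative \<phi> (at x) b)"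
proof -
  have "Ck 0 \<phi>" "Ck (Suc 0) \<phi>" using assms by (auto simp: test_functions_def simp del: Ck.simps)
  then show "continuous_on UNIV \<phi>" "b \<in> Basis \<Longrightarrow> continuous_on UNIV (\<lambda>x. frechet_derivative \<phi> (at x) b)"
    by auto
qed

text \<open>The product vanishes off K, and on K the continuous factor is bounded, so integrability
  on D reduces to that of g on K.\<close>

lemma locally_integrable_times_continuous:
  fixes g :: "'a::euclidean_space \<Rightarrow> real"
  assumes D: "open D" and g: "locally_integrable D g" and \<psi>: "continuous_on UNIV \<psi>"
    and K: "compact K" "K \<subseteq> D" "\<And>x. x \<notin> K \<Longrightarrow> \<psi> x = 0"
  shows "integrable (lebesgue_on D) (\<lambda>x. g x * \<psi> x)"
proof -
  have Dm: "D \<in> sets lebesgue" and Km: "K \<in> sets lebesgue"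
    using D K(1) by (auto intro: lmeasurable_compact fmeasurableD)
  have "integrable (lebesgue_on K) g" using g K by (auto simp: locally_integrable_def)
  then have gi: "integrable lebesgue (\<lambda>x. indicator K x *\<^sub>R g x)"
    using Km by (simp add: integrable_restrict_space)
  obtain B where B: "\<And>x. x \<in> K \<Longrightarrow> \<bar>\<psi> x\<bar> \<le> B"
    using compact_imp_bounded[OF compact_continuous_image[OF continuous_on_subset[OF \<psi>] K(1)]]
    by (auto simp: bounded_iff)
  have "integrable lebesgue (\<lambda>x. (indicator K x *\<^sub>R g x) * \<psi> x)"
  proof (rule Bochner_Integration.integrable_bound[OF integrable_mult_right[OF gi, of B]])
    show "(\<lambda>x. (indicator K x *\<^sub>R g x) * \<psi> x) \<in> borel_measurable lebesgue"
      using gi \<psi> by (intro borel_measurable_times)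
        (auto simp: measurable_completion borel_measurable_continuous_onI)
    show "AE x in lebesgue. norm ((indicator K x *\<^sub>R g x) * \<psi> x) \<le> norm (B * (indicator K x *\<^sub>R g x))"
    proof (rule AE_I2)
      fix x show "norm ((indicator K x *\<^sub>R g x) * \<psi> x) \<le> norm (B * (indicator K x *\<^sub>R g x))"
      proof (cases "x \<in> K")
        case True
        then have "\<bar>\<psi> x\<bar> \<le> \<bar>B\<bar>" using B[OF True] by linarith
        then show ?thesis using True by (simp add: abs_mult mult.commute mult_right_mono)
      qed simp
    qed
  qed
  moreover have "(\<lambda>x. (indicator K x *\<^sub>R g x) * \<psi> x) = (\<lambda>x. indicator D x *\<^sub>R (g x * \<psi> x))"
    using K by (auto simp: fun_eq_iff indicator_def)
  ultimately show ?thesis using Dm by (simp add: integrable_restrict_space)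
qed

text \<open>Open boxes form an intersection-stable generator of the Borel sets, and the sets over
  which h integrates to 0 form a Dynkin system; the support condition makes the total integral one
  of the given ones, as complements require. The sets where h is positive or negative then force h =
  0 almost everywhere.\<close>

lemma AE_zero_if_box_integrals_zero:
  fixes h :: "'a::euclidean_space \<Rightarrow> real"
  assumes h: "integrable lebesgue h" and supp: "\<And>x. x \<notin> box a b \<Longrightarrow> h x = 0"
    and zero: "\<And>c d. (LINT x|lebesgue. indicator (box c d) x *\<^sub>R h x) = 0"
  shows "AE x in lebesgue. h x = 0"
proof -
  have inth: "(LINT x|lebesgue. h x) = 0"
  proof -
    have "(\<lambda>x. indicator (box a b) x *\<^sub>R h x) = h" using supp by (auto simp: fun_eq_iff indicator_def)
    then show ?thesis using zero[of a b] by simp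
  qed
  have si: "set_integrable lebesgue A h" if "A \<in> sets lebesgue" for A
    using h that unfolding set_integrable_def by (rule integrable_mult_indicator[rotated])
  let ?G = "range (\<lambda>(a, b). box a b) :: 'a set set"
  have sb: "sets borel = sigma_sets UNIV ?G" by (simp add: borel_eq_box)
  have all: "(LINT x:A|lebesgue. h x) = 0" if "A \<in> sets borel" for A
  proof -
    have "Int_stable ?G" by (auto simp: Int_stable_def box_Int_box)
    moreover have "?G \<subseteq> Pow UNIV" by simp
    moreover have "A \<in> sigma_sets UNIV ?G" using that sb by simp
    ultimately show ?thesis
    proof (induction rule: sigma_sets_induct_disjoint)
      case (basic A)
      then show ?case using zero by (auto simp: set_lebesgue_integral_def)
    next
      case empty
      then show ?case by (simp add: set_lebesgue_integral_def)
    next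
      case (compl A)
      then have A: "A \<in> sets lebesgue"
        using sb by auto
      have "(\<lambda>x. indicator (UNIV - A) x *\<^sub>R h x) = (\<lambda>x. h x - indicator A x *\<^sub>R h x)"
        by (auto simp: fun_eq_iff indicator_def)
      then have "(LINT x:UNIV - A|lebesgue. h x) = (LINT x|lebesgue. h x - indicator A x *\<^sub>R h x)"
        by (simp add: set_lebesgue_integral_def)
      also have "\<dots> = (LINT x|lebesgue. h x) - (LINT x:A|lebesgue. h x)"
        using h si[OF A] unfolding set_lebesgue_integral_def set_integrable_def
        by (intro Bochner_Integration.integral_diff)
      finally show ?case using inth compl by simp
    next
      case (union A)
      then have "A i \<in> sets borel" for i
        using sb by (metis range_subsetD)
      then have A: "A i \<in> sets lebesgue" for i by auto
      have "(LINT x:(\<Union>i. A i)|lebesgue. h x) = (\<Sum>i. LINT x:A i|lebesgue. h x)"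
        using union A by (intro lebesgue_integral_countable_add si)
          (auto simp: disjoint_family_on_def)
      then show ?case using union by simp
    qed
  qed
  \<comment> \<open>The sign sets must be Borel to fall under \<open>all\<close>, so they are taken
    from a Borel version of h.\<close>
  obtain h' where h': "h' \<in> borel_measurable lborel" and ae: "AE x in lborel. h x = h' x"
    using completion_ex_borel_measurable_real[of h lborel] h by auto
  have ae': "AE x in lebesgue. h x = h' x" using AE_completion[OF ae] .
  have half: "AE x in lebesgue. indicator S x *\<^sub>R (c * h x) = 0"
    if S: "S \<in> sets borel" and nn: "AE x in lebesgue. 0 \<le> indicator S x *\<^sub>R (c * h x)" for S c
  proof -
    have "S \<in> sets lebesgue" using S by simp
    from integrable_mult_right[OF si[OF this, unfolded set_integrable_def], of c]
    have "integrable lebesgue (\<lambda>x. indicator S x *\<^sub>R (c * h x))" by (simp add: mult.left_commute)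
    moreover have "(LINT x|lebesgue. indicator S x *\<^sub>R (c * h x)) = c * (LINT x:S|lebesgue. h x)"
      unfolding set_lebesgue_integral_def integral_mult_right_zero[symmetric] by (simp add: mult.left_commute)
    ultimately show ?thesis using integral_nonneg_eq_0_iff_AE[OF _ nn] all[OF S] by simp
  qed
  have "AE x in lebesgue. indicator {x. h' x > 0} x *\<^sub>R (1 * h x) = 0"
    using h' ae' by (intro half) (auto elim!: eventually_mono simp: indicator_def)
  moreover have "AE x in lebesgue. indicator {x. h' x < 0} x *\<^sub>R (- 1 * h x) = 0"
    using h' ae' by (intro half) (auto elim!: eventually_mono simp: indicator_def)
  ultimately show ?thesis using ae'
    by eventually_elim (auto simp: indicator_def split: if_splits)
qed

lemma locally_integrable_box:
  assumes "locally_integrable D g" "cbox c d \<subseteq> D"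
  shows "integrable lebesgue (\<lambda>x. indicator (cbox c d) x *\<^sub>R g x)"
proof -
  have "integrable (lebesgue_on (cbox c d)) g"
    using assms compact_cbox unfolding locally_integrable_def by blast
  then show ?thesis by (subst (asm) integrable_restrict_space) auto
qed

text \<open>By dominated convergence the plateau functions turn the hypothesis into vanishing
  integrals over every open box whose closed box lies in D. Inside one such box
  \<open>AE_zero_if_box_integrals_zero\<close> applies to g cut off to the open box, and D is a
  union of countably many closed boxes.\<close>

lemma fundamental_lemma_calculus_of_variations:
  fixes g :: "'a::euclidean_space \<Rightarrow> real"
  assumes D: "open D" and g: "locally_integrable D g"
    and zero: "\<And>\<phi>. \<phi> \<in> test_functions D \<Longrightarrow> (LINT x|lebesgue_on D. g x * \<phi> x) = 0"
  shows "AE x in lebesgue_on D. g x = 0"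
proof -
  have Dm: "D \<in> sets lebesgue" using D by auto
  have small: "(LINT x|lebesgue. indicator (box c d) x *\<^sub>R g x) = 0" if cd: "cbox c d \<subseteq> D" for c d
  proof -
    have gi: "integrable lebesgue (\<lambda>x. indicator (cbox c d) x *\<^sub>R g x)"
      using locally_integrable_box[OF g cd] .
    have e: "(LINT x|lebesgue. (indicator (cbox c d) x *\<^sub>R g x) * box_plateau c d n x) = 0" for n
    proof -
      have "(LINT x|lebesgue_on D. g x * box_plateau c d n x) = 0"
        using zero box_plateau_test_function[OF cd] by blast
      moreover have "(\<lambda>x. indicator D x *\<^sub>R (g x * box_plateau c d n x)) = (\<lambda>x. (indicator (cbox c d) x *\<^sub>R g x) * box_plateau c d n x)"
        using box_plateau_props(4)[of _ c d n] cd box_subset_cbox[of c d]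
        by (auto simp: fun_eq_iff indicator_def)
      ultimately show ?thesis using Dm by (simp add: integral_restrict_space)
    qed
    have "(\<lambda>n. LINT x|lebesgue. (indicator (cbox c d) x *\<^sub>R g x) * box_plateau c d n x) \<longlonglongrightarrow>
        (LINT x|lebesgue. (indicator (cbox c d) x *\<^sub>R g x) * indicator (box c d) x)"
    proof (rule integral_dominated_convergence[where w="\<lambda>x. norm (indicator (cbox c d) x *\<^sub>R g x)"])
      show "(\<lambda>x. (indicator (cbox c d) x *\<^sub>R g x) * indicator (box c d) x) \<in> borel_measurable lebesgue"
        using gi by (intro borel_measurable_times borel_measurable_indicator) auto
      show "(\<lambda>x. (indicator (cbox c d) x *\<^sub>R g x) * box_plateau c d n x) \<in> borel_measurable lebesgue" for n
        using gi box_plateau_props(1)[of 0 c d n]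
        by (intro borel_measurable_times) (auto simp: measurable_completion borel_measurable_continuous_onI)
      show "AE x in lebesgue. norm ((indicator (cbox c d) x *\<^sub>R g x) * box_plateau c d n x) \<le> norm (indicator (cbox c d) x *\<^sub>R g x)" for n
        using box_plateau_props(2,3)[of c d n] by (auto simp: abs_mult mult_left_le)
    qed (use gi in \<open>auto intro!: tendsto_mult tendsto_const box_plateau_props(5)\<close>)
    moreover have "(\<lambda>x. (indicator (cbox c d) x *\<^sub>R g x) * indicator (box c d) x) = (\<lambda>x. indicator (box c d) x *\<^sub>R g x)"
      using box_subset_cbox[of c d] by (auto simp: fun_eq_iff indicator_def)
    ultimately show ?thesis using e by (simp add: LIMSEQ_const_iff)
  qed
  have loc: "AE x in lebesgue. x \<in> cbox a b \<longrightarrow> g x = 0" if ab: "cbox a b \<subseteq> D" for a b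
  proof -
    let ?h = "\<lambda>x. indicator (box a b) x *\<^sub>R g x"
    have "integrable lebesgue (\<lambda>x. indicator (cbox a b) x *\<^sub>R g x)"
      using locally_integrable_box[OF g ab] .
    from integrable_mult_indicator[OF _ this, of "box a b"]
    have "integrable lebesgue (\<lambda>x. indicator (box a b) x *\<^sub>R indicator (cbox a b) x *\<^sub>R g x)" by simp
    moreover have "(\<lambda>x. indicator (box a b) x *\<^sub>R indicator (cbox a b) x *\<^sub>R g x) = ?h"
      using box_subset_cbox[of a b] by (auto simp: fun_eq_iff indicator_def)
    ultimately have hi: "integrable lebesgue ?h" by simp
    have "AE x in lebesgue. ?h x = 0"
    proof (rule AE_zero_if_box_integrals_zero[OF hi, of a b])
      fix c d :: 'a
      \<comment> \<open>The cut-off replaces box c d by its intersection with box a b. This is again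
        a box, and its closed box lies in D, as \<open>small\<close> demands.\<close>
      obtain c' d' where i: "box c d \<inter> box a b = box c' d'" "box c d \<inter> box a b \<noteq> {} \<Longrightarrow> cbox c' d' \<subseteq> cbox a b"
      proof -
        define c' :: 'a where "c' = (\<Sum>i\<in>Basis. max (c \<bullet> i) (a \<bullet> i) *\<^sub>R i)"
        define d' :: 'a where "d' = (\<Sum>i\<in>Basis. min (d \<bullet> i) (b \<bullet> i) *\<^sub>R i)"
        have "box c d \<inter> box a b = box c' d'"
          unfolding c'_def d'_def by (simp add: box_Int_box)
        moreover have "cbox c' d' \<subseteq> cbox a b"
          unfolding c'_def d'_def by (auto simp: mem_box)
        ultimately show ?thesis using that by blast
      qed
      have "(\<lambda>x. indicator (box c d) x *\<^sub>R ?h x) = (\<lambda>x. indicator (box c' d') x *\<^sub>R g x)"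
        unfolding i(1)[symmetric] by (auto simp: fun_eq_iff indicator_def)
      then show "(LINT x|lebesgue. indicator (box c d) x *\<^sub>R ?h x) = 0"
        using small[of c' d'] i ab by (cases "box c d \<inter> box a b = {}") auto
    qed auto
    \<comment> \<open>What the cut-off lost is the boundary of the box, a null set.\<close>
    moreover have "AE x in lebesgue. x \<notin> cbox a b - box a b"
    proof -
      have "cbox a b - box a b \<in> null_sets lebesgue"
        using negligible_frontier_interval[of a b] by (simp add: negligible_iff_null_sets)
      then show ?thesis by (rule AE_not_in)
    qed
    ultimately show ?thesis by eventually_elim (auto simp: indicator_def split: if_splits)
  qed
  obtain \<D> where \<D>: "countable \<D>" "\<D> \<subseteq> Pow D" "\<And>X. X \<in> \<D> \<Longrightarrow> \<exists>a b. X = cbox a b" "\<Union>\<D> = D"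
    using open_countable_Union_open_cbox[OF D] by metis
  have "AE x in lebesgue. \<forall>X\<in>\<D>. x \<in> X \<longrightarrow> g x = 0"
    using \<D> loc by (subst AE_ball_countable) (auto, metis PowD subsetD)
  then have "AE x in lebesgue. x \<in> D \<longrightarrow> g x = 0"
    by eventually_elim (use \<D>(4) in blast)
  then show ?thesis using Dm by (simp add: AE_restrict_space_iff)
qed

section \<open>Primitives and weak gradients\<close>

text \<open>A primitive of a bump on (-1, 1), normalised to rise from 0 to 1. Its rescaled
  derivatives are mollifiers, and differences of its rescaled translates approximate indicators of
  intervals.\<close>

lemma smooth_step:
  obtains S S' :: "real \<Rightarrow> real"
  where "\<And>k. Ck k S" "\<And>t. (S has_real_derivative S' t) (at t)"
    "continuous_on UNIV S'" "\<And>t. 0 \<le> S' t" "\<And>t. 1 \<le> \<bar>t\<bar> \<Longrightarrow> S' t = 0"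
    "\<And>t. t \<le> -1 \<Longrightarrow> S t = 0" "\<And>t. 1 \<le> t \<Longrightarrow> S t = 1" "\<And>t. 0 \<le> S t" "\<And>t. S t \<le> 1"
proof -
  define \<rho> :: "real \<Rightarrow> real" where "\<rho> = box_bump (-1) 1"
  have Ck\<rho>: "Ck k \<rho>" for k unfolding \<rho>_def by (rule Ck_box_bump)
  have nn: "0 \<le> \<rho> t" for t by (simp add: \<rho>_def box_bump_bounds)
  have pos: "0 < \<rho> t" if "-1 < t" "t < 1" for t
    using that by (simp add: \<rho>_def box_bump_pos_iff box_real)
  have zero: "\<rho> t = 0" if "1 \<le> \<bar>t\<bar>" for t
  proof -
    have "t \<notin> box (-1) 1" using that by (auto simp: box_real)
    then have "\<not> 0 < \<rho> t" by (simp add: \<rho>_def box_bump_pos_iff)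
    then show ?thesis using nn[of t] by linarith
  qed
  have cont: "continuous_on UNIV \<rho>" using Ck\<rho>[of 0] by simp
  obtain F where F: "\<And>t. (F has_real_derivative \<rho> t) (at t)"
  proof -
    have "\<exists>F. \<forall>x. - \<infinity> < ereal x \<longrightarrow> ereal x < \<infinity> \<longrightarrow> (F has_vector_derivative \<rho> x) (at x)"
      using cont by (intro einterval_antiderivative) (auto simp: continuous_on_eq_continuous_at)
    then show ?thesis using that by (auto simp: has_real_derivative_iff_has_vector_derivative)
  qed
  have mono: "F s \<le> F t" if "s \<le> t" for s t
    using DERIV_nonneg_imp_nondecreasing[OF that] F nn by blast
  have const: "F s = F t" if "s \<le> t" "\<And>x. s \<le> x \<Longrightarrow> x \<le> t \<Longrightarrow> \<rho> x = 0" for s t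
  proof (rule antisym)
    show "F t \<le> F s"
      by (rule DERIV_nonpos_imp_nonincreasing[OF that(1)]) (metis F that(2) order_refl)
  qed (rule mono[OF that(1)])
  have "(-1::real) < 1" by simp
  \<comment> \<open>The bump is positive inside (-1, 1), so the normalising denominator F 1 - F (-1)
    is positive.\<close>
  then have strict: "F (-1) < F 1"
  proof (rule DERIV_pos_imp_increasing_open)
    show "\<exists>y. (F has_real_derivative y) (at x) \<and> 0 < y" if "-1 < x" "x < 1" for x
      using F[of x] pos[OF that] by blast
    show "continuous_on {-1..1} F"
      by (rule DERIV_continuous_on) (rule has_field_derivative_at_within[OF F])
  qed
  define S where "S t = (F t - F (-1)) / (F 1 - F (-1))" for t
  define S' where "S' t = \<rho> t / (F 1 - F (-1))" for t
  have dS: "(S has_real_derivative S' t) (at t)" for t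
    unfolding S_def S'_def by (rule DERIV_cdivide) (auto intro!: derivative_eq_intros F)
  have CkS: "Ck k S" for k
  proof -
    have "Ck k (\<lambda>t. 1 / (F 1 - F (-1)) * \<rho> t)" by (intro Ck_mult Ck_const Ck\<rho>)
    then have "Ck k S'" by (simp add: S'_def[abs_def])
    then show ?thesis using dS Ck_Suc_imp Ck_real_derivI by blast
  qed
  have lo: "S t = 0" if "t \<le> -1" for t
    using const[OF that] zero by (simp add: S_def)
  have hi: "S t = 1" if "1 \<le> t" for t
    using const[OF that] zero strict by (simp add: S_def)
  have "0 \<le> S t" "S t \<le> 1" for t
  proof -
    have "F (-1) \<le> F t" by (cases "t \<le> -1") (use mono const[of t "-1"] zero in auto)
    then show "0 \<le> S t" using strict by (simp add: S_def)
    have "F t \<le> F 1" by (cases "1 \<le> t") (use mono const[of 1 t] zero in auto)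
    then show "S t \<le> 1" using strict by (simp add: S_def)
  qed
  moreover have "continuous_on UNIV S'" unfolding S'_def using strict
    by (intro continuous_intros cont) auto
  ultimately show ?thesis
    using that[of S S'] CkS dS lo hi nn zero strict by (auto simp: S'_def)
qed

text \<open>Tested with S((t - a)/r) - S((t - b)/r), the left side is the difference of two
  mollifications of g, at a and at b, and the right side integrates q against a smooth approximation
  of the indicator of (a, b). As r tends to 0, continuity of g and dominated convergence give the
  identity.\<close>

lemma primitive_from_test_functions:
  fixes g q :: "real \<Rightarrow> real"
  assumes g: "continuous_on {0..T} g" and q: "integrable (lebesgue_on {0<..<T}) q"
    and weak: "\<And>\<eta>. \<eta> \<in> test_functions {0<..<T} \<Longrightarrow>
      (LINT t|lebesgue_on {0<..<T}. g t * deriv \<eta> t) = - (LINT t|lebesgue_on {0<..<T}. q t * \<eta> t)"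
    and ab: "0 < a" "a < b" "b < T"
  shows "g b - g a = (LINT t|lebesgue_on {0<..<T}. q t * indicator {a<..<b} t)"
proof -
  let ?M = "lebesgue_on {0<..<T}"
  obtain S S' :: "real \<Rightarrow> real"
    where S: "\<And>k. Ck k S" "\<And>t. (S has_real_derivative S' t) (at t)"
      "continuous_on UNIV S'" "\<And>t. 0 \<le> S' t" "\<And>t. 1 \<le> \<bar>t\<bar> \<Longrightarrow> S' t = 0"
      "\<And>t. t \<le> -1 \<Longrightarrow> S t = 0" "\<And>t. 1 \<le> t \<Longrightarrow> S t = 1" "\<And>t. 0 \<le> S t" "\<And>t. S t \<le> 1"
    by (rule smooth_step) blast
  have gm: "g \<in> borel_measurable ?M"
    by (rule continuous_imp_measurable_on_sets_lebesgue) (use g in \<open>auto intro: continuous_on_subset\<close>)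
  obtain B where B: "\<And>t. t \<in> {0..T} \<Longrightarrow> \<bar>g t\<bar> \<le> B"
  proof -
    have "bounded (g ` {0..T})" using compact_imp_bounded[OF compact_continuous_image[OF g]] by simp
    then show ?thesis using that by (fastforce simp: bounded_iff)
  qed
  \<comment> \<open>The derivative of a rescaled, translated step: a bump of mass 1 within distance
    r of c.\<close>
  define \<kappa> where "\<kappa> c r t = S' ((t - c) / r) / r" for c r t
  have S\<kappa>: "((\<lambda>x. S ((x - c) / r)) has_real_derivative \<kappa> c r x) (at x)" for c r x
  proof -
    have "((\<lambda>x. (x - c) / r) has_real_derivative 1 / r) (at x)"
      by (rule DERIV_cdivide) (auto intro!: derivative_eq_intros)
    from DERIV_chain2[OF S(2) this] show ?thesis by (simp add: \<kappa>_def)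
  qed
  have \<kappa>cont: "continuous_on UNIV (\<kappa> c r)" if "0 < r" for c r
  proof -
    have "continuous_on UNIV (\<lambda>t. (t - c) / r)" using that by (intro continuous_intros) auto
    from continuous_on_compose2[OF S(3) this] have "continuous_on UNIV (\<lambda>t. S' ((t - c) / r))" by simp
    then show ?thesis
      unfolding \<kappa>_def[abs_def] using that by (intro continuous_on_divide continuous_on_const) auto
  qed
  have \<kappa>m: "\<kappa> c r \<in> borel_measurable ?M" if "0 < r" for c r
    by (rule continuous_imp_measurable_on_sets_lebesgue)
      (use continuous_on_subset[OF \<kappa>cont[OF that]] in auto)
  have \<kappa>nn: "0 \<le> \<kappa> c r t" if "0 < r" for c r t using S(4) that by (simp add: \<kappa>_def)
  have \<kappa>0: "\<kappa> c r t = 0" if "0 < r" "r \<le> \<bar>t - c\<bar>" for c r t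
    using that by (simp add: \<kappa>_def S(5) abs_divide)
  have \<kappa>int: "integrable ?M (\<kappa> c r)" "(LINT t|?M. \<kappa> c r t) = 1"
    if r: "0 < r" "0 < c - r" "c + r < T" for c r
  proof -
    have hb: "has_bochner_integral lborel (\<lambda>x. \<kappa> c r x * indicator {c - r..c + r} x) (S ((c + r - c) / r) - S ((c - r - c) / r))"
    proof (rule has_bochner_integral_FTC_Icc_real)
      show "((\<lambda>x. S ((x - c) / r)) has_real_derivative \<kappa> c r x) (at x)" for x
        by (rule S\<kappa>)
      show "isCont (\<kappa> c r) x" for x
        using \<kappa>cont[OF r(1)] by (simp add: continuous_on_eq_continuous_at)
    qed (use r in auto)
    have e: "(\<lambda>x. \<kappa> c r x * indicator {c - r..c + r} x) = (\<lambda>x. indicator {0<..<T} x *\<^sub>R \<kappa> c r x)"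
    proof
      fix x show "\<kappa> c r x * indicator {c - r..c + r} x = indicator {0<..<T} x *\<^sub>R \<kappa> c r x"
        using \<kappa>0[OF r(1), of x c] r by (cases "r \<le> \<bar>x - c\<bar>") (auto simp: indicator_def)
    qed
    have "has_bochner_integral lborel (\<lambda>x. indicator {0<..<T} x *\<^sub>R \<kappa> c r x) 1"
      using hb r(1) unfolding e by (simp add: S)
    then have i: "integrable lborel (\<lambda>x. indicator {0<..<T} x *\<^sub>R \<kappa> c r x)" "(LINT x|lborel. indicator {0<..<T} x *\<^sub>R \<kappa> c r x) = 1"
      by (auto simp: has_bochner_integral_iff)
    show "integrable ?M (\<kappa> c r)"
      using i(1) by (subst integrable_restrict_space) (auto simp: integrable_completion borel_measurable_integrable)
    show "(LINT t|?M. \<kappa> c r t) = 1"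
      using i by (subst integral_restrict_space) (auto simp: integral_completion borel_measurable_integrable)
  qed
  have g\<kappa>int: "integrable ?M (\<lambda>t. g t * \<kappa> c r t)" if r: "0 < r" "0 < c - r" "c + r < T" for c r
  proof (rule Bochner_Integration.integrable_bound[OF integrable_mult_right[OF \<kappa>int(1)[OF r], of B]])
    show "AE t in ?M. norm (g t * \<kappa> c r t) \<le> norm (B * \<kappa> c r t)"
    proof (rule AE_I2)
      fix t assume "t \<in> space ?M"
      then have "\<bar>g t\<bar> \<le> \<bar>B\<bar>" using B[of t] by auto
      then show "norm (g t * \<kappa> c r t) \<le> norm (B * \<kappa> c r t)" by (simp add: abs_mult mult_right_mono)
    qed
  qed (use gm \<kappa>m r in auto)
  have near: "\<exists>\<delta>>0. \<forall>r. 0 < r \<longrightarrow> r < \<delta> \<longrightarrow> \<bar>(LINT t|?M. g t * \<kappa> c r t) - g c\<bar> \<le> e"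
    if c: "0 < c" "c < T" and e: "0 < e" for c e
  proof -
    obtain d where d: "d > 0" "\<And>t. t \<in> {0..T} \<Longrightarrow> dist t c < d \<Longrightarrow> dist (g t) (g c) < e"
      using g c e unfolding continuous_on_iff by (metis atLeastAtMost_iff less_imp_le)
    show ?thesis
    proof (intro exI[of _ "min d (min c (T - c))"] conjI allI impI)
      fix r assume r: "0 < r" "r < min d (min c (T - c))"
      then have r': "0 < r" "0 < c - r" "c + r < T" by auto
      have "(LINT t|?M. g t * \<kappa> c r t) - g c = (LINT t|?M. g t * \<kappa> c r t) - (LINT t|?M. g c * \<kappa> c r t)"
        using \<kappa>int[OF r'] by simp
      also have "\<dots> = (LINT t|?M. g t * \<kappa> c r t - g c * \<kappa> c r t)"
        using \<kappa>int[OF r'] g\<kappa>int[OF r'] by (intro Bochner_Integration.integral_diff[symmetric]) auto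
      finally have "\<bar>(LINT t|?M. g t * \<kappa> c r t) - g c\<bar> \<le> (LINT t|?M. \<bar>g t * \<kappa> c r t - g c * \<kappa> c r t\<bar>)"
        using integral_abs_bound by metis
      also have "\<dots> \<le> (LINT t|?M. e * \<kappa> c r t)"
      proof (rule integral_mono)
        show "integrable ?M (\<lambda>t. \<bar>g t * \<kappa> c r t - g c * \<kappa> c r t\<bar>)"
          using \<kappa>int[OF r'] g\<kappa>int[OF r'] by (intro integrable_abs Bochner_Integration.integrable_diff) auto
        fix t assume t: "t \<in> space ?M"
        show "\<bar>g t * \<kappa> c r t - g c * \<kappa> c r t\<bar> \<le> e * \<kappa> c r t"
        proof (cases "r \<le> \<bar>t - c\<bar>")
          case True
          then show ?thesis using \<kappa>0[OF r(1)] by simp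
        next
          case False
          then have "\<bar>g t - g c\<bar> \<le> e"
            using d(2)[of t] t r by (auto simp: dist_real_def)
          then have "\<bar>g t - g c\<bar> * \<kappa> c r t \<le> e * \<kappa> c r t"
            using \<kappa>nn[OF r(1)] by (rule mult_right_mono)
          then show ?thesis using \<kappa>nn[OF r(1), of c t] by (simp add: left_diff_distrib[symmetric] abs_mult)
        qed
      qed (use \<kappa>int[OF r'] in auto)
      also have "\<dots> = e" using \<kappa>int[OF r'] by simp
      finally show "\<bar>(LINT t|?M. g t * \<kappa> c r t) - g c\<bar> \<le> e" .
    qed (use d c in auto)
  qed
  \<comment> \<open>Radii up to this size keep the mollifiers at a and at b supported inside (0,
    T).\<close>
  define r0 where "r0 = min a (min (T - b) (b - a)) / 2"
  have r0: "0 < r0" "r0 < a" "r0 < T - b" using ab by (auto simp: r0_def min_def)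
  define r where "r n = r0 / real (Suc n)" for n
  have rpos: "0 < r n" for n using r0 by (simp add: r_def)
  have rle: "r n \<le> r0" for n using r0 by (simp add: r_def divide_le_eq)
  have rlim: "r \<longlonglongrightarrow> 0" unfolding r_def
    using LIMSEQ_Suc[OF lim_const_over_n[of r0]] by simp
  have lim\<kappa>: "(\<lambda>n. LINT t|?M. g t * \<kappa> c (r n) t) \<longlonglongrightarrow> g c" if c: "0 < c" "c < T" for c
  proof (rule LIMSEQ_I)
    fix e :: real assume "0 < e"
    then have "0 < e / 2" by simp
    from near[OF c this] obtain \<delta> where \<delta>: "\<delta> > 0" "\<And>r. 0 < r \<Longrightarrow> r < \<delta> \<Longrightarrow> \<bar>(LINT t|?M. g t * \<kappa> c r t) - g c\<bar> \<le> e / 2"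
      by blast
    have "\<forall>\<^sub>F n in sequentially. r n < \<delta>" using rlim \<delta>(1) order_tendstoD(2) by blast
    then obtain N where "\<And>n. n \<ge> N \<Longrightarrow> r n < \<delta>" by (auto simp: eventually_sequentially)
    then have "norm ((LINT t|?M. g t * \<kappa> c (r n) t) - g c) < e" if "n \<ge> N" for n
      using \<delta>(2)[OF rpos, of n] that \<open>0 < e\<close> by fastforce
    then show "\<exists>no. \<forall>n\<ge>no. norm ((LINT t|?M. g t * \<kappa> c (r n) t) - g c) < e" by blast
  qed
  define \<eta> where "\<eta> n t = S ((t - a) / r n) - S ((t - b) / r n)" for n t
  have \<eta>0: "\<eta> n t = 0" if "t \<notin> {a - r n..b + r n}" for n t
  proof -
    have "t < a - r n \<or> b + r n < t" using that by (auto simp: not_le)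
    then show ?thesis
    proof
      assume "t < a - r n"
      then have "(t - a) / r n \<le> -1" "(t - b) / r n \<le> -1" using rpos[of n] ab by (auto simp: divide_le_eq)
      then show ?thesis by (simp add: \<eta>_def S)
    next
      assume "b + r n < t"
      then have "1 \<le> (t - a) / r n" "1 \<le> (t - b) / r n" using rpos[of n] ab by (auto simp: le_divide_eq)
      then show ?thesis by (simp add: \<eta>_def S)
    qed
  qed
  have \<eta>test: "\<eta> n \<in> test_functions {0<..<T}" for n
  proof -
    have "Ck k (\<lambda>t. S (t \<bullet> (1 / r n) + (- a / r n)) - S (t \<bullet> (1 / r n) + (- b / r n)))" for k
      by (intro Ck_diff Ck_affine S)
    moreover have "(\<lambda>t. S (t \<bullet> (1 / r n) + (- a / r n)) - S (t \<bullet> (1 / r n) + (- b / r n))) = \<eta> n"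
      by (auto simp: \<eta>_def fun_eq_iff diff_divide_distrib)
    ultimately have C: "Ck k (\<eta> n)" for k by simp
    have "{t. \<eta> n t \<noteq> 0} \<subseteq> {a - r n..b + r n}" using \<eta>0 by blast
    then have cl: "closure {t. \<eta> n t \<noteq> 0} \<subseteq> {a - r n..b + r n}"
      by (rule closure_minimal) simp
    then have "compact (closure {t. \<eta> n t \<noteq> 0})"
      by (meson bounded_closed_interval bounded_subset closed_closure compact_eq_bounded_closed)
    moreover have "{a - r n..b + r n} \<subseteq> {0<..<T}" using rle[of n] r0 by auto
    ultimately show ?thesis using C cl by (auto simp: test_functions_def)
  qed
  have deriv\<eta>: "deriv (\<eta> n) t = \<kappa> a (r n) t - \<kappa> b (r n) t" for n t
  proof (rule DERIV_imp_deriv)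
    show "(\<eta> n has_real_derivative \<kappa> a (r n) t - \<kappa> b (r n) t) (at t)"
      unfolding \<eta>_def[abs_def] by (intro DERIV_diff S\<kappa>)
  qed
  have rr: "0 < a - r n" "a + r n < T" "0 < b - r n" "b + r n < T" for n
    using rle[of n] r0 ab by auto
  have "(LINT t|?M. g t * deriv (\<eta> n) t) = (LINT t|?M. g t * \<kappa> a (r n) t) - (LINT t|?M. g t * \<kappa> b (r n) t)" for n
    unfolding deriv\<eta> right_diff_distrib using g\<kappa>int[OF rpos rr(1,2)] g\<kappa>int[OF rpos rr(3,4)]
    by (rule Bochner_Integration.integral_diff)
  then have "(\<lambda>n. LINT t|?M. g t * deriv (\<eta> n) t) \<longlonglongrightarrow> g a - g b"
    using ab by (auto intro!: tendsto_diff lim\<kappa>)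
  then have L1: "(\<lambda>n. - (LINT t|?M. q t * \<eta> n t)) \<longlonglongrightarrow> g a - g b"
    using weak[OF \<eta>test] by simp
  have "(\<lambda>n. LINT t|?M. q t * \<eta> n t) \<longlonglongrightarrow> (LINT t|?M. q t * indicator {a<..<b} t)"
  proof (rule integral_dominated_convergence[where w="\<lambda>t. norm (q t)"])
    have "\<eta> n \<in> borel_measurable ?M" for n
    proof (rule continuous_imp_measurable_on_sets_lebesgue)
      show "continuous_on {0<..<T} (\<eta> n)"
        using test_function_continuous(1)[OF \<eta>test] continuous_on_subset by blast
    qed simp
    then show "(\<lambda>t. q t * \<eta> n t) \<in> borel_measurable ?M" for n
      using q by (intro borel_measurable_times) auto
    show "(\<lambda>t. q t * indicator {a<..<b} t) \<in> borel_measurable ?M"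
    proof (intro borel_measurable_times borel_measurable_indicator)
      show "{a<..<b} \<in> sets ?M" using ab by (auto simp: sets_restrict_space intro!: image_eqI[of _ _ "{a<..<b}"])
    qed (use q in auto)
    show "AE t in ?M. norm (q t * \<eta> n t) \<le> norm (q t)" for n
    proof (rule AE_I2)
      fix t
      have "\<bar>\<eta> n t\<bar> \<le> 1" using S(8)[of "(t - a) / r n"] S(9)[of "(t - a) / r n"] S(8)[of "(t - b) / r n"] S(9)[of "(t - b) / r n"]
        unfolding \<eta>_def by linarith
      then show "norm (q t * \<eta> n t) \<le> norm (q t)" by (simp add: abs_mult mult_left_le)
    qed
    \<comment> \<open>At a and at b one of the two steps keeps the uncontrolled value S 0, so the
      limit need not be that of the indicator; these two points are discarded.\<close>
    have "AE t in lebesgue. t \<noteq> a \<and> t \<noteq> b"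
    proof -
      have "{a, b} \<in> null_sets lebesgue" by (simp add: negligible_iff_null_sets[symmetric] negligible_insert)
      from AE_not_in[OF this] show ?thesis by simp
    qed
    then have "AE t in ?M. t \<noteq> a \<and> t \<noteq> b" by (subst AE_restrict_space_iff) (auto elim: eventually_mono)
    then show "AE t in ?M. (\<lambda>n. q t * \<eta> n t) \<longlonglongrightarrow> q t * indicator {a<..<b} t"
    proof eventually_elim
      case (elim t)
      define \<delta> where "\<delta> = min \<bar>t - a\<bar> \<bar>t - b\<bar>"
      have "0 < \<delta>" using elim by (simp add: \<delta>_def)
      then have "\<forall>\<^sub>F n in sequentially. r n < \<delta>" using rlim order_tendstoD(2) by blast
      then have "\<forall>\<^sub>F n in sequentially. \<eta> n t = indicator {a<..<b} t"
      proof eventually_elim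
        case (elim n)
        have st: "S ((t - c) / r n) = (if c < t then 1 else 0)" if "r n < \<bar>t - c\<bar>" for c
        proof (cases "c < t")
          case True
          then have "1 \<le> (t - c) / r n" using that rpos[of n] by (simp add: le_divide_eq)
          then show ?thesis using True by (simp add: S)
        next
          case False
          then have "(t - c) / r n \<le> -1" using that rpos[of n] by (simp add: divide_le_eq)
          then show ?thesis using False by (simp add: S)
        qed
        have "\<eta> n t = (if a < t then 1 else 0) - (if b < t then 1 else 0)"
          unfolding \<eta>_def using elim by (simp add: \<delta>_def st)
        moreover have "t \<noteq> b" using elim rpos[of n] by (auto simp: \<delta>_def)
        ultimately show ?case using ab by (auto simp: indicator_def)
      qed
      then have "(\<lambda>n. \<eta> n t) \<longlonglongrightarrow> indicator {a<..<b} t" by (rule tendsto_eventually)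
      then show ?case by (intro tendsto_intros)
    qed
  qed (use q in auto)
  from tendsto_minus[OF this] have "g a - g b = - (LINT t|?M. q t * indicator {a<..<b} t)"
    using L1 LIMSEQ_unique by blast
  then show ?thesis by simp
qed


section \<open>Linearity and uniqueness of weak gradients\<close>

lemma test_function_mult_integrable:
  fixes g :: "'a::euclidean_space \<Rightarrow> real"
  assumes D: "open D" and g: "locally_integrable D g" and \<phi>: "\<phi> \<in> test_functions D"
  shows "integrable (lebesgue_on D) (\<lambda>x. g x * \<phi> x)"
    "b \<in> Basis \<Longrightarrow> integrable (lebesgue_on D) (\<lambda>x. g x * frechet_derivative \<phi> (at x) b)"
proof -
  obtain K where "compact K" "K \<subseteq> D" "\<And>x. x \<notin> K \<Longrightarrow> \<phi> x = 0"
    "\<And>x b. x \<notin> K \<Longrightarrow> frechet_derivative \<phi> (at x) b = 0"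
    using test_function_support[OF \<phi>] by metis
  then show "integrable (lebesgue_on D) (\<lambda>x. g x * \<phi> x)"
    "b \<in> Basis \<Longrightarrow> integrable (lebesgue_on D) (\<lambda>x. g x * frechet_derivative \<phi> (at x) b)"
    using test_function_continuous[OF \<phi>]
    by (auto intro!: locally_integrable_times_continuous[OF D g])
qed

lemma locally_integrable_add:
  "locally_integrable D f \<Longrightarrow> locally_integrable D g \<Longrightarrow> locally_integrable D (\<lambda>x. f x + g x)"
  by (simp add: locally_integrable_def)

lemma locally_integrable_scaleR:
  "locally_integrable D f \<Longrightarrow> locally_integrable D (\<lambda>x. c *\<^sub>R f x)"
  by (auto simp: locally_integrable_def)

lemma locally_integrable_inner:
  "locally_integrable D f \<Longrightarrow> locally_integrable D (\<lambda>x. f x \<bullet> b)"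
  by (simp add: locally_integrable_def)

lemma has_weak_grad_add:
  assumes D: "open D" and u: "has_weak_grad D u g" and v: "has_weak_grad D v h"
  shows "has_weak_grad D (\<lambda>x. u x + v x) (\<lambda>x. g x + h x)"
  unfolding has_weak_grad_def
proof (intro conjI ballI)
  show "locally_integrable D (\<lambda>x. u x + v x)" "locally_integrable D (\<lambda>x. g x + h x)"
    using u v by (auto simp: has_weak_grad_def intro: locally_integrable_add)
  fix \<phi> and b :: 'a assume \<phi>: "\<phi> \<in> test_functions D" and b: "b \<in> Basis"
  have l: "locally_integrable D u" "locally_integrable D v"
    "locally_integrable D (\<lambda>x. g x \<bullet> b)" "locally_integrable D (\<lambda>x. h x \<bullet> b)"
    using u v by (auto simp: has_weak_grad_def intro: locally_integrable_inner)
  have e: "(LINT x|lebesgue_on D. u x * frechet_derivative \<phi> (at x) b) = - (LINT x|lebesgue_on D. (g x \<bullet> b) * \<phi> x)"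
    "(LINT x|lebesgue_on D. v x * frechet_derivative \<phi> (at x) b) = - (LINT x|lebesgue_on D. (h x \<bullet> b) * \<phi> x)"
    using u v \<phi> b by (auto simp: has_weak_grad_def)
  show "(LINT x|lebesgue_on D. (u x + v x) * frechet_derivative \<phi> (at x) b) = - (LINT x|lebesgue_on D. ((g x + h x) \<bullet> b) * \<phi> x)"
    using e l[THEN test_function_mult_integrable(1)[OF D _ \<phi>]] l[THEN test_function_mult_integrable(2)[OF D _ \<phi> b]]
    by (simp add: distrib_right inner_add_left)
qed

lemma has_weak_grad_scale:
  assumes D: "open D" and u: "has_weak_grad D u g"
  shows "has_weak_grad D (\<lambda>x. c * u x) (\<lambda>x. c *\<^sub>R g x)"
  unfolding has_weak_grad_def
proof (intro conjI ballI)
  show "locally_integrable D (\<lambda>x. c * u x)" "locally_integrable D (\<lambda>x. c *\<^sub>R g x)"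
    using u locally_integrable_scaleR[of D u c] by (auto simp: has_weak_grad_def intro: locally_integrable_scaleR)
  fix \<phi> and b :: 'a assume \<phi>: "\<phi> \<in> test_functions D" and b: "b \<in> Basis"
  then have "(LINT x|lebesgue_on D. u x * frechet_derivative \<phi> (at x) b) = - (LINT x|lebesgue_on D. (g x \<bullet> b) * \<phi> x)"
    using u by (auto simp: has_weak_grad_def)
  then show "(LINT x|lebesgue_on D. (c * u x) * frechet_derivative \<phi> (at x) b) = - (LINT x|lebesgue_on D. ((c *\<^sub>R g x) \<bullet> b) * \<phi> x)"
    by (simp add: mult.assoc)
qed

lemma has_weak_grad_zero: "has_weak_grad D (\<lambda>x. 0) (\<lambda>x. 0)"
  by (simp add: has_weak_grad_def locally_integrable_def)

text \<open>The difference is a weak gradient of the zero function, so each of its coordinates is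
  annihilated by all test functions.\<close>

lemma has_weak_grad_unique:
  assumes D: "open D" and g: "has_weak_grad D u g" and h: "has_weak_grad D u h"
  shows "AE x in lebesgue_on D. g x = h x"
proof -
  have "AE x in lebesgue_on D. (g x - h x) \<bullet> b = 0" if b: "b \<in> Basis" for b
  proof (rule fundamental_lemma_calculus_of_variations[OF D])
    have d: "has_weak_grad D (\<lambda>x. u x + (-1) * u x) (\<lambda>x. g x + (-1) *\<^sub>R h x)"
      by (intro has_weak_grad_add has_weak_grad_scale D g h)
    then show "locally_integrable D (\<lambda>x. (g x - h x) \<bullet> b)"
      by (auto simp: has_weak_grad_def intro!: locally_integrable_inner)
    fix \<phi> assume "\<phi> \<in> test_functions D"
    with d b show "(LINT x|lebesgue_on D. ((g x - h x) \<bullet> b) * \<phi> x) = 0"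
      by (auto simp: has_weak_grad_def)
  qed
  then have "AE x in lebesgue_on D. \<forall>b\<in>Basis. (g x - h x) \<bullet> b = 0"
    by (intro AE_finite_allI) auto
  then show ?thesis
    by eventually_elim (simp add: inner_diff_left euclidean_eq_iff[where 'a='a])
qed

text \<open>\<open>weak_grad\<close> is a choice, so a weak gradient found by calculation is
  identified with it only almost everywhere; this is why the algebraic rules below hold almost
  everywhere.\<close>

lemma weak_grad_eq:
  assumes D: "open D" and g: "has_weak_grad D u g"
  shows "has_weak_grad D u (weak_grad D u)" "AE x in lebesgue_on D. g x = weak_grad D u x"
proof -
  show "has_weak_grad D u (weak_grad D u)" unfolding weak_grad_def using someI[of "has_weak_grad D u", OF g] .
  then show "AE x in lebesgue_on D. g x = weak_grad D u x"
    by (rule has_weak_grad_unique[OF D g])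
qed

section \<open>The spaces \<open>H1\<close> and \<open>W1inf\<close> and the dual of
  \<open>H1\<close>\<close>

abbreviation L2 :: "'a::euclidean_space set \<Rightarrow> ('a \<Rightarrow> 'b::euclidean_space) set" where
  "L2 D \<equiv> Lp 2 (lebesgue_on D)"

abbreviation L2_norm :: "'a::euclidean_space set \<Rightarrow> ('a \<Rightarrow> 'b::euclidean_space) \<Rightarrow> real" where
  "L2_norm D \<equiv> Lp_norm 2 (lebesgue_on D)"

lemma W1pI: "u \<in> Lp p (lebesgue_on D) \<Longrightarrow> g \<in> Lp p (lebesgue_on D) \<Longrightarrow> has_weak_grad D u g \<Longrightarrow> u \<in> W1p p D"
  unfolding W1p_def by blast

lemma W1infI: "u \<in> Linf (lebesgue_on D) \<Longrightarrow> g \<in> Linf (lebesgue_on D) \<Longrightarrow> has_weak_grad D u g \<Longrightarrow> u \<in> W1inf D"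
  unfolding W1inf_def by blast

lemma complete_measure_lebesgue_on_open: "open D \<Longrightarrow> complete_measure (lebesgue_on D)"
  by (rule complete_measure_lebesgue_on) auto

text \<open>Membership in \<open>H1\<close> provides some square-integrable weak gradient, not the
  chosen one. Uniqueness carries square integrability over to the choice, and completeness of the
  measure carries measurability.\<close>

lemma W1p_2_D:
  assumes D: "open D" and u: "u \<in> H1 D"
  shows "u \<in> L2 D" "weak_grad D u \<in> L2 D" "has_weak_grad D u (weak_grad D u)"
proof -
  obtain g where g: "g \<in> L2 D" "has_weak_grad D u g" "u \<in> L2 D"
    using u by (auto simp: W1p_def)
  note w = weak_grad_eq[OF D g(2)]
  have "weak_grad D u \<in> borel_measurable (lebesgue_on D)"
    using complete_measure.borel_measurable_AE_cong[OF complete_measure_lebesgue_on_open[OF D] _ w(2)] g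
    by (auto simp: Lp2_iff)
  then show "weak_grad D u \<in> L2 D"
    by (rule Lp2_bound[OF g(1), where c=1]) (use w(2) in \<open>eventually_elim, simp\<close>)
qed (use u weak_grad_eq[OF D] in \<open>auto simp: W1p_def\<close>)

lemma H1_add:
  assumes D: "open D" and u: "u \<in> H1 D" and v: "v \<in> H1 D"
  shows "(\<lambda>x. u x + v x) \<in> H1 D"
    "AE x in lebesgue_on D. weak_grad D u x + weak_grad D v x = weak_grad D (\<lambda>x. u x + v x) x"
proof -
  note u' = W1p_2_D[OF D u] and v' = W1p_2_D[OF D v]
  note w = has_weak_grad_add[OF D u'(3) v'(3)]
  show "(\<lambda>x. u x + v x) \<in> H1 D"
    by (rule W1pI[OF _ _ w]) (intro Lp2_add u' v')+
  show "AE x in lebesgue_on D. weak_grad D u x + weak_grad D v x = weak_grad D (\<lambda>x. u x + v x) x"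
    by (rule weak_grad_eq[OF D w])
qed

lemma H1_scale:
  assumes D: "open D" and u: "u \<in> H1 D"
  shows "(\<lambda>x. c * u x) \<in> H1 D"
    "AE x in lebesgue_on D. c *\<^sub>R weak_grad D u x = weak_grad D (\<lambda>x. c * u x) x"
proof -
  note u' = W1p_2_D[OF D u]
  note w = has_weak_grad_scale[OF D u'(3), of c]
  show "(\<lambda>x. c * u x) \<in> H1 D"
    by (rule W1pI[OF _ _ w]) (intro Lp2_scaleR Lp2_cmult u')+
  show "AE x in lebesgue_on D. c *\<^sub>R weak_grad D u x = weak_grad D (\<lambda>x. c * u x) x"
    by (rule weak_grad_eq[OF D w])
qed

lemma H1_zero: "(\<lambda>x. 0) \<in> H1 D"
  by (rule W1pI[OF Lp2_zero Lp2_zero has_weak_grad_zero])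

lemma Lp2_measurable: "f \<in> Lp 2 M \<Longrightarrow> f \<in> borel_measurable M"
  by (simp add: Lp_def)

text \<open>Minkowski's inequality is used twice: in L2 for the function and for its gradient, then
  in the plane for the pairs of their norms.\<close>

lemma H1_norm_triangle:
  assumes D: "open D" and u: "u \<in> H1 D" and v: "v \<in> H1 D"
  shows "H1_norm D (\<lambda>x. u x + v x) \<le> H1_norm D u + H1_norm D v"
proof -
  note u' = W1p_2_D[OF D u] and v' = W1p_2_D[OF D v] and w = H1_add[OF D u v]
  have "L2_norm D (weak_grad D (\<lambda>x. u x + v x)) = L2_norm D (\<lambda>x. weak_grad D u x + weak_grad D v x)"
    by (rule Lp2_norm_cong_AE[symmetric, OF _ _ w(2)])
      (intro Lp2_measurable Lp2_add u' v' W1p_2_D[OF D w(1)])+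
  also have "\<dots> \<le> L2_norm D (weak_grad D u) + L2_norm D (weak_grad D v)"
    by (intro Lp2_norm_triangle u' v')
  finally have "H1_norm D (\<lambda>x. u x + v x) \<le> sqrt ((L2_norm D u + L2_norm D v)\<^sup>2
      + (L2_norm D (weak_grad D u) + L2_norm D (weak_grad D v))\<^sup>2)"
    unfolding H1_norm_def by (intro real_sqrt_le_mono add_mono power_mono Lp2_norm_triangle u' v') auto
  also have "\<dots> \<le> H1_norm D u + H1_norm D v"
    unfolding H1_norm_def by (rule real_sqrt_sum_squares_triangle_ineq)
  finally show ?thesis .
qed

lemma H1_norm_scale:
  assumes D: "open D" and u: "u \<in> H1 D"
  shows "H1_norm D (\<lambda>x. c * u x) = \<bar>c\<bar> * H1_norm D u"
proof -
  note u' = W1p_2_D[OF D u] and w = H1_scale[OF D u, of c]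
  have "L2_norm D (weak_grad D (\<lambda>x. c * u x)) = L2_norm D (\<lambda>x. c *\<^sub>R weak_grad D u x)"
    by (rule Lp2_norm_cong_AE[symmetric, OF _ _ w(2)])
      (intro Lp2_measurable Lp2_scaleR u' W1p_2_D[OF D w(1)])+
  then have "H1_norm D (\<lambda>x. c * u x) = sqrt (c\<^sup>2 * ((L2_norm D u)\<^sup>2 + (L2_norm D (weak_grad D u))\<^sup>2))"
    unfolding H1_norm_def by (simp add: Lp2_norm_scaleR Lp2_norm_cmult power_mult_distrib distrib_left)
  then show ?thesis unfolding H1_norm_def by (simp add: real_sqrt_mult)
qed

lemma H1_norm_nonneg: "0 \<le> H1_norm D u"
  by (simp add: H1_norm_def)

lemma H1_norm_power2: "(H1_norm D u)\<^sup>2 = (L2_norm D u)\<^sup>2 + (L2_norm D (weak_grad D u))\<^sup>2"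
  unfolding H1_norm_def by simp

lemma Lp2_norm_le_H1_norm:
  "L2_norm D u \<le> H1_norm D u" "L2_norm D (weak_grad D u) \<le> H1_norm D u"
  unfolding H1_norm_def by (auto intro: real_le_rsqrt)

lemma W1inf_D:
  assumes D: "open D" and u: "u \<in> W1inf D"
  shows "u \<in> Linf (lebesgue_on D)" "weak_grad D u \<in> Linf (lebesgue_on D)" "has_weak_grad D u (weak_grad D u)"
proof -
  obtain g where g: "g \<in> Linf (lebesgue_on D)" "has_weak_grad D u g" "u \<in> Linf (lebesgue_on D)"
    using u by (auto simp: W1inf_def)
  note w = weak_grad_eq[OF D g(2)]
  have m: "weak_grad D u \<in> borel_measurable (lebesgue_on D)"
    using complete_measure.borel_measurable_AE_cong[OF complete_measure_lebesgue_on_open[OF D] _ w(2)] g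
    by (auto simp: Linf_def)
  have "AE x in lebesgue_on D. norm (weak_grad D u x) \<le> Linf_norm (lebesgue_on D) g"
    using w(2) Linf_AE_bound[OF g(1)] by eventually_elim simp
  then show "weak_grad D u \<in> Linf (lebesgue_on D)" using m by (auto simp: Linf_def)
qed (use u weak_grad_eq[OF D] in \<open>auto simp: W1inf_def\<close>)

lemma W1inf_add:
  assumes D: "open D" and u: "u \<in> W1inf D" and v: "v \<in> W1inf D"
  shows "(\<lambda>x. u x + v x) \<in> W1inf D"
    "AE x in lebesgue_on D. weak_grad D u x + weak_grad D v x = weak_grad D (\<lambda>x. u x + v x) x"
    "W1inf_norm D (\<lambda>x. u x + v x) \<le> W1inf_norm D u + W1inf_norm D v"
proof -
  note u' = W1inf_D[OF D u] and v' = W1inf_D[OF D v]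
  note w = has_weak_grad_add[OF D u'(3) v'(3)]
  show m: "(\<lambda>x. u x + v x) \<in> W1inf D"
    by (rule W1infI[OF _ _ w]) (intro Linf_add(1) u' v')+
  show e: "AE x in lebesgue_on D. weak_grad D u x + weak_grad D v x = weak_grad D (\<lambda>x. u x + v x) x"
    by (rule weak_grad_eq[OF D w])
  have "Linf_norm (lebesgue_on D) (weak_grad D (\<lambda>x. u x + v x)) = Linf_norm (lebesgue_on D) (\<lambda>x. weak_grad D u x + weak_grad D v x)"
    by (rule Linf_norm_cong_AE[symmetric, OF _ _ e])
      (use W1inf_D(2)[OF D m] Linf_add(1)[OF u'(2) v'(2)] in \<open>auto simp: Linf_def\<close>)
  then show "W1inf_norm D (\<lambda>x. u x + v x) \<le> W1inf_norm D u + W1inf_norm D v"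
    using Linf_add(2)[OF u'(1) v'(1)] Linf_add(2)[OF u'(2) v'(2)] by (simp add: W1inf_norm_def)
qed

lemma W1inf_scale_le:
  assumes D: "open D" and u: "u \<in> W1inf D"
  shows "(\<lambda>x. c * u x) \<in> W1inf D"
    "AE x in lebesgue_on D. c *\<^sub>R weak_grad D u x = weak_grad D (\<lambda>x. c * u x) x"
    "W1inf_norm D (\<lambda>x. c * u x) \<le> \<bar>c\<bar> * W1inf_norm D u"
proof -
  note u' = W1inf_D[OF D u]
  note w = has_weak_grad_scale[OF D u'(3), of c]
  show m: "(\<lambda>x. c * u x) \<in> W1inf D"
    using Linf_scaleR(1)[OF u'(1), of c] by (intro W1infI[OF _ Linf_scaleR(1)[OF u'(2)] w]) simp
  show e: "AE x in lebesgue_on D. c *\<^sub>R weak_grad D u x = weak_grad D (\<lambda>x. c * u x) x"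
    by (rule weak_grad_eq[OF D w])
  have "Linf_norm (lebesgue_on D) (weak_grad D (\<lambda>x. c * u x)) = Linf_norm (lebesgue_on D) (\<lambda>x. c *\<^sub>R weak_grad D u x)"
    by (rule Linf_norm_cong_AE[symmetric, OF _ _ e])
      (use W1inf_D(2)[OF D m] Linf_scaleR(1)[OF u'(2)] in \<open>auto simp: Linf_def\<close>)
  then show "W1inf_norm D (\<lambda>x. c * u x) \<le> \<bar>c\<bar> * W1inf_norm D u"
    using Linf_scaleR(2)[OF u'(1), of c] Linf_scaleR(2)[OF u'(2), of c] by (simp add: W1inf_norm_def distrib_left)
qed

text \<open>A supremum of reals says something only if it is bounded. The constant in
  \<open>H1_dual\<close> supplies the bound; it is not assumed nonnegative, hence the absolute value
  in the proof.\<close>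

lemma H1_dual_bdd_above:
  assumes l: "l \<in> H1_dual D"
  shows "bdd_above ((\<lambda>u. \<bar>l u\<bar>) ` {u \<in> H1 D. H1_norm D u \<le> 1})"
proof -
  obtain B where B: "\<And>u. u \<in> H1 D \<Longrightarrow> \<bar>l u\<bar> \<le> B * H1_norm D u"
    using l unfolding H1_dual_def by blast
  show ?thesis
  proof (rule bdd_aboveI2)
    fix v assume v: "v \<in> {u \<in> H1 D. H1_norm D u \<le> 1}"
    have "\<bar>l v\<bar> \<le> B * H1_norm D v" using B v by simp
    also have "\<dots> \<le> \<bar>B\<bar> * 1" using v by (intro mult_mono) (auto simp: H1_norm_nonneg)
    finally show "\<bar>l v\<bar> \<le> \<bar>B\<bar>" by simp
  qed
qed

text \<open>Scaling to the unit ball requires a positive norm. On functions, as opposed to classes,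
  \<open>H1_norm\<close> is a seminorm; where it vanishes, the bound in \<open>H1_dual\<close> makes
  the functional vanish too.\<close>

lemma H1_dual_bound:
  assumes l: "l \<in> H1_dual D" and u: "u \<in> H1 D" and D: "open D"
  shows "\<bar>l u\<bar> \<le> H1_dual_norm D l * H1_norm D u"
proof -
  obtain B where B: "\<And>u. u \<in> H1 D \<Longrightarrow> \<bar>l u\<bar> \<le> B * H1_norm D u"
    using l unfolding H1_dual_def by blast
  show ?thesis
  proof (cases "H1_norm D u = 0")
    case True
    then show ?thesis using B[OF u] by simp
  next
    case False
    then have p: "0 < H1_norm D u" using H1_norm_nonneg[of D u] by simp
    let ?v = "\<lambda>x. (1 / H1_norm D u) * u x"
    have "?v \<in> {u \<in> H1 D. H1_norm D u \<le> 1}"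
      using H1_scale(1)[OF D u, of "1 / H1_norm D u"] H1_norm_scale[OF D u, of "1 / H1_norm D u"] p by simp
    then have "\<bar>l ?v\<bar> \<le> H1_dual_norm D l"
      unfolding H1_dual_norm_def by (rule cSUP_upper[OF _ H1_dual_bdd_above[OF l]])
    moreover have "l ?v = (1 / H1_norm D u) * l u" using l u unfolding H1_dual_def by blast
    ultimately show ?thesis using p by (simp add: abs_mult divide_le_eq)
  qed
qed

lemma H1_dual_norm_le:
  assumes D: "open D" and "0 \<le> B" and "\<And>u. u \<in> H1 D \<Longrightarrow> \<bar>l u\<bar> \<le> B * H1_norm D u"
  shows "H1_dual_norm D l \<le> B"
  unfolding H1_dual_norm_def
proof (rule cSUP_least)
  show "{u \<in> H1 D. H1_norm D u \<le> 1} \<noteq> {}"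
    using H1_zero[of D] H1_norm_scale[OF D H1_zero, of 0] by auto
  fix u assume u: "u \<in> {u \<in> H1 D. H1_norm D u \<le> 1}"
  have "\<bar>l u\<bar> \<le> B * H1_norm D u" using assms(3) u by simp
  also have "\<dots> \<le> B * 1" using u assms(2) by (intro mult_left_mono) auto
  finally show "\<bar>l u\<bar> \<le> B" by simp
qed

section \<open>Bochner spaces\<close>

abbreviation I\<^sub>T :: "real \<Rightarrow> real measure" where
  "I\<^sub>T T \<equiv> lebesgue_on {0<..<T}"

lemma simple_into_level_sets:
  assumes "simple_into X T s"
  shows "{t \<in> {0<..<T}. s t = y} \<in> sets (I\<^sub>T T)"
  using assms by (auto simp: simple_into_def sets_restrict_space intro!: image_eqI[where x="{t \<in> {0<..<T}. s t = y}"])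

text \<open>Splitting a simple path into its finitely many values reduces measurability,
  integrability and limits of expressions in \<open>s t\<close> to the same questions for one fixed
  value on one level set.\<close>

lemma sum_over_level_sets:
  fixes G :: "('b \<Rightarrow> real) \<Rightarrow> real \<Rightarrow> real"
  assumes s: "simple_into X T s" and t: "t \<in> {0<..<T}"
  shows "(\<Sum>y\<in>s ` {0<..<T}. indicator {t \<in> {0<..<T}. s t = y} t * G y t) = G (s t) t"
proof -
  have "(\<Sum>y\<in>s ` {0<..<T}. indicator {t \<in> {0<..<T}. s t = y} t * G y t) = (\<Sum>y\<in>s ` {0<..<T}. if y = s t then G y t else 0)"
    using t by (intro sum.cong) (auto simp: indicator_def)
  also have "\<dots> = G (s t) t" using s t by (simp add: sum.delta simple_into_def)
  finally show ?thesis .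
qed

lemma simple_into_measurable:
  fixes G :: "('b \<Rightarrow> real) \<Rightarrow> real \<Rightarrow> real"
  assumes s: "simple_into X T s" and G: "\<And>y. y \<in> X \<Longrightarrow> G y \<in> borel_measurable (I\<^sub>T T)"
  shows "(\<lambda>t. G (s t) t) \<in> borel_measurable (I\<^sub>T T)"
proof -
  have "s ` {0<..<T} \<subseteq> X" using s by (auto simp: simple_into_def)
  then have "(\<lambda>t. \<Sum>y\<in>s ` {0<..<T}. indicator {t \<in> {0<..<T}. s t = y} t * G y t) \<in> borel_measurable (I\<^sub>T T)"
    using G simple_into_level_sets[OF s]
    by (intro borel_measurable_sum borel_measurable_times borel_measurable_indicator) auto
  then show ?thesis
    using sum_over_level_sets[OF s, of _ G] by (subst measurable_cong[symmetric]) auto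
qed

lemma complete_measure_interval: "complete_measure (I\<^sub>T T)"
  by (rule complete_measure_lebesgue_on) simp

text \<open>What \<open>H1\<close>, \<open>W1inf\<close> and \<open>H1_dual\<close> have in common.
  Functions are not identified up to null sets, so the norm is only a seminorm. The scaling rule is
  an inequality; it already yields the symmetry of distances and the value 0 at the zero
  function.\<close>

locale seminormed_functions =
  fixes X :: "('b \<Rightarrow> real) set" and nrm :: "('b \<Rightarrow> real) \<Rightarrow> real"
  assumes zero: "(\<lambda>_. 0) \<in> X"
    and add: "x \<in> X \<Longrightarrow> y \<in> X \<Longrightarrow> (\<lambda>z. x z + y z) \<in> X"
    and scale: "x \<in> X \<Longrightarrow> (\<lambda>z. c * x z) \<in> X"
    and nrm_triangle: "x \<in> X \<Longrightarrow> y \<in> X \<Longrightarrow> nrm (\<lambda>z. x z + y z) \<le> nrm x + nrm y"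
    and nrm_scale_le: "x \<in> X \<Longrightarrow> nrm (\<lambda>z. c * x z) \<le> \<bar>c\<bar> * nrm x"
    and nrm_nonneg: "x \<in> X \<Longrightarrow> 0 \<le> nrm x"
begin

lemma diff: "x \<in> X \<Longrightarrow> y \<in> X \<Longrightarrow> (\<lambda>z. x z - y z) \<in> X"
  using add[OF _ scale[of y "-1"], of x] by simp

lemma nrm_minus_commute_le: "x \<in> X \<Longrightarrow> y \<in> X \<Longrightarrow> nrm (\<lambda>z. x z - y z) \<le> nrm (\<lambda>z. y z - x z)"
  using nrm_scale_le[OF diff[of y x], of "-1"] by simp

lemma nrm_minus_commute: "x \<in> X \<Longrightarrow> y \<in> X \<Longrightarrow> nrm (\<lambda>z. x z - y z) = nrm (\<lambda>z. y z - x z)"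
  by (intro antisym nrm_minus_commute_le)

lemma nrm_diff_le_add: "x \<in> X \<Longrightarrow> y \<in> X \<Longrightarrow> nrm (\<lambda>z. x z - y z) \<le> nrm x + nrm y"
  using nrm_triangle[OF _ scale[of y "-1"], of x] nrm_scale_le[of y "-1"] by simp

lemma nrm_zero: "nrm (\<lambda>_. 0) = 0"
  using nrm_scale_le[OF zero, of 0] nrm_nonneg[OF zero] by simp

lemma nrm_le_add_diff:
  assumes "x \<in> X" "y \<in> X"
  shows "nrm x \<le> nrm y + nrm (\<lambda>z. x z - y z)"
  using nrm_triangle[OF assms(2) diff[OF assms]] by simp

lemma abs_nrm_diff_le:
  assumes "x \<in> X" "y \<in> X"
  shows "\<bar>nrm x - nrm y\<bar> \<le> nrm (\<lambda>z. x z - y z)"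
  using nrm_le_add_diff[OF assms] nrm_le_add_diff[OF assms(2,1)] nrm_minus_commute[OF assms] by linarith

lemma simple_into_diff:
  assumes s: "simple_into X T s" and r: "simple_into X T r"
  shows "simple_into X T (\<lambda>t z. s t z - r t z)"
  unfolding simple_into_def
proof (intro conjI allI)
  let ?S = "s ` {0<..<T}" and ?R = "r ` {0<..<T}"
  have fin: "finite ?S" "finite ?R" and sub: "?S \<subseteq> X" "?R \<subseteq> X"
    using s r by (auto simp: simple_into_def)
  have "(\<lambda>t z. s t z - r t z) ` {0<..<T} \<subseteq> (\<lambda>(x, y) z. x z - y z) ` (?S \<times> ?R)" by auto
  then show "finite ((\<lambda>t z. s t z - r t z) ` {0<..<T})"
    using fin finite_subset by blast
  show "(\<lambda>t z. s t z - r t z) ` {0<..<T} \<subseteq> X" using sub diff by auto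
  fix y
  have "{t \<in> {0<..<T}. (\<lambda>z. s t z - r t z) = y} =
     (\<Union>(p, q)\<in>{(p, q) \<in> ?S \<times> ?R. (\<lambda>z. p z - q z) = y}. {t \<in> {0<..<T}. s t = p} \<inter> {t \<in> {0<..<T}. r t = q})"
    (is "?L = ?R'")
  proof (intro set_eqI iffI)
    show "t \<in> ?R'" if "t \<in> ?L" for t
      using that by (intro UN_I[of "(s t, r t)"]) auto
    show "t \<in> ?L" if "t \<in> ?R'" for t
      using that
    proof (rule UN_E)
      fix a assume "a \<in> {(p, q) \<in> ?S \<times> ?R. (\<lambda>z. p z - q z) = y}"
        "t \<in> (case a of (p, q) \<Rightarrow> {t \<in> {0<..<T}. s t = p} \<inter> {t \<in> {0<..<T}. r t = q})"
      then show ?thesis by (cases a) simp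
    qed
  qed
  also have "\<dots> \<in> sets lebesgue"
  proof (rule sets.finite_UN)
    show "finite {(p, q) \<in> ?S \<times> ?R. (\<lambda>z. p z - q z) = y}"
      by (rule finite_subset[of _ "?S \<times> ?R"]) (use fin in auto)
  qed (use s r in \<open>auto simp: simple_into_def\<close>)
  finally show "{t \<in> {0<..<T}. (\<lambda>z. s t z - r t z) = y} \<in> sets lebesgue" .
qed

lemma simple_into_mem: "simple_into X T s \<Longrightarrow> t \<in> {0<..<T} \<Longrightarrow> s t \<in> X"
  by (auto simp: simple_into_def)

lemma AE_simple_into_mem: "simple_into X T s \<Longrightarrow> AE t in I\<^sub>T T. s t \<in> X"
  using simple_into_mem by (intro AE_I2) simp

lemma strongly_measurableE:
  assumes "strongly_measurable X nrm T u"
  obtains s where "\<And>k. simple_into X T (s k)" "AE t in I\<^sub>T T. u t \<in> X"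
    "AE t in I\<^sub>T T. (\<lambda>k. nrm (\<lambda>x. s k t x - u t x)) \<longlonglongrightarrow> 0"
  using assms unfolding strongly_measurable_def by blast

text \<open>Along simple approximants the expression is measurable, and the Lipschitz bound makes it
  converge at almost every time. The Lipschitz constant may depend on t in any manner, which covers
  the pairing of \<open>u t\<close> with a functional that varies in time.\<close>

lemma strongly_measurable_apply:
  fixes G :: "('b \<Rightarrow> real) \<Rightarrow> real \<Rightarrow> real"
  assumes u: "strongly_measurable X nrm T u" and G: "\<And>y. y \<in> X \<Longrightarrow> G y \<in> borel_measurable (I\<^sub>T T)"
    and lip: "AE t in I\<^sub>T T. \<exists>B. \<forall>x\<in>X. \<forall>y\<in>X. \<bar>G x t - G y t\<bar> \<le> B * nrm (\<lambda>z. x z - y z)"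
  shows "(\<lambda>t. G (u t) t) \<in> borel_measurable (I\<^sub>T T)"
proof -
  obtain s where s: "\<And>k. simple_into X T (s k)" "AE t in I\<^sub>T T. u t \<in> X"
    "AE t in I\<^sub>T T. (\<lambda>k. nrm (\<lambda>x. s k t x - u t x)) \<longlonglongrightarrow> 0"
    using strongly_measurableE[OF u] by blast
  show ?thesis
  proof (rule complete_measure.borel_measurable_AE_limit[OF complete_measure_interval])
    show "(\<lambda>t. G (s k t) t) \<in> borel_measurable (I\<^sub>T T)" for k
      by (rule simple_into_measurable[OF s(1) G])
    have "AE t in I\<^sub>T T. t \<in> {0<..<T}" by (rule AE_I2) simp
    then show "AE t in I\<^sub>T T. (\<lambda>k. G (s k t) t) \<longlonglongrightarrow> G (u t) t"
      using s(2,3) lip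
    proof eventually_elim
      case (elim t)
      obtain B where B: "\<And>x y. x \<in> X \<Longrightarrow> y \<in> X \<Longrightarrow> \<bar>G x t - G y t\<bar> \<le> B * nrm (\<lambda>z. x z - y z)"
        using elim(4) by blast
      have lim: "(\<lambda>k. B * nrm (\<lambda>x. s k t x - u t x)) \<longlonglongrightarrow> 0"
        using elim(3) by (rule tendsto_mult_right_zero)
      have "(\<lambda>k. G (s k t) t - G (u t) t) \<longlonglongrightarrow> 0"
      proof (rule Lim_null_comparison[OF _ lim])
        have "norm (G (s k t) t - G (u t) t) \<le> B * nrm (\<lambda>x. s k t x - u t x)" for k
          using B[OF simple_into_mem[OF s(1) elim(1)] elim(2)] by simp
        then show "\<forall>\<^sub>F k in sequentially. norm (G (s k t) t - G (u t) t) \<le> B * nrm (\<lambda>x. s k t x - u t x)"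
          by (intro always_eventually allI)
      qed
      then show ?case by (simp add: LIM_zero_iff)
    qed
  qed
qed

lemma strongly_measurable_nrm_diff_simple:
  assumes u: "strongly_measurable X nrm T u" and r: "simple_into X T r"
  shows "(\<lambda>t. nrm (\<lambda>x. u t x - r t x)) \<in> borel_measurable (I\<^sub>T T)"
proof (rule strongly_measurable_apply[OF u])
  show "(\<lambda>t. nrm (\<lambda>x. y x - r t x)) \<in> borel_measurable (I\<^sub>T T)" for y
    using simple_into_measurable[OF r, of "\<lambda>z t. nrm (\<lambda>x. y x - z x)"] by simp
  show "AE t in I\<^sub>T T. \<exists>B. \<forall>x\<in>X. \<forall>y\<in>X. \<bar>nrm (\<lambda>z. x z - r t z) - nrm (\<lambda>z. y z - r t z)\<bar> \<le> B * nrm (\<lambda>z. x z - y z)"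
    using AE_simple_into_mem[OF r]
  proof eventually_elim
    case (elim t)
    have "\<bar>nrm (\<lambda>z. x z - r t z) - nrm (\<lambda>z. y z - r t z)\<bar> \<le> 1 * nrm (\<lambda>z. x z - y z)" if "x \<in> X" "y \<in> X" for x y
      using abs_nrm_diff_le[OF diff[OF that(1) elim] diff[OF that(2) elim]] by simp
    then show ?case by blast
  qed
qed

lemma simple_into_zero: "simple_into X T (\<lambda>t z. 0)"
proof -
  have "{t \<in> {0<..<T}. (\<lambda>z. 0) = (y :: 'b \<Rightarrow> real)} = (if (\<lambda>z. 0) = y then {0<..<T} else {})" for y
    by auto
  then show ?thesis using zero by (auto simp: simple_into_def image_constant_conv)
qed

lemma strongly_measurable_nrm:
  assumes u: "strongly_measurable X nrm T u"
  shows "(\<lambda>t. nrm (u t)) \<in> borel_measurable (I\<^sub>T T)"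
  using strongly_measurable_nrm_diff_simple[OF u simple_into_zero] by simp

lemma strongly_measurable_diff:
  assumes u: "strongly_measurable X nrm T u" and v: "strongly_measurable X nrm T v"
  shows "strongly_measurable X nrm T (\<lambda>t z. u t z - v t z)"
proof -
  obtain s where s: "\<And>k. simple_into X T (s k)" "AE t in I\<^sub>T T. u t \<in> X"
    "AE t in I\<^sub>T T. (\<lambda>k. nrm (\<lambda>x. s k t x - u t x)) \<longlonglongrightarrow> 0"
    using strongly_measurableE[OF u] by blast
  obtain r where r: "\<And>k. simple_into X T (r k)" "AE t in I\<^sub>T T. v t \<in> X"
    "AE t in I\<^sub>T T. (\<lambda>k. nrm (\<lambda>x. r k t x - v t x)) \<longlonglongrightarrow> 0"
    using strongly_measurableE[OF v] by blast
  show ?thesis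
    unfolding strongly_measurable_def
  proof (intro conjI exI[of _ "\<lambda>k t z. s k t z - r k t z"] allI)
    show "AE t in I\<^sub>T T. (\<lambda>z. u t z - v t z) \<in> X"
      using s(2) r(2) by eventually_elim (rule diff)
    show "simple_into X T (\<lambda>t z. s k t z - r k t z)" for k by (intro simple_into_diff s r)
    have "AE t in I\<^sub>T T. t \<in> {0<..<T}" by (rule AE_I2) simp
    then show "AE t in I\<^sub>T T. (\<lambda>k. nrm (\<lambda>x. s k t x - r k t x - (u t x - v t x))) \<longlonglongrightarrow> 0"
      using s(2,3) r(2,3)
    proof eventually_elim
      case (elim t)
      have m: "s k t \<in> X" "r k t \<in> X" for k using simple_into_mem[OF s(1) elim(1)] simple_into_mem[OF r(1) elim(1)] by auto
      have "nrm (\<lambda>x. s k t x - r k t x - (u t x - v t x)) \<le> nrm (\<lambda>x. s k t x - u t x) + nrm (\<lambda>x. r k t x - v t x)" for k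
      proof -
        have "(\<lambda>x. s k t x - r k t x - (u t x - v t x)) = (\<lambda>x. (s k t x - u t x) - (r k t x - v t x))"
          by (simp add: fun_eq_iff)
        then show ?thesis
          using nrm_diff_le_add[OF diff diff, of "s k t" "u t" "r k t" "v t"] m elim by simp
      qed
      moreover have "0 \<le> nrm (\<lambda>x. s k t x - r k t x - (u t x - v t x))" for k
        using m elim by (intro nrm_nonneg diff) auto
      ultimately have le: "norm (nrm (\<lambda>x. s k t x - r k t x - (u t x - v t x))) \<le> nrm (\<lambda>x. s k t x - u t x) + nrm (\<lambda>x. r k t x - v t x)" for k
        by simp
      have lim: "(\<lambda>k. nrm (\<lambda>x. s k t x - u t x) + nrm (\<lambda>x. r k t x - v t x)) \<longlonglongrightarrow> 0"
        using elim(3,5) by (rule tendsto_add_zero)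
      show ?case
      proof (rule Lim_null_comparison[OF _ lim])
        show "\<forall>\<^sub>F k in sequentially. norm (nrm (\<lambda>x. s k t x - r k t x - (u t x - v t x))) \<le> nrm (\<lambda>x. s k t x - u t x) + nrm (\<lambda>x. r k t x - v t x)"
          using le by (intro always_eventually allI)
      qed
    qed
  qed
qed

lemma Bochner_L2_diff:
  assumes u: "u \<in> Bochner_L2 X nrm T" and v: "v \<in> Bochner_L2 X nrm T"
  shows "(\<lambda>t z. u t z - v t z) \<in> Bochner_L2 X nrm T"
proof -
  have m: "strongly_measurable X nrm T (\<lambda>t z. u t z - v t z)"
    using u v by (intro strongly_measurable_diff) (auto simp: Bochner_L2_def)
  have L: "(\<lambda>t. nrm (u t)) \<in> Lp 2 (I\<^sub>T T)" "(\<lambda>t. nrm (v t)) \<in> Lp 2 (I\<^sub>T T)"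
    "AE t in I\<^sub>T T. u t \<in> X" "AE t in I\<^sub>T T. v t \<in> X"
    using u v by (auto simp: Bochner_L2_def strongly_measurable_def)
  have "(\<lambda>t. nrm (\<lambda>z. u t z - v t z)) \<in> Lp 2 (I\<^sub>T T)"
  proof (rule Lp2_bound[OF Lp2_add[OF L(1,2)], where c=1])
    show "AE t in I\<^sub>T T. norm (nrm (\<lambda>z. u t z - v t z)) \<le> 1 * norm (nrm (u t) + nrm (v t))"
      using L(3,4)
    proof eventually_elim
      case (elim t)
      then show ?case using nrm_diff_le_add[OF elim] nrm_nonneg[OF diff[OF elim]] by simp
    qed
  qed (rule strongly_measurable_nrm[OF m])
  then show ?thesis using m by (simp add: Bochner_L2_def)
qed

text \<open>Membership, in particular measurability of the norm, is what makes the norm of a difference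
  meaningful: \<open>esssup\<close> of a non-measurable function is \<open>\<infinity>\<close>, which \<open>real_of_ereal\<close> sends to \<open>0\<close>.\<close>

lemma Bochner_Linf_diff:
  assumes u: "u \<in> Bochner_Linf X nrm T" and v: "v \<in> Bochner_Linf X nrm T"
  shows "(\<lambda>t z. u t z - v t z) \<in> Bochner_Linf X nrm T"
proof -
  have m: "strongly_measurable X nrm T (\<lambda>t z. u t z - v t z)"
    using u v by (intro strongly_measurable_diff) (auto simp: Bochner_Linf_def)
  have L: "(\<lambda>t. nrm (u t)) \<in> Linf (I\<^sub>T T)" "(\<lambda>t. nrm (v t)) \<in> Linf (I\<^sub>T T)"
    "AE t in I\<^sub>T T. u t \<in> X" "AE t in I\<^sub>T T. v t \<in> X"
    using u v by (auto simp: Bochner_Linf_def strongly_measurable_def)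
  have "AE t in I\<^sub>T T. norm (nrm (\<lambda>z. u t z - v t z)) \<le> Linf_norm (I\<^sub>T T) (\<lambda>t. nrm (u t)) + Linf_norm (I\<^sub>T T) (\<lambda>t. nrm (v t))"
    using L(3,4) Linf_AE_bound[OF L(1)] Linf_AE_bound[OF L(2)]
  proof eventually_elim
    case (elim t)
    then show ?case using nrm_diff_le_add[OF elim(1,2)] nrm_nonneg[OF diff[OF elim(1,2)]] by simp
  qed
  then show ?thesis using m strongly_measurable_nrm[OF m] by (auto simp: Bochner_Linf_def Linf_def)
qed

lemma Bochner_Linf_AE_bound:
  assumes u: "u \<in> Bochner_Linf X nrm T"
  shows "AE t in I\<^sub>T T. u t \<in> X \<and> nrm (u t) \<le> Bochner_Linf_norm nrm T u"
proof -
  have "AE t in I\<^sub>T T. u t \<in> X" "(\<lambda>t. nrm (u t)) \<in> Linf (I\<^sub>T T)"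
    using u by (auto simp: Bochner_Linf_def strongly_measurable_def)
  from this(1) Linf_AE_bound[OF this(2)] show ?thesis
    by eventually_elim (auto simp: Bochner_Linf_norm_def)
qed

text \<open>Truncating the approximating simple functions where they exceed twice the norm of the
  limit gives a dominating function.\<close>

lemma Bochner_L2_simple_approx:
  assumes u: "u \<in> Bochner_L2 X nrm T" and e: "0 < e"
  obtains \<sigma> where "simple_into X T \<sigma>" "integrable (I\<^sub>T T) (\<lambda>t. (nrm (\<lambda>x. u t x - \<sigma> t x))\<^sup>2)"
    "(LINT t|I\<^sub>T T. (nrm (\<lambda>x. u t x - \<sigma> t x))\<^sup>2) < e"
proof -
  have sm: "strongly_measurable X nrm T u" and L2: "(\<lambda>t. nrm (u t)) \<in> Lp 2 (I\<^sub>T T)"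
    using u by (auto simp: Bochner_L2_def)
  obtain s where s: "\<And>k. simple_into X T (s k)" "AE t in I\<^sub>T T. u t \<in> X"
    "AE t in I\<^sub>T T. (\<lambda>k. nrm (\<lambda>x. s k t x - u t x)) \<longlonglongrightarrow> 0"
    using strongly_measurableE[OF sm] by blast
  define \<sigma> where "\<sigma> k t = (if nrm (s k t) \<le> 2 * nrm (u t) then s k t else (\<lambda>z. 0))" for k t
  define z0 :: "'b \<Rightarrow> real" where "z0 = (\<lambda>z. 0)"
  have \<sigma>0: "\<sigma> k t = (if nrm (s k t) \<le> 2 * nrm (u t) then s k t else z0)" for k t
    by (simp add: \<sigma>_def z0_def)
  have inT: "AE t in I\<^sub>T T. t \<in> {0<..<T}" by (rule AE_I2) simp
  have \<sigma>s: "simple_into X T (\<sigma> k)" for k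
    unfolding simple_into_def
  proof (intro conjI allI)
    have im: "\<sigma> k ` {0<..<T} \<subseteq> insert (\<lambda>z. 0) (s k ` {0<..<T})" by (auto simp: \<sigma>_def)
    have sk: "finite (s k ` {0<..<T})" "s k ` {0<..<T} \<subseteq> X" using s(1)[of k] by (auto simp: simple_into_def)
    show "finite (\<sigma> k ` {0<..<T})" using finite_subset[OF im] sk(1) by simp
    show "\<sigma> k ` {0<..<T} \<subseteq> X" using subset_trans[OF im] sk(2) zero by simp
    fix y
    have "{t \<in> space (I\<^sub>T T). nrm (s k t) \<le> 2 * nrm (u t)} \<in> sets (I\<^sub>T T)"
      using simple_into_measurable[OF s(1), of "\<lambda>y t. nrm y"] strongly_measurable_nrm[OF sm] by measurable
    then have A': "{t \<in> {0<..<T}. nrm (s k t) \<le> 2 * nrm (u t)} \<in> sets lebesgue"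
      by (auto simp: sets_restrict_space_iff)
    have B: "{t \<in> {0<..<T}. s k t = y} \<in> sets lebesgue" using s(1)[of k] by (auto simp: simple_into_def)
    have "{t \<in> {0<..<T}. \<sigma> k t = y} =
       ({t \<in> {0<..<T}. s k t = y} \<inter> {t \<in> {0<..<T}. nrm (s k t) \<le> 2 * nrm (u t)}) \<union>
       (if y = z0 then {0<..<T} - {t \<in> {0<..<T}. nrm (s k t) \<le> 2 * nrm (u t)} else {})"
      (is "?L = ?R")
    proof (rule set_eqI)
      fix t show "t \<in> ?L \<longleftrightarrow> t \<in> ?R"
        by (cases "nrm (s k t) \<le> 2 * nrm (u t)"; cases "y = z0") (simp_all only: \<sigma>0 if_True if_False, auto)
    qed
    also have "\<dots> \<in> sets lebesgue"
    proof (intro sets.Un sets.Int A' B)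
      show "(if y = z0 then {0<..<T} - {t \<in> {0<..<T}. nrm (s k t) \<le> 2 * nrm (u t)} else {}) \<in> sets lebesgue"
        using sets.Diff[OF _ A', of "{0<..<T}"] by simp
    qed
    finally show "{t \<in> {0<..<T}. \<sigma> k t = y} \<in> sets lebesgue" .
  qed
  have \<sigma>le: "nrm (\<sigma> k t) \<le> 2 * nrm (u t)" if "u t \<in> X" for k t
    using nrm_nonneg[OF that] by (simp add: \<sigma>_def nrm_zero)
  have lim: "AE t in I\<^sub>T T. (\<lambda>k. (nrm (\<lambda>x. u t x - \<sigma> k t x))\<^sup>2) \<longlonglongrightarrow> 0"
    using inT s(2,3)
  proof eventually_elim
    case (elim t)
    have sX: "s k t \<in> X" for k using simple_into_mem[OF s(1) elim(1)] by auto
    have "(\<lambda>k. nrm (\<lambda>x. u t x - \<sigma> k t x)) \<longlonglongrightarrow> 0"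
    proof (cases "nrm (u t) = 0")
      case True
      \<comment> \<open>Where \<open>u t\<close> has norm 0, truncation leaves only approximants of
        norm 0.\<close>
      have "nrm (\<lambda>x. u t x - \<sigma> k t x) = 0" for k
      proof -
        have \<sigma>X: "\<sigma> k t \<in> X" using sX zero by (simp add: \<sigma>_def)
        have "nrm (\<sigma> k t) = 0" using \<sigma>le[OF elim(2), of k] True nrm_nonneg[OF \<sigma>X] by simp
        then show ?thesis using nrm_diff_le_add[OF elim(2) \<sigma>X] nrm_nonneg[OF diff[OF elim(2) \<sigma>X]] True by simp
      qed
      then show ?thesis by simp
    next
      case False
      then have "0 < nrm (u t)" using nrm_nonneg[OF elim(2)] by simp
      \<comment> \<open>An approximant closer to \<open>u t\<close> than the norm of
        \<open>u t\<close> has at most twice that norm, so truncation is eventually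
        inactive.\<close>
      then have "\<forall>\<^sub>F k in sequentially. nrm (\<lambda>x. s k t x - u t x) < nrm (u t)"
        using elim(3) order_tendstoD(2) by blast
      then have "\<forall>\<^sub>F k in sequentially. nrm (\<lambda>x. s k t x - u t x) = nrm (\<lambda>x. u t x - \<sigma> k t x)"
      proof eventually_elim
        case (elim k)
        have "nrm (s k t) \<le> nrm (u t) + nrm (\<lambda>x. s k t x - u t x)"
          by (rule nrm_le_add_diff[OF sX \<open>u t \<in> X\<close>])
        then have "\<sigma> k t = s k t" using elim by (simp add: \<sigma>_def)
        then show ?case using nrm_minus_commute[OF sX \<open>u t \<in> X\<close>] by simp
      qed
      from Lim_transform_eventually[OF elim(3) this] show ?thesis .
    qed
    from tendsto_power[OF this, of 2] show ?case by simp
  qed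
  \<comment> \<open>Truncation bounds the distance by 1 + 2 = 3 times the norm of
    \<open>u t\<close>, and 9 = 3^2.\<close>
  have ule: "AE t in I\<^sub>T T. (nrm (\<lambda>x. u t x - \<sigma> k t x))\<^sup>2 \<le> 9 * (nrm (u t))\<^sup>2" for k
    using AE_simple_into_mem[OF \<sigma>s[of k]] s(2)
  proof eventually_elim
    case (elim t)
    have "nrm (\<lambda>x. u t x - \<sigma> k t x) \<le> 3 * nrm (u t)"
      using nrm_diff_le_add[OF elim(2,1)] \<sigma>le[OF elim(2), of k] by linarith
    then have "(nrm (\<lambda>x. u t x - \<sigma> k t x))\<^sup>2 \<le> (3 * nrm (u t))\<^sup>2"
      using nrm_nonneg[OF diff[OF elim(2,1)]] by (intro power_mono)
    then show ?case by (simp add: power_mult_distrib)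
  qed
  have wi: "integrable (I\<^sub>T T) (\<lambda>t. 9 * (nrm (u t))\<^sup>2)" using L2 by (auto simp: Lp2_iff)
  have meas: "(\<lambda>t. (nrm (\<lambda>x. u t x - \<sigma> k t x))\<^sup>2) \<in> borel_measurable (I\<^sub>T T)" for k
    using strongly_measurable_nrm_diff_simple[OF sm \<sigma>s[of k]] by measurable
  have "(\<lambda>k. LINT t|I\<^sub>T T. (nrm (\<lambda>x. u t x - \<sigma> k t x))\<^sup>2) \<longlonglongrightarrow> (LINT t|I\<^sub>T T. 0)"
  proof (rule integral_dominated_convergence[where w="\<lambda>t. 9 * (nrm (u t))\<^sup>2"])
    show "AE t in I\<^sub>T T. norm ((nrm (\<lambda>x. u t x - \<sigma> k t x))\<^sup>2) \<le> 9 * (nrm (u t))\<^sup>2" for k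
      using ule[of k] by eventually_elim simp
  qed (use wi meas lim in auto)
  then have "\<forall>\<^sub>F k in sequentially. (LINT t|I\<^sub>T T. (nrm (\<lambda>x. u t x - \<sigma> k t x))\<^sup>2) < e"
    using e order_tendstoD(2) by fastforce
  then obtain k where k: "(LINT t|I\<^sub>T T. (nrm (\<lambda>x. u t x - \<sigma> k t x))\<^sup>2) < e"
    by (auto simp: eventually_sequentially)
  have "integrable (I\<^sub>T T) (\<lambda>t. (nrm (\<lambda>x. u t x - \<sigma> k t x))\<^sup>2)"
    by (rule Bochner_Integration.integrable_bound[OF wi meas]) (use ule[of k] in \<open>eventually_elim, simp\<close>)
  then show ?thesis using that \<sigma>s k by blast
qed

end

section \<open>The three function spaces as instances\<close>

lemma seminormed_H1: "open D \<Longrightarrow> seminormed_functions (H1 D) (H1_norm D)"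
  by unfold_locales (auto simp: H1_zero H1_add(1) H1_scale(1) H1_norm_triangle H1_norm_scale H1_norm_nonneg)

lemma seminormed_W1inf: "open D \<Longrightarrow> seminormed_functions (W1inf D) (W1inf_norm D)"
proof unfold_locales
  show "(\<lambda>_. 0) \<in> W1inf D" by (rule W1infI[OF Linf_zero Linf_zero has_weak_grad_zero])
qed (auto simp: W1inf_add W1inf_scale_le W1inf_norm_def intro: W1inf_add(3)[unfolded W1inf_norm_def] W1inf_scale_le(3)[unfolded W1inf_norm_def])

lemma H1_dualD:
  assumes "l \<in> H1_dual D"
  shows "u \<in> H1 D \<Longrightarrow> v \<in> H1 D \<Longrightarrow> l (\<lambda>x. u x + v x) = l u + l v"
    "u \<in> H1 D \<Longrightarrow> l (\<lambda>x. c * u x) = c * l u"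
  using assms unfolding H1_dual_def by blast+

lemma H1_dualI:
  assumes "\<And>u v. u \<in> H1 D \<Longrightarrow> v \<in> H1 D \<Longrightarrow> l (\<lambda>x. u x + v x) = l u + l v"
    "\<And>u c. u \<in> H1 D \<Longrightarrow> l (\<lambda>x. c * u x) = c * l u"
    "\<And>u. u \<in> H1 D \<Longrightarrow> \<bar>l u\<bar> \<le> B * H1_norm D u"
  shows "l \<in> H1_dual D"
  using assms unfolding H1_dual_def by blast

lemma H1_dual_diff_arg:
  assumes D: "open D" and l: "l \<in> H1_dual D" and "u \<in> H1 D" "v \<in> H1 D"
  shows "l (\<lambda>x. u x - v x) = l u - l v"
proof -
  have "l (\<lambda>x. u x + (-1) * v x) = l u + l (\<lambda>x. (-1) * v x)"
    by (intro H1_dualD[OF l] assms H1_scale(1)[OF D])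
  then show ?thesis using H1_dualD(2)[OF l assms(4), of "-1"] by simp
qed

lemma H1_dual_norm_nonneg:
  assumes D: "open D" and l: "l \<in> H1_dual D"
  shows "0 \<le> H1_dual_norm D l"
proof -
  have "(\<lambda>x. 0) \<in> {u \<in> H1 D. H1_norm D u \<le> 1}"
    using H1_zero[of D] H1_norm_scale[OF D H1_zero, of 0] by auto
  then have "\<bar>l (\<lambda>x. 0)\<bar> \<le> H1_dual_norm D l"
    unfolding H1_dual_norm_def by (rule cSUP_upper[OF _ H1_dual_bdd_above[OF l]])
  then show ?thesis using abs_ge_zero order_trans by blast
qed

lemma seminormed_H1_dual:
  assumes D: "open D"
  shows "seminormed_functions (H1_dual D) (H1_dual_norm D)"
proof unfold_locales
  show "(\<lambda>_. 0) \<in> H1_dual D" by (rule H1_dualI[where B=0]) auto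
  fix l m assume l: "l \<in> H1_dual D" and m: "m \<in> H1_dual D"
  show "0 \<le> H1_dual_norm D l" by (rule H1_dual_norm_nonneg[OF D l])
  have b: "\<bar>l u + m u\<bar> \<le> (H1_dual_norm D l + H1_dual_norm D m) * H1_norm D u" if "u \<in> H1 D" for u
    using H1_dual_bound[OF l that D] H1_dual_bound[OF m that D] by (simp add: distrib_right)
  then show "(\<lambda>u. l u + m u) \<in> H1_dual D"
    by (intro H1_dualI[where B="H1_dual_norm D l + H1_dual_norm D m"])
      (auto simp: H1_dualD[OF l] H1_dualD[OF m] algebra_simps)
  show "H1_dual_norm D (\<lambda>u. l u + m u) \<le> H1_dual_norm D l + H1_dual_norm D m"
    using b H1_dual_norm_nonneg[OF D l] H1_dual_norm_nonneg[OF D m] by (intro H1_dual_norm_le[OF D]) auto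
  fix c :: real
  have b: "\<bar>c * l u\<bar> \<le> (\<bar>c\<bar> * H1_dual_norm D l) * H1_norm D u" if "u \<in> H1 D" for u
    using mult_left_mono[OF H1_dual_bound[OF l that D], of "\<bar>c\<bar>"] by (simp add: abs_mult mult.assoc)
  then show "(\<lambda>u. c * l u) \<in> H1_dual D"
    by (intro H1_dualI[where B="\<bar>c\<bar> * H1_dual_norm D l"]) (auto simp: H1_dualD[OF l] algebra_simps)
  show "H1_dual_norm D (\<lambda>u. c * l u) \<le> \<bar>c\<bar> * H1_dual_norm D l"
    using b H1_dual_norm_nonneg[OF D l] by (intro H1_dual_norm_le[OF D]) auto
qed

section \<open>Difference quotients in time\<close>

lemma integrable_lebesgue_on_subset:
  fixes f :: "'a::euclidean_space \<Rightarrow> 'b::euclidean_space"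
  assumes "integrable (lebesgue_on S) f" "A \<subseteq> S" "A \<in> sets lebesgue" "S \<in> sets lebesgue"
  shows "integrable (lebesgue_on A) f"
proof -
  have "integrable lebesgue (\<lambda>x. indicator S x *\<^sub>R f x)"
    using assms by (simp add: integrable_restrict_space)
  from integrable_mult_indicator[OF assms(3) this]
  have "integrable lebesgue (\<lambda>x. indicator A x *\<^sub>R (indicator S x *\<^sub>R f x))" .
  moreover have "(\<lambda>x. indicator A x *\<^sub>R (indicator S x *\<^sub>R f x)) = (\<lambda>x. indicator A x *\<^sub>R f x)"
    using assms(2) by (auto simp: fun_eq_iff indicator_def)
  ultimately show ?thesis using assms by (simp add: integrable_restrict_space)
qed

lemma AE_lebesgue_on_subset:
  assumes "AE x in lebesgue_on S. P x" "A \<subseteq> S" "A \<in> sets lebesgue" "S \<in> sets lebesgue"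
  shows "AE x in lebesgue_on A. P x"
proof -
  have "AE x in lebesgue. x \<in> S \<longrightarrow> P x" using assms by (simp add: AE_restrict_space_iff)
  then have "AE x in lebesgue. x \<in> A \<longrightarrow> P x" by eventually_elim (use assms(2) in auto)
  then show ?thesis using assms by (simp add: AE_restrict_space_iff)
qed

lemma integrable_lebesgue_on_indicator_mult:
  fixes f :: "'a::euclidean_space \<Rightarrow> real"
  assumes "A \<in> sets lebesgue" "integrable (lebesgue_on S) f"
  shows "integrable (lebesgue_on S) (\<lambda>s. indicator A s * f s)"
proof (rule Bochner_Integration.integrable_bound[OF assms(2)])
  show "(\<lambda>s. indicator A s * f s) \<in> borel_measurable (lebesgue_on S)"
    using assms by (intro borel_measurable_times measurable_restrict_space1[OF borel_measurable_indicator] borel_measurable_integrable)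
qed (auto simp: abs_mult indicator_def)

text \<open>Later N is a square, integrated over moving windows [s - h, s]. Written as \<Psi> s -
  \<Psi> (s - h), these integrals are continuous in s, and their means over the window have a known
  limit by \<open>difference_quotient_integral_tendsto\<close>.\<close>

lemma indefinite_LINT:
  fixes N :: "real \<Rightarrow> real"
  assumes N: "integrable (lebesgue_on {a0..b}) N"
  obtains \<Psi> where "continuous_on {a0..b} \<Psi>"
    "\<And>c d. a0 \<le> c \<Longrightarrow> c \<le> d \<Longrightarrow> d \<le> b \<Longrightarrow> (LINT t|lebesgue_on {c..d}. N t) = \<Psi> d - \<Psi> c"
proof -
  have Ni: "integrable (lebesgue_on {c..d}) N" if "a0 \<le> c" "d \<le> b" for c d
    by (rule integrable_lebesgue_on_subset[OF N]) (use that in auto)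
  have Nh: "N integrable_on {c..d}" if "a0 \<le> c" "d \<le> b" for c d
    using integrable_on_lebesgue_on[OF Ni[OF that]] by simp
  have "(LINT t|lebesgue_on {c..d}. N t) = integral {a0..d} N - integral {a0..c} N"
    if "a0 \<le> c" "c \<le> d" "d \<le> b" for c d
    using Henstock_Kurzweil_Integration.integral_combine[OF that(1,2) Nh] that
      lebesgue_integral_eq_integral[OF Ni[OF that(1,3)]] by simp
  moreover have "continuous_on {a0..b} (\<lambda>x. integral {a0..x} N)"
    by (intro indefinite_integral_continuous_1 Nh) auto
  ultimately show ?thesis using that by blast
qed

lemma LINT_lebesgue_on_indicator:
  fixes f :: "'a::euclidean_space \<Rightarrow> real"
  assumes "A \<in> sets lebesgue" "S \<in> sets lebesgue"
  shows "(LINT s|lebesgue_on S. indicator A s * f s) = (LINT s|lebesgue_on (S \<inter> A). f s)"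
  using assms by (simp add: integral_restrict_space indicator_inter_arith ac_simps)

text \<open>Testing with smooth steps produces the indicator of an open interval, while the energy
  argument works with closed windows; the endpoints are negligible.\<close>

lemma LINT_lebesgue_on_open_interval:
  fixes f :: "real \<Rightarrow> real"
  assumes f: "integrable (I\<^sub>T T) f" and ab: "0 < a" "a \<le> b" "b < T"
  shows "(LINT t|I\<^sub>T T. f t * indicator {a<..<b} t) = (LINT t|lebesgue_on {a..b}. f t)"
proof -
  have "{a<..<b} \<subseteq> {0<..<T}" "{a..b} \<subseteq> {0<..<T}" using ab by auto
  then have i: "integrable (lebesgue_on {a<..<b}) f" "integrable (lebesgue_on {a..b}) f"
    using f by (auto intro: integrable_lebesgue_on_subset)
  have "{0<..<T} \<inter> {a<..<b} = {a<..<b}" using ab by auto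
  then have "(LINT t|I\<^sub>T T. f t * indicator {a<..<b} t) = (LINT t|lebesgue_on {a<..<b}. f t)"
    using LINT_lebesgue_on_indicator[of "{a<..<b}" "{0<..<T}" f] by (simp add: mult.commute)
  also have "\<dots> = integral {a<..<b} f" by (rule lebesgue_integral_eq_integral[OF i(1)]) simp
  also have "\<dots> = integral {a..b} f" by (simp add: integral_open_interval_real)
  also have "\<dots> = (LINT t|lebesgue_on {a..b}. f t)"
    by (rule lebesgue_integral_eq_integral[symmetric, OF i(2)]) simp
  finally show ?thesis .
qed

section \<open>Convergence of difference quotients\<close>

lemma continuous_on_difference_quotient:
  fixes G :: "real \<Rightarrow> real"
  assumes G: "continuous_on {a0..b} G" and h: "0 < h" "h \<le> a - a0"
  shows "continuous_on {a..b} (\<lambda>s. (G s - G (s - h)) / h)"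
proof -
  have "continuous_on {a..b} G" by (rule continuous_on_subset[OF G]) (use h in auto)
  moreover have "continuous_on {a..b} (\<lambda>s. G (s - h))"
    by (rule continuous_on_compose2[OF G]) (use h in \<open>auto intro!: continuous_intros\<close>)
  ultimately show ?thesis using h by (intro continuous_on_divide continuous_on_diff continuous_on_const) auto
qed

text \<open>By a shift of variable the integral is the backward difference quotient at b of a
  primitive of G minus the one at a, and the fundamental theorem gives the limit. The gap between a0
  and a makes room for the shift to the left.\<close>

lemma difference_quotient_integral_tendsto:
  fixes G :: "real \<Rightarrow> real"
  assumes G: "continuous_on {a0..b} G" and ab: "a0 < a" "a \<le> b"
  shows "((\<lambda>h. LINT s|lebesgue_on {a..b}. (G s - G (s - h)) / h) \<longlongrightarrow> G b - G a) (at_right 0)"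
proof -
  define \<Gamma> where "\<Gamma> x = integral {a0..x} G" for x
  have io: "G integrable_on {x..y}" if "a0 \<le> x" "y \<le> b" for x y
    by (rule integrable_continuous_interval, rule continuous_on_subset[OF G]) (use that in auto)
  have \<Gamma>: "integral {x..y} G = \<Gamma> y - \<Gamma> x" if "a0 \<le> x" "x \<le> y" "y \<le> b" for x y
    using Henstock_Kurzweil_Integration.integral_combine[OF that(1,2) io] that by (simp add: \<Gamma>_def)
  have lim: "((\<lambda>h. (\<Gamma> x - \<Gamma> (x - h)) / h) \<longlongrightarrow> G x) (at_right 0)" if x: "a0 < x" "x \<le> b" for x
  proof -
    have "(\<Gamma> has_real_derivative G x) (at x within {a0..b})"
      unfolding \<Gamma>_def by (rule integral_has_real_derivative[OF G]) (use x in auto)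
    then have l: "((\<lambda>y. (\<Gamma> y - \<Gamma> x) / (y - x)) \<longlongrightarrow> G x) (at x within {a0..b})"
      by (simp add: has_field_derivative_iff)
    have "filterlim (\<lambda>h. x - h) (at x within {a0..b}) (at_right 0)"
      unfolding filterlim_at
    proof
      have "\<forall>\<^sub>F h in at_right 0. h \<in> {0<..<x - a0}"
        using x by (intro eventually_at_right_real) auto
      then show "\<forall>\<^sub>F h in at_right 0. x - h \<in> {a0..b} \<and> x - h \<noteq> x"
        by eventually_elim (use x in auto)
      have "((\<lambda>h. x - h) \<longlongrightarrow> x - 0) (at_right 0)" by (intro tendsto_intros)
      then show "((\<lambda>h. x - h) \<longlongrightarrow> x) (at_right 0)" by simp
    qed
    from filterlim_compose[OF l this]
    have "((\<lambda>h. (\<Gamma> (x - h) - \<Gamma> x) / (x - h - x)) \<longlongrightarrow> G x) (at_right 0)" .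
    moreover have "(\<Gamma> (x - h) - \<Gamma> x) / (x - h - x) = (\<Gamma> x - \<Gamma> (x - h)) / h" for h
      by (simp add: minus_divide_divide[symmetric, of "\<Gamma> (x - h) - \<Gamma> x"])
    ultimately show ?thesis by simp
  qed
  have "((\<lambda>h. (\<Gamma> b - \<Gamma> (b - h)) / h - (\<Gamma> a - \<Gamma> (a - h)) / h) \<longlongrightarrow> G b - G a) (at_right 0)"
    using ab by (intro tendsto_diff lim) auto
  moreover have "\<forall>\<^sub>F h in at_right 0. h \<in> {0<..<a - a0}"
    using ab by (intro eventually_at_right_real) auto
  then have "\<forall>\<^sub>F h in at_right 0. (\<Gamma> b - \<Gamma> (b - h)) / h - (\<Gamma> a - \<Gamma> (a - h)) / h =
      (LINT s|lebesgue_on {a..b}. (G s - G (s - h)) / h)"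
  proof eventually_elim
    case (elim h)
    then have h: "0 < h" "h < a - a0" by auto
    have "continuous_on {a..b} (\<lambda>s. (G s - G (s - h)) / h)"
      by (rule continuous_on_difference_quotient[OF G]) (use h in auto)
    then have "(LINT s|lebesgue_on {a..b}. (G s - G (s - h)) / h) = integral {a..b} (\<lambda>s. (G s - G (s - h)) / h)"
      by (intro lebesgue_integral_eq_integral continuous_imp_integrable_real) auto
    also have "\<dots> = integral {a..b} (\<lambda>s. G s - G (s - h)) / h"
      by simp
    also have "integral {a..b} (\<lambda>s. G s - G (s - h)) = integral {a..b} G - integral {a..b} (\<lambda>s. G (s - h))"
    proof (rule integral_diff)
      show "G integrable_on {a..b}" using ab by (intro io) auto
      show "(\<lambda>s. G (s - h)) integrable_on {a..b}"
        by (intro integrable_continuous_interval continuous_on_compose2[OF G])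
          (use h in \<open>auto intro!: continuous_intros\<close>)
    qed
    also have "integral {a..b} (\<lambda>s. G (s - h)) = integral {a - h..b - h} G"
      using integral_shift_Icc_real[of a b G "-h"] by (simp add: o_def)
    also have "integral {a..b} G = \<Gamma> b - \<Gamma> a" using ab by (intro \<Gamma>) auto
    also have "integral {a - h..b - h} G = \<Gamma> (b - h) - \<Gamma> (a - h)" using ab h by (intro \<Gamma>) auto
    finally show ?case by (simp add: diff_divide_distrib)
  qed
  ultimately show ?thesis by (rule Lim_transform_eventually)
qed

lemma young_ineq: "0 < (\<delta>::real) \<Longrightarrow> a * b \<le> a\<^sup>2 / (2 * \<delta>) + \<delta> / 2 * b\<^sup>2"
proof -
  assume d: "0 < \<delta>"
  have "0 \<le> (a - \<delta> * b)\<^sup>2 / (2 * \<delta>)" using d by simp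
  also have "\<dots> = a\<^sup>2 / (2 * \<delta>) + \<delta> / 2 * b\<^sup>2 - a * b"
    using d by (simp add: field_simps power2_eq_square)
  finally show ?thesis by simp
qed

text \<open>Young's inequality under the integral, with free weight \<delta>. With c = 1 it yields
  the equi-integrability of difference quotients; with c the H1 norm of an approximation error it
  trades that error against the squared dual norm of the time derivative.\<close>

lemma increment_bound:
  fixes q N :: "real \<Rightarrow> real"
  assumes q: "integrable (lebesgue_on {r..s}) q" and N: "integrable (lebesgue_on {r..s}) (\<lambda>t. (N t)\<^sup>2)"
    and le: "AE t in lebesgue_on {r..s}. \<bar>q t\<bar> \<le> c * N t" and d: "0 < \<delta>" and rs: "r \<le> s"
  shows "\<bar>LINT t|lebesgue_on {r..s}. q t\<bar> \<le> (s - r) * (c\<^sup>2 / (2 * \<delta>)) + \<delta> / 2 * (LINT t|lebesgue_on {r..s}. (N t)\<^sup>2)"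
proof -
  have fm: "finite_measure (lebesgue_on {r..s})" by (rule finite_measure_lebesgue_on) simp
  have ci: "integrable (lebesgue_on {r..s}) (\<lambda>t. c\<^sup>2 / (2 * \<delta>))"
    using finite_measure.integrable_const[OF fm] by blast
  have "\<bar>LINT t|lebesgue_on {r..s}. q t\<bar> \<le> (LINT t|lebesgue_on {r..s}. \<bar>q t\<bar>)" by (rule integral_abs_bound)
  also have "\<dots> \<le> (LINT t|lebesgue_on {r..s}. c\<^sup>2 / (2 * \<delta>) + \<delta> / 2 * (N t)\<^sup>2)"
  proof (rule integral_mono_AE)
    show "AE t in lebesgue_on {r..s}. \<bar>q t\<bar> \<le> c\<^sup>2 / (2 * \<delta>) + \<delta> / 2 * (N t)\<^sup>2"
      using le
    proof eventually_elim
      case (elim t) then show ?case using young_ineq[OF d, of c "N t"] by linarith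
    qed
  qed (use q N ci in auto)
  also have "\<dots> = (LINT t|lebesgue_on {r..s}. c\<^sup>2 / (2 * \<delta>)) + \<delta> / 2 * (LINT t|lebesgue_on {r..s}. (N t)\<^sup>2)"
    using Bochner_Integration.integral_add[OF ci integrable_mult_right[OF N, of "\<delta> / 2"]]
    by (simp only: integral_mult_right_zero)
  finally have "\<bar>LINT t|lebesgue_on {r..s}. q t\<bar> \<le>
      (LINT t|lebesgue_on {r..s}. c\<^sup>2 / (2 * \<delta>)) + \<delta> / 2 * (LINT t|lebesgue_on {r..s}. (N t)\<^sup>2)" .
  moreover have "measure (lebesgue_on {r..s}) {r..s} = s - r"
    using rs by (simp add: measure_restrict_space)
  then have "(LINT t|lebesgue_on {r..s}. c\<^sup>2 / (2 * \<delta>)) = (s - r) * (c\<^sup>2 / (2 * \<delta>))"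
    by (simp only: lebesgue_integral_const space_lebesgue_on real_scaleR_def)
  ultimately show ?thesis by (simp only:)
qed

text \<open>The difference quotients of a primitive of \<open>q\<close> converge weakly to \<open>q\<close>; they are equi-integrable
  because \<open>q\<^sup>2\<close> is integrable, so that the sets on which they converge form a Dynkin system.\<close>

lemma difference_quotient_set_tendsto:
  fixes g q :: "real \<Rightarrow> real"
  assumes ab: "a0 < a" "a < b" and g: "continuous_on {a0..b} g"
    and q: "integrable (lebesgue_on {a0..b}) q" and q2: "integrable (lebesgue_on {a0..b}) (\<lambda>t. (q t)\<^sup>2)"
    and prim: "\<And>c d. a0 \<le> c \<Longrightarrow> c \<le> d \<Longrightarrow> d \<le> b \<Longrightarrow> g d - g c = (LINT t|lebesgue_on {c..d}. q t)"
    and E: "E \<in> sets borel"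
  shows "((\<lambda>h. LINT s|lebesgue_on {a..b}. indicator E s * ((g s - g (s - h)) / h)) \<longlongrightarrow>
      (LINT s|lebesgue_on {a..b}. indicator E s * q s)) (at_right 0)"
proof -
  let ?J = "lebesgue_on {a..b}"
  define F where "F h A = (LINT s|?J. indicator A s * ((g s - g (s - h)) / h))" for h A
  define F0 where "F0 A = (LINT s|?J. indicator A s * q s)" for A
  have subi: "integrable (lebesgue_on {c..d}) q" "integrable (lebesgue_on {c..d}) (\<lambda>t. (q t)\<^sup>2)"
    if "a0 \<le> c" "d \<le> b" for c d
    by (rule integrable_lebesgue_on_subset[OF q], use that in auto)
      (rule integrable_lebesgue_on_subset[OF q2], use that in auto)
  obtain \<Psi> where \<Psi>c: "continuous_on {a0..b} \<Psi>"
    and \<Psi>d: "\<And>c d. a0 \<le> c \<Longrightarrow> c \<le> d \<Longrightarrow> d \<le> b \<Longrightarrow> (LINT t|lebesgue_on {c..d}. (q t)\<^sup>2) = \<Psi> d - \<Psi> c"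
    using indefinite_LINT[OF q2] by blast
  \<comment> \<open>The integrated window means of q^2 tend to \<Psi> b - \<Psi> a; adding 1 makes K
    positive and an eventual strict upper bound.\<close>
  define K where "K = \<Psi> b - \<Psi> a + 1"
  have K1: "1 \<le> K"
  proof -
    have "0 \<le> (LINT t|lebesgue_on {a..b}. (q t)\<^sup>2)" by simp
    then show ?thesis using \<Psi>d[of a b] ab by (simp add: K_def)
  qed
  have indm: "(indicator A :: real \<Rightarrow> real) \<in> borel_measurable ?J" if "A \<in> sets borel" for A
    using that by (intro measurable_restrict_space1 borel_measurable_indicator) simp
  have fm: "finite_measure ?J" by (rule finite_measure_lebesgue_on) simp
  have indi: "integrable ?J (indicator A :: real \<Rightarrow> real)" if "A \<in> sets borel" for A
    by (rule finite_measure.integrable_const_bound[OF fm, where B=1]) (auto intro: indm that AE_I2)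
  have \<Delta>i: "integrable ?J (\<lambda>s. (g s - g (s - h)) / h)" if "0 < h" "h < a - a0" for h
    by (intro continuous_imp_integrable_real continuous_on_difference_quotient[OF g]) (use that in auto)
  have ii: "integrable ?J (\<lambda>s. indicator A s * f s)" if "A \<in> sets borel" "integrable ?J f" for A and f :: "real \<Rightarrow> real"
    using that by (intro integrable_lebesgue_on_indicator_mult) auto
  have small_h: "\<forall>\<^sub>F h in at_right 0. 0 < h \<and> h < a - a0"
    using eventually_at_right_real[of 0 "a - a0"] ab by (auto elim: eventually_mono)
  have Klim: "\<forall>\<^sub>F h in at_right 0. (LINT s|?J. (\<Psi> s - \<Psi> (s - h)) / h) < K"
    using difference_quotient_integral_tendsto[OF \<Psi>c ab(1)] ab
    by (intro order_tendstoD(2)[where y="\<Psi> b - \<Psi> a"]) (auto simp: K_def)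
  define \<mu> :: "real set \<Rightarrow> real" where "\<mu> A = (LINT s|?J. indicator A s)" for A
  \<comment> \<open>The set A enters only through its length. With a bound on the integral of Q,
    taking first \<delta> and then the length of A small makes the left side small, uniformly in
    r.\<close>
  have bound: "\<bar>LINT s|?J. indicator A s * r s\<bar> \<le> \<mu> A / (2 * \<delta>) + \<delta> / 2 * (LINT s|?J. Q s)"
    if A: "A \<in> sets borel" and d: "0 < \<delta>" and r: "integrable ?J r" and Q: "integrable ?J Q"
      and nn: "\<And>s. s \<in> {a..b} \<Longrightarrow> 0 \<le> Q s" and le: "\<And>s. s \<in> {a..b} \<Longrightarrow> \<bar>r s\<bar> \<le> 1 / (2 * \<delta>) + \<delta> / 2 * Q s"
    for A \<delta> and r Q :: "real \<Rightarrow> real"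
  proof -
    have "\<bar>LINT s|?J. indicator A s * r s\<bar> \<le> (LINT s|?J. \<bar>indicator A s * r s\<bar>)" by (rule integral_abs_bound)
    also have "\<dots> \<le> (LINT s|?J. indicator A s * (1 / (2 * \<delta>)) + \<delta> / 2 * Q s)"
    proof (rule integral_mono)
      fix s assume "s \<in> space ?J"
      then have s: "s \<in> {a..b}" by simp
      have "0 \<le> \<delta> / 2 * Q s" using nn[OF s] d by (intro mult_nonneg_nonneg) auto
      then show "\<bar>indicator A s * r s\<bar> \<le> indicator A s * (1 / (2 * \<delta>)) + \<delta> / 2 * Q s"
        using le[OF s] by (auto simp: indicator_def)
    next
      show "integrable ?J (\<lambda>s. \<bar>indicator A s * r s\<bar>)" by (intro integrable_abs ii A r)
      show "integrable ?J (\<lambda>s. indicator A s * (1 / (2 * \<delta>)) + \<delta> / 2 * Q s)"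
        by (intro Bochner_Integration.integrable_add integrable_mult_left integrable_mult_right indi A Q)
    qed
    also have "\<dots> = (LINT s|?J. indicator A s * (1 / (2 * \<delta>))) + (LINT s|?J. \<delta> / 2 * Q s)"
      by (intro Bochner_Integration.integral_add integrable_mult_left integrable_mult_right indi A Q)
    also have "\<dots> = \<mu> A / (2 * \<delta>) + \<delta> / 2 * (LINT s|?J. Q s)"
      unfolding \<mu>_def by (simp only: integral_mult_left_zero integral_mult_right_zero) simp
    finally show ?thesis .
  qed
  have F0b: "\<bar>F0 A\<bar> \<le> \<mu> A / (2 * \<delta>) + \<delta> / 2 * K" if A: "A \<in> sets borel" and d: "0 < \<delta>" for A \<delta>
  proof -
    have "\<bar>F0 A\<bar> \<le> \<mu> A / (2 * \<delta>) + \<delta> / 2 * (LINT s|?J. (q s)\<^sup>2)"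
      unfolding F0_def
    proof (rule bound[OF A d])
      show "\<bar>q s\<bar> \<le> 1 / (2 * \<delta>) + \<delta> / 2 * (q s)\<^sup>2" for s using young_ineq[OF d, of 1 "\<bar>q s\<bar>"] by simp
    qed (use ab in \<open>auto intro: subi\<close>)
    also have "\<dots> \<le> \<mu> A / (2 * \<delta>) + \<delta> / 2 * K"
      using d \<Psi>d[of a b] ab unfolding K_def by (intro add_left_mono mult_left_mono) auto
    finally show ?thesis .
  qed
  have Fb: "\<bar>F h A\<bar> \<le> \<mu> A / (2 * \<delta>) + \<delta> / 2 * K"
    if A: "A \<in> sets borel" and d: "0 < \<delta>" and h: "0 < h" "h < a - a0"
      and hK: "(LINT s|?J. (\<Psi> s - \<Psi> (s - h)) / h) < K" for A \<delta> h
  proof -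
    have "\<bar>F h A\<bar> \<le> \<mu> A / (2 * \<delta>) + \<delta> / 2 * (LINT s|?J. (\<Psi> s - \<Psi> (s - h)) / h)"
      unfolding F_def
    proof (rule bound[OF A d \<Delta>i[OF h]])
      show "integrable ?J (\<lambda>s. (\<Psi> s - \<Psi> (s - h)) / h)"
        by (intro continuous_imp_integrable_real continuous_on_difference_quotient[OF \<Psi>c]) (use h in auto)
      fix s assume s: "s \<in> {a..b}"
      have r: "a0 \<le> s - h" "s - h \<le> s" "s \<le> b" using s h by auto
      have e: "(LINT t|lebesgue_on {s - h..s}. (q t)\<^sup>2) = \<Psi> s - \<Psi> (s - h)" by (rule \<Psi>d[OF r])
      have "0 \<le> (LINT t|lebesgue_on {s - h..s}. (q t)\<^sup>2)" by simp
      then show "0 \<le> (\<Psi> s - \<Psi> (s - h)) / h" using e h by simp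
      \<comment> \<open>\<open>increment_bound\<close> with c = 1; division by the window length h
        then gives the pointwise hypothesis of \<open>bound\<close>.\<close>
      have "\<bar>LINT t|lebesgue_on {s - h..s}. q t\<bar> \<le> (s - (s - h)) * (1\<^sup>2 / (2 * \<delta>)) + \<delta> / 2 * (LINT t|lebesgue_on {s - h..s}. (\<bar>q t\<bar>)\<^sup>2)"
        using r subi[OF r(1,3)] by (intro increment_bound d) auto
      then have "\<bar>g s - g (s - h)\<bar> \<le> h * (1 / (2 * \<delta>)) + \<delta> / 2 * (\<Psi> s - \<Psi> (s - h))"
        using prim[OF r] e by simp
      then have "\<bar>g s - g (s - h)\<bar> / h \<le> (h * (1 / (2 * \<delta>)) + \<delta> / 2 * (\<Psi> s - \<Psi> (s - h))) / h"
        using h by (intro divide_right_mono) auto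
      also have "\<dots> = 1 / (2 * \<delta>) + \<delta> / 2 * ((\<Psi> s - \<Psi> (s - h)) / h)"
        using h by (simp add: add_divide_distrib)
      finally show "\<bar>(g s - g (s - h)) / h\<bar> \<le> 1 / (2 * \<delta>) + \<delta> / 2 * ((\<Psi> s - \<Psi> (s - h)) / h)"
        using h by (simp add: abs_divide)
    qed
    also have "\<dots> \<le> \<mu> A / (2 * \<delta>) + \<delta> / 2 * K"
      using d hK by (intro add_left_mono mult_left_mono) auto
    finally show ?thesis .
  qed
  have "((\<lambda>h. F h E) \<longlongrightarrow> F0 E) (at_right 0)"
  proof -
    let ?G = "range (\<lambda>(c, d). {c..d}) :: real set set"
    have sb: "sets borel = sigma_sets UNIV ?G" by (simp add: borel_eq_atLeastAtMost)
    have "Int_stable ?G" by (auto simp: Int_stable_def)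
    moreover have "?G \<subseteq> Pow UNIV" by simp
    moreover have "E \<in> sigma_sets UNIV ?G" using E sb by simp
    ultimately show ?thesis
    proof (induction rule: sigma_sets_induct_disjoint)
      case (basic A)
      then obtain c d where A: "A = {c..d}" by auto
      let ?c = "max a c" and ?d = "min b d"
      have i: "{a..b} \<inter> A = {?c..?d}" unfolding A by auto
      have e: "(LINT s|?J. indicator A s * f s) = (LINT s|lebesgue_on {?c..?d}. f s)" for f :: "real \<Rightarrow> real"
        using LINT_lebesgue_on_indicator[of A "{a..b}" f] i A by simp
      show ?case
      proof (cases "?c \<le> ?d")
        case True
        have "((\<lambda>h. LINT s|lebesgue_on {?c..?d}. (g s - g (s - h)) / h) \<longlongrightarrow> g ?d - g ?c) (at_right 0)"
          by (rule difference_quotient_integral_tendsto[where ?a0.0=a0])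
            (use True ab in \<open>auto intro: continuous_on_subset[OF g]\<close>)
        moreover have "g ?d - g ?c = (LINT t|lebesgue_on {?c..?d}. q t)"
          using True ab by (intro prim) auto
        ultimately show ?thesis unfolding F_def F0_def e by simp
      next
        case False
        then show ?thesis unfolding F_def F0_def e by simp
      qed
    next
      case empty
      then show ?case by (simp add: F_def F0_def)
    next
      case (compl A)
      have A: "A \<in> sets borel" using compl sb by simp
      have e: "(LINT s|?J. indicator (UNIV - A) s * f s) = (LINT s|?J. f s) - (LINT s|?J. indicator A s * f s)"
        if f: "integrable ?J f" for f :: "real \<Rightarrow> real"
      proof -
        have "(LINT s|?J. indicator (UNIV - A) s * f s) = (LINT s|?J. f s - indicator A s * f s)"
          by (rule Bochner_Integration.integral_cong) (auto simp: indicator_def)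
        then show ?thesis using Bochner_Integration.integral_diff[OF f ii[OF A f]] by simp
      qed
      have "((\<lambda>h. (LINT s|?J. (g s - g (s - h)) / h) - F h A) \<longlongrightarrow> (g b - g a) - F0 A) (at_right 0)"
        using ab by (intro tendsto_diff compl difference_quotient_integral_tendsto[OF g]) auto
      moreover have "\<forall>\<^sub>F h in at_right 0. (LINT s|?J. (g s - g (s - h)) / h) - F h A = F h (UNIV - A)"
        using small_h
      proof eventually_elim
        case (elim h)
        have "F h (UNIV - A) = (LINT s|?J. (g s - g (s - h)) / h) - F h A"
          unfolding F_def by (rule e[OF \<Delta>i]) (use elim in auto)
        then show ?case by simp
      qed
      moreover have "(g b - g a) - F0 A = F0 (UNIV - A)"
        using prim[of a b] subi(1)[of a b] ab by (simp add: F0_def e)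
      ultimately show ?case using Lim_transform_eventually by fastforce
    next
      case (union A)
      have A: "A i \<in> sets borel" for i using union sb by (metis range_subsetD)
      \<comment> \<open>Convergence on each \<open>A i\<close> gives convergence on finite unions
        only. The tail \<open>R n\<close> has small length, and \<open>Fb\<close> and
        \<open>F0b\<close> bound its contribution uniformly in h.\<close>
      define B where "B = (\<Union>i. A i)"
      define R where "R n = B - (\<Union>i<n. A i)" for n
      have Rm: "R n \<in> sets borel" for n using A by (auto simp: B_def R_def)
      have dec: "indicator B s = (\<Sum>i<n. indicator (A i) s) + (indicator (R n) s :: real)" for n s
      proof -
        have "(\<Sum>i<n. indicator (A i) s) = (indicator (\<Union>i<n. A i) s :: real)"
        proof (rule indicator_UN_disjoint[symmetric])
          show "disjoint_family_on A {..<n}"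
            using union(1) by (auto simp: disjoint_family_on_def)
        qed simp
        moreover have "indicator B s = indicator (\<Union>i<n. A i) s + (indicator (R n) s :: real)"
          by (auto simp: R_def B_def indicator_def)
        ultimately show ?thesis by simp
      qed
      have e: "(LINT s|?J. indicator B s * f s) = (\<Sum>i<n. LINT s|?J. indicator (A i) s * f s) + (LINT s|?J. indicator (R n) s * f s)"
        if f: "integrable ?J f" for f :: "real \<Rightarrow> real" and n
      proof -
        have "(LINT s|?J. indicator B s * f s) = (LINT s|?J. (\<Sum>i<n. indicator (A i) s * f s) + indicator (R n) s * f s)"
          by (rule Bochner_Integration.integral_cong) (auto simp: dec[of _ n] distrib_right sum_distrib_right)
        also have "\<dots> = (LINT s|?J. (\<Sum>i<n. indicator (A i) s * f s)) + (LINT s|?J. indicator (R n) s * f s)"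
          by (intro Bochner_Integration.integral_add Bochner_Integration.integrable_sum ii A Rm f)
        also have "(LINT s|?J. (\<Sum>i<n. indicator (A i) s * f s)) = (\<Sum>i<n. LINT s|?J. indicator (A i) s * f s)"
          by (intro Bochner_Integration.integral_sum ii A f)
        finally show ?thesis .
      qed
      have \<mu>lim: "(\<lambda>n. \<mu> (R n)) \<longlonglongrightarrow> 0"
      proof -
        have "(\<lambda>n. LINT s|?J. (indicator (R n) s :: real)) \<longlonglongrightarrow> (LINT s|?J. 0)"
        proof (rule integral_dominated_convergence[where w="\<lambda>s. 1"])
          show "AE s in ?J. (\<lambda>n. indicator (R n) s :: real) \<longlonglongrightarrow> 0"
          proof (rule AE_I2)
            fix s
            have "\<forall>\<^sub>F n in sequentially. (indicator (R n) s :: real) = 0"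
            proof (cases "s \<in> B")
              case True
              then obtain i where "s \<in> A i" by (auto simp: B_def)
              then have "s \<notin> R n" if "n \<ge> Suc i" for n using that by (auto simp: R_def)
              then show ?thesis unfolding eventually_sequentially
                by (intro exI[of _ "Suc i"]) auto
            qed (simp add: R_def)
            then show "(\<lambda>n. indicator (R n) s :: real) \<longlonglongrightarrow> 0" by (rule tendsto_eventually)
          qed
          show "integrable ?J (\<lambda>s. 1::real)" using finite_measure.integrable_const[OF fm] by blast
          show "(indicator (R n) :: real \<Rightarrow> real) \<in> borel_measurable ?J" for n by (rule indm[OF Rm])
        qed (auto simp: indicator_def)
        then show ?thesis by (simp add: \<mu>_def)
      qed
      have "((\<lambda>h. F h B) \<longlongrightarrow> F0 B) (at_right 0)"
      proof (rule tendstoI)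
        fix \<epsilon> :: real assume \<epsilon>: "0 < \<epsilon>"
        \<comment> \<open>This makes the second term of the tail bound \<epsilon>/8; n is then so
          large that the first is below \<epsilon>/8 too. Both tails and the finite sum thus
          contribute less than \<epsilon>/4 each.\<close>
        define \<delta> where "\<delta> = \<epsilon> / (4 * K)"
        have \<delta>: "0 < \<delta>" "\<delta> / 2 * K = \<epsilon> / 8" using \<epsilon> K1 by (auto simp: \<delta>_def)
        have "\<forall>\<^sub>F n in sequentially. \<mu> (R n) < \<delta> * \<epsilon> / 4"
          using \<mu>lim by (rule order_tendstoD(2)) (use \<delta> \<epsilon> in simp)
        then obtain n where n: "\<mu> (R n) < \<delta> * \<epsilon> / 4" by (auto simp: eventually_sequentially)
        have rb: "\<mu> (R n) / (2 * \<delta>) + \<delta> / 2 * K < \<epsilon> / 4"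
        proof -
          have "\<mu> (R n) / (2 * \<delta>) < (\<delta> * \<epsilon> / 4) / (2 * \<delta>)" using n \<delta> by (intro divide_strict_right_mono) auto
          also have "\<dots> = \<epsilon> / 8" using \<delta> by simp
          finally show ?thesis using \<delta>(2) by simp
        qed
        have "((\<lambda>h. \<Sum>i<n. F h (A i)) \<longlongrightarrow> (\<Sum>i<n. F0 (A i))) (at_right 0)"
          by (intro tendsto_sum union)
        then have "\<forall>\<^sub>F h in at_right 0. dist (\<Sum>i<n. F h (A i)) (\<Sum>i<n. F0 (A i)) < \<epsilon> / 4"
          using \<epsilon> by (intro tendstoD) auto
        then show "\<forall>\<^sub>F h in at_right 0. dist (F h B) (F0 B) < \<epsilon>"
          using small_h Klim
        proof eventually_elim
          case (elim h)
          have "F h B = (\<Sum>i<n. F h (A i)) + F h (R n)"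
            unfolding F_def using elim by (intro e \<Delta>i) auto
          moreover have "F0 B = (\<Sum>i<n. F0 (A i)) + F0 (R n)"
            unfolding F0_def using ab by (intro e subi) auto
          moreover have "\<bar>F h (R n)\<bar> < \<epsilon> / 4" using Fb[OF Rm \<delta>(1), of h n] elim rb by linarith
          moreover have "\<bar>F0 (R n)\<bar> < \<epsilon> / 4" using F0b[OF Rm \<delta>(1), of n] rb by linarith
          ultimately show ?case using elim(1) \<epsilon> unfolding dist_real_def by linarith
        qed
      qed
      then show ?case by (simp add: B_def)
    qed
  qed
  then show ?thesis by (simp add: F_def F0_def)
qed

text \<open>Level sets of simple paths are merely Lebesgue measurable; each differs from a Borel set
  by a null set, which the integrals do not see.\<close>

lemma difference_quotient_lebesgue_set_tendsto:
  fixes g q :: "real \<Rightarrow> real"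
  assumes ab: "a0 < a" "a < b" and g: "continuous_on {a0..b} g"
    and q: "integrable (lebesgue_on {a0..b}) q" and q2: "integrable (lebesgue_on {a0..b}) (\<lambda>t. (q t)\<^sup>2)"
    and prim: "\<And>c d. a0 \<le> c \<Longrightarrow> c \<le> d \<Longrightarrow> d \<le> b \<Longrightarrow> g d - g c = (LINT t|lebesgue_on {c..d}. q t)"
    and E: "E \<in> sets lebesgue"
  shows "((\<lambda>h. LINT s|lebesgue_on {a..b}. indicator E s * ((g s - g (s - h)) / h)) \<longlongrightarrow>
      (LINT s|lebesgue_on {a..b}. indicator E s * q s)) (at_right 0)"
proof -
  let ?J = "lebesgue_on {a..b}"
  obtain S N N' where S: "E = S \<union> N" "N \<subseteq> N'" "N' \<in> null_sets lborel" "S \<in> sets lborel"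
    using E by (rule sets_completionE)
  have Sl: "S \<in> sets lebesgue" "N' \<in> null_sets lebesgue" using S by (auto simp: null_sets_completionI)
  have "AE s in lebesgue. s \<notin> N'" by (rule AE_not_in[OF Sl(2)])
  then have "AE s in ?J. s \<notin> N'" by (subst AE_restrict_space_iff) (auto elim: eventually_mono)
  then have ae: "AE s in ?J. indicator E s = (indicator S s :: real)"
    by eventually_elim (use S(1,2) in \<open>auto simp: indicator_def\<close>)
  have m: "(indicator A :: real \<Rightarrow> real) \<in> borel_measurable ?J" if "A \<in> sets lebesgue" for A
    using that by (intro measurable_restrict_space1 borel_measurable_indicator)
  have eq: "(LINT s|?J. indicator E s * f s) = (LINT s|?J. indicator S s * f s)" if "f \<in> borel_measurable ?J" for f :: "real \<Rightarrow> real"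
    using ae m[OF E] m[OF Sl(1)] that by (intro integral_cong_AE) auto
  have "((\<lambda>h. LINT s|?J. indicator S s * ((g s - g (s - h)) / h)) \<longlongrightarrow> (LINT s|?J. indicator S s * q s)) (at_right 0)"
    using S(4) by (intro difference_quotient_set_tendsto[OF ab g q q2 prim]) auto
  moreover have "(LINT s|?J. indicator S s * q s) = (LINT s|?J. indicator E s * q s)"
    using ab by (intro eq[symmetric] borel_measurable_integrable integrable_lebesgue_on_subset[OF q]) auto
  moreover have "\<forall>\<^sub>F h in at_right 0. h \<in> {0<..<a - a0}"
    using ab by (intro eventually_at_right_real) auto
  then have "\<forall>\<^sub>F h in at_right 0. (LINT s|?J. indicator S s * ((g s - g (s - h)) / h)) = (LINT s|?J. indicator E s * ((g s - g (s - h)) / h))"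
  proof eventually_elim
    case (elim h)
    then show ?case
      by (intro eq[symmetric] borel_measurable_integrable continuous_imp_integrable_real continuous_on_difference_quotient[OF g]) auto
  qed
  ultimately show ?thesis using Lim_transform_eventually by fastforce
qed

section \<open>The energy inequality\<close>

lemma (in seminormed_functions) Bochner_L2D:
  assumes "u \<in> Bochner_L2 X nrm T"
  shows "strongly_measurable X nrm T u" "AE t in I\<^sub>T T. u t \<in> X"
    "integrable (I\<^sub>T T) (\<lambda>t. (nrm (u t))\<^sup>2)" "(\<lambda>t. nrm (u t)) \<in> borel_measurable (I\<^sub>T T)"
  using assms by (auto simp: Bochner_L2_def strongly_measurable_def Lp2_iff)

lemma integrable_if_square_integrable:
  fixes f :: "'b \<Rightarrow> real"
  assumes "finite_measure M" "f \<in> borel_measurable M" "integrable M (\<lambda>x. (f x)\<^sup>2)"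
  shows "integrable M f"
proof (rule Bochner_Integration.integrable_bound)
  show "integrable M (\<lambda>x. 1 + (f x)\<^sup>2)"
    using assms finite_measure.integrable_const[OF assms(1)] by (intro Bochner_Integration.integrable_add) auto
  have "\<bar>f x\<bar> \<le> 1 + (f x)\<^sup>2" for x
  proof -
    have "0 \<le> (\<bar>f x\<bar> - 1)\<^sup>2" by simp
    then have "2 * \<bar>f x\<bar> \<le> 1 + (f x)\<^sup>2" by (simp add: power2_diff)
    then show ?thesis by linarith
  qed
  then show "AE x in M. norm (f x) \<le> norm (1 + (f x)\<^sup>2)" by (auto simp: abs_of_nonneg)
qed fact

lemma measurable_dual_apply:
  assumes D: "open D" and w: "strongly_measurable (H1_dual D) (H1_dual_norm D) T w" and \<phi>: "\<phi> \<in> H1 D"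
  shows "(\<lambda>t. w t \<phi>) \<in> borel_measurable (I\<^sub>T T)"
proof -
  interpret d: seminormed_functions "H1_dual D" "H1_dual_norm D" by (rule seminormed_H1_dual[OF D])
  have "\<bar>l \<phi> - m \<phi>\<bar> \<le> H1_norm D \<phi> * H1_dual_norm D (\<lambda>x. l x - m x)" if "l \<in> H1_dual D" "m \<in> H1_dual D" for l m
    using H1_dual_bound[OF d.diff[OF that] \<phi> D] by (simp add: mult.commute)
  then show ?thesis
    using d.strongly_measurable_apply[OF w, of "\<lambda>l t. l \<phi>"] by (auto intro!: AE_I2)
qed

text \<open>The pairing is Lipschitz in its argument with the dual norm of \<open>w t\<close> as
  constant; that this constant varies with t is allowed by
  \<open>strongly_measurable_apply\<close>.\<close>

lemma measurable_dual_pairing: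
  assumes D: "open D" and w: "strongly_measurable (H1_dual D) (H1_dual_norm D) T w"
    and u: "strongly_measurable (H1 D) (H1_norm D) T u"
  shows "(\<lambda>t. w t (u t)) \<in> borel_measurable (I\<^sub>T T)"
proof -
  interpret h: seminormed_functions "H1 D" "H1_norm D" by (rule seminormed_H1[OF D])
  have "AE t in I\<^sub>T T. w t \<in> H1_dual D" using w by (simp add: strongly_measurable_def)
  then have "AE t in I\<^sub>T T. \<exists>B. \<forall>x\<in>H1 D. \<forall>y\<in>H1 D. \<bar>w t x - w t y\<bar> \<le> B * H1_norm D (\<lambda>z. x z - y z)"
  proof eventually_elim
    case (elim t)
    have "\<bar>w t x - w t y\<bar> \<le> H1_dual_norm D (w t) * H1_norm D (\<lambda>z. x z - y z)" if "x \<in> H1 D" "y \<in> H1 D" for x y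
      using H1_dual_bound[OF elim h.diff[OF that] D] H1_dual_diff_arg[OF D elim that] by simp
    then show ?case by blast
  qed
  with h.strongly_measurable_apply[OF u, of "\<lambda>y t. w t y"] measurable_dual_apply[OF D w]
  show ?thesis by simp
qed

section \<open>Paths with a time derivative in the dual space\<close>

locale evolution_path =
  fixes D :: "'a::euclidean_space set" and T :: real
    and u :: "real \<Rightarrow> 'a \<Rightarrow> real" and w :: "real \<Rightarrow> ('a \<Rightarrow> real) \<Rightarrow> real" and v :: "real \<Rightarrow> 'a \<Rightarrow> real"
  assumes D: "open D" and T: "0 < T"
    and u: "u \<in> Bochner_L2 (H1 D) (H1_norm D) T"
    and w: "w \<in> Bochner_L2 (H1_dual D) (H1_dual_norm D) T"
    and v_L2: "\<And>t. t \<in> {0..T} \<Longrightarrow> v t \<in> L2 D"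
    and v_cont: "\<And>t. t \<in> {0..T} \<Longrightarrow> ((\<lambda>s. L2_norm D (\<lambda>x. v s x - v t x)) \<longlongrightarrow> 0) (at t within {0..T})"
    and v_eq: "AE t in I\<^sub>T T. AE x in lebesgue_on D. v t x = u t x"
begin

sublocale h: seminormed_functions "H1 D" "H1_norm D" by (rule seminormed_H1[OF D])
sublocale d: seminormed_functions "H1_dual D" "H1_dual_norm D" by (rule seminormed_H1_dual[OF D])

definition energy :: "real \<Rightarrow> real" where
  "energy t = (L2_norm D (v t))\<^sup>2"

lemma u_mem: "AE t in I\<^sub>T T. u t \<in> H1 D" and w_mem: "AE t in I\<^sub>T T. w t \<in> H1_dual D"
  using h.Bochner_L2D(2)[OF u] d.Bochner_L2D(2)[OF w] by auto

lemma continuous_if_L2_lipschitz: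
  fixes F :: "real \<Rightarrow> real"
  assumes "\<And>s t. s \<in> {0..T} \<Longrightarrow> t \<in> {0..T} \<Longrightarrow> \<bar>F s - F t\<bar> \<le> L2_norm D (\<lambda>x. v s x - v t x) * B"
  shows "continuous_on {0..T} F"
  unfolding continuous_on_def
proof
  fix t assume t: "t \<in> {0..T}"
  have lim: "((\<lambda>s. L2_norm D (\<lambda>x. v s x - v t x) * B) \<longlongrightarrow> 0) (at t within {0..T})"
    using v_cont[OF t] by (rule tendsto_mult_left_zero)
  have "((\<lambda>s. F s - F t) \<longlongrightarrow> 0) (at t within {0..T})"
    by (rule Lim_null_comparison[OF _ lim])
      (use assms[OF _ t] in \<open>auto simp: eventually_at_filter intro!: always_eventually\<close>)
  then show "(F \<longlongrightarrow> F t) (at t within {0..T})" by (simp add: LIM_zero_iff)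
qed

lemma continuous_L2_inner:
  assumes \<phi>: "\<phi> \<in> L2 D"
  shows "continuous_on {0..T} (\<lambda>t. LINT x|lebesgue_on D. v t x * \<phi> x)"
proof (rule continuous_if_L2_lipschitz)
  fix s t assume s: "s \<in> {0..T}" and t: "t \<in> {0..T}"
  have "(LINT x|lebesgue_on D. v s x * \<phi> x) - (LINT x|lebesgue_on D. v t x * \<phi> x) = (LINT x|lebesgue_on D. (v s x - v t x) * \<phi> x)"
    using Lp2_integrable_mult[OF v_L2[OF s] \<phi>] Lp2_integrable_mult[OF v_L2[OF t] \<phi>]
    by (simp add: left_diff_distrib)
  then show "\<bar>(LINT x|lebesgue_on D. v s x * \<phi> x) - (LINT x|lebesgue_on D. v t x * \<phi> x)\<bar>
      \<le> L2_norm D (\<lambda>x. v s x - v t x) * L2_norm D \<phi>"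
    using Cauchy_Schwarz_Lp2_real[OF Lp2_diff[OF v_L2[OF s] v_L2[OF t]] \<phi>] by simp
qed

lemma continuous_energy: "continuous_on {0..T} energy"
proof -
  have le: "L2_norm D (v s) \<le> L2_norm D (v t) + L2_norm D (\<lambda>x. v s x - v t x)"
    if "s \<in> {0..T}" "t \<in> {0..T}" for s t
    using Lp2_norm_triangle[OF v_L2[OF that(2)] Lp2_diff[OF v_L2[OF that(1)] v_L2[OF that(2)]]] by simp
  have "continuous_on {0..T} (\<lambda>t. L2_norm D (v t))"
  proof (rule continuous_if_L2_lipschitz)
    show "\<bar>L2_norm D (v s) - L2_norm D (v t)\<bar> \<le> L2_norm D (\<lambda>x. v s x - v t x) * 1"
      if "s \<in> {0..T}" "t \<in> {0..T}" for s t
      using le[OF that] le[OF that(2,1)] Lp2_norm_minus_commute[of "lebesgue_on D" "v s" "v t"] by simp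
  qed
  then show ?thesis unfolding energy_def by (intro continuous_on_power)
qed

lemma finite_measure_time: "finite_measure (I\<^sub>T T)"
  by (rule finite_measure_lebesgue_on) simp

lemma dual_apply_square_integrable:
  assumes \<phi>: "\<phi> \<in> H1 D"
  shows "integrable (I\<^sub>T T) (\<lambda>t. (w t \<phi>)\<^sup>2)" "integrable (I\<^sub>T T) (\<lambda>t. w t \<phi>)"
proof -
  have m: "(\<lambda>t. w t \<phi>) \<in> borel_measurable (I\<^sub>T T)"
    by (rule measurable_dual_apply[OF D d.Bochner_L2D(1)[OF w] \<phi>])
  show i: "integrable (I\<^sub>T T) (\<lambda>t. (w t \<phi>)\<^sup>2)"
  proof (rule Bochner_Integration.integrable_bound)
    show "integrable (I\<^sub>T T) (\<lambda>t. (H1_dual_norm D (w t))\<^sup>2 * (H1_norm D \<phi>)\<^sup>2)"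
      using d.Bochner_L2D(3)[OF w] by (rule integrable_mult_left)
    show "(\<lambda>t. (w t \<phi>)\<^sup>2) \<in> borel_measurable (I\<^sub>T T)" using m by (rule borel_measurable_power)
    show "AE t in I\<^sub>T T. norm ((w t \<phi>)\<^sup>2) \<le> norm ((H1_dual_norm D (w t))\<^sup>2 * (H1_norm D \<phi>)\<^sup>2)"
      using w_mem
    proof eventually_elim
      case (elim t)
      have "\<bar>w t \<phi>\<bar>\<^sup>2 \<le> (H1_dual_norm D (w t) * H1_norm D \<phi>)\<^sup>2"
        using H1_dual_bound[OF elim \<phi> D] by (intro power_mono) auto
      then show ?case by (simp add: power_mult_distrib)
    qed
  qed
  show "integrable (I\<^sub>T T) (\<lambda>t. w t \<phi>)" by (rule integrable_if_square_integrable[OF finite_measure_time m i])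
qed

text \<open>\<open>has_time_derivative\<close> tests u, whereas increments between given times
  require the representative v. For almost every t both have the same inner product with \<phi>, so
  the identity transfers to a continuous function of t and
  \<open>primitive_from_test_functions\<close> applies.\<close>

lemma L2_inner_primitive_if_derivative:
  assumes deriv: "has_time_derivative D T u w" and \<phi>: "\<phi> \<in> H1 D" and cd: "0 < c" "c \<le> d" "d < T"
  shows "(LINT x|lebesgue_on D. v d x * \<phi> x) - (LINT x|lebesgue_on D. v c x * \<phi> x) = (LINT t|lebesgue_on {c..d}. w t \<phi>)"
proof (cases "c = d")
  case True
  have "(LINT t|lebesgue_on {c..d}. w t \<phi>) = integral {c..d} (\<lambda>t. w t \<phi>)"
    by (intro lebesgue_integral_eq_integral integrable_lebesgue_on_subset[OF dual_apply_square_integrable(2)[OF \<phi>]])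
      (use cd in auto)
  then show ?thesis using True by simp
next
  case False
  let ?g = "\<lambda>t. LINT x|lebesgue_on D. v t x * \<phi> x"
  note \<phi>2 = W1p_2_D(1)[OF D \<phi>]
  have "?g d - ?g c = (LINT t|I\<^sub>T T. w t \<phi> * indicator {c<..<d} t)"
  proof (rule primitive_from_test_functions)
    show "continuous_on {0..T} ?g" by (rule continuous_L2_inner[OF \<phi>2])
    show "integrable (I\<^sub>T T) (\<lambda>t. w t \<phi>)" by (rule dual_apply_square_integrable[OF \<phi>])
    fix \<eta> assume \<eta>: "\<eta> \<in> test_functions {0<..<T}"
    have dm: "(\<lambda>t. deriv \<eta> t) \<in> borel_measurable (I\<^sub>T T)"
    proof (rule continuous_imp_measurable_on_sets_lebesgue)
      \<comment> \<open>\<open>Ck\<close> speaks of Frechet derivatives; in direction 1 this is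
        \<open>deriv\<close>, which is thereby continuous.\<close>
      have "deriv \<eta> t = frechet_derivative \<eta> (at t) 1" for t
      proof -
        have "Ck (Suc 0) \<eta>" using \<eta> by (auto simp: test_functions_def simp del: Ck.simps)
        from Ck_SucD(1)[OF this] have "\<eta> differentiable (at t)" unfolding differentiable_def by blast
        then have "(\<eta> has_real_derivative deriv \<eta> t) (at t)"
          using DERIV_deriv_iff_real_differentiable by blast
        then show ?thesis using frechet_derivative_real by metis
      qed
      then show "continuous_on {0<..<T} (\<lambda>t. deriv \<eta> t)"
        using test_function_continuous(2)[OF \<eta>, of 1] continuous_on_subset by fastforce
    qed simp
    have gm: "?g \<in> borel_measurable (I\<^sub>T T)"
    proof (rule continuous_imp_measurable_on_sets_lebesgue)
      show "continuous_on {0<..<T} ?g"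
        by (rule continuous_on_subset[OF continuous_L2_inner[OF \<phi>2]]) auto
    qed simp
    have ae: "AE t in I\<^sub>T T. ?g t = (LINT x|lebesgue_on D. u t x * \<phi> x)"
    proof -
      have "AE t in I\<^sub>T T. t \<in> {0<..<T}" by (rule AE_I2) simp
      then show ?thesis using v_eq u_mem
      proof eventually_elim
        case (elim t)
        show ?case
        proof (rule integral_cong_AE)
          show "(\<lambda>x. v t x * \<phi> x) \<in> borel_measurable (lebesgue_on D)" "(\<lambda>x. u t x * \<phi> x) \<in> borel_measurable (lebesgue_on D)"
            using v_L2[of t] W1p_2_D(1)[OF D elim(3)] \<phi>2 elim(1) by (auto intro!: borel_measurable_times dest: Lp2_measurable)
          show "AE x in lebesgue_on D. v t x * \<phi> x = u t x * \<phi> x" using elim(2) by eventually_elim simp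
        qed
      qed
    qed
    have "(\<lambda>t. LINT x|lebesgue_on D. u t x * \<phi> x) \<in> borel_measurable (I\<^sub>T T)"
      by (rule complete_measure.borel_measurable_AE_cong[OF complete_measure_interval gm ae])
    then have "(LINT t|I\<^sub>T T. ?g t * deriv \<eta> t) = (LINT t|I\<^sub>T T. (LINT x|lebesgue_on D. u t x * \<phi> x) * deriv \<eta> t)"
      using ae gm dm by (intro integral_cong_AE) (auto elim: eventually_mono)
    then show "(LINT t|I\<^sub>T T. ?g t * deriv \<eta> t) = - (LINT t|I\<^sub>T T. w t \<phi> * \<eta> t)"
      using deriv \<eta> \<phi> by (simp add: has_time_derivative_def)
  qed (use cd False in auto)
  also have "\<dots> = (LINT t|lebesgue_on {c..d}. w t \<phi>)"
    by (rule LINT_lebesgue_on_open_interval[OF dual_apply_square_integrable(2)[OF \<phi>] cd])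
  finally show ?thesis .
qed

end

text \<open>The relation of v and w is recorded in integrated form: it holds at all interior times
  without exceptional null sets, and it passes to the difference of two paths by
  subtraction.\<close>

locale energy_path = evolution_path +
  assumes L2_inner_primitive: "\<And>\<phi> c d. \<phi> \<in> H1 D \<Longrightarrow> 0 < c \<Longrightarrow> c \<le> d \<Longrightarrow> d < T \<Longrightarrow>
    (LINT x|lebesgue_on D. v d x * \<phi> x) - (LINT x|lebesgue_on D. v c x * \<phi> x) = (LINT t|lebesgue_on {c..d}. w t \<phi>)"
begin

text \<open>On each level set of \<sigma> the test function y is fixed, so the scalar result applies
  to the inner product of \<open>v s\<close> with y, whose derivative is \<open>w s y\<close>;
  finitely many values are summed.\<close>

lemma difference_quotient_simple_tendsto:
  assumes \<sigma>: "simple_into (H1 D) T \<sigma>" and ab: "0 < a" "a < b" "b < T"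
  shows "((\<lambda>h. LINT s|lebesgue_on {a..b}. (LINT x|lebesgue_on D. (v s x - v (s - h) x) * \<sigma> s x) / h) \<longlongrightarrow>
    (LINT s|lebesgue_on {a..b}. w s (\<sigma> s))) (at_right 0)"
    and "0 < h \<Longrightarrow> h < a / 2 \<Longrightarrow> integrable (lebesgue_on {a..b}) (\<lambda>s. (LINT x|lebesgue_on D. (v s x - v (s - h) x) * \<sigma> s x) / h)"
proof -
  let ?J = "lebesgue_on {a..b}"
  let ?R = "\<sigma> ` {0<..<T}"
  let ?E = "\<lambda>y. {t \<in> {0<..<T}. \<sigma> t = y}"
  let ?g = "\<lambda>y s. LINT x|lebesgue_on D. v s x * y x"
  have R: "?R \<subseteq> H1 D" and E: "?E y \<in> sets lebesgue" for y
    using \<sigma> by (auto simp: simple_into_def)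
  \<comment> \<open>Starting at a / 2 leaves room for backward steps of length below a / 2.\<close>
  have a0: "0 < a / 2" "a / 2 < a" using ab by auto
  have sub: "{a / 2..b} \<subseteq> {0<..<T}" "{a..b} \<subseteq> {0<..<T}" using ab by auto
  have gc: "continuous_on {a / 2..b} (?g y)" if "y \<in> H1 D" for y
    by (rule continuous_on_subset[OF continuous_L2_inner[OF W1p_2_D(1)[OF D that]]]) (use ab in auto)
  note sum_eq = sum_over_level_sets[OF \<sigma>]
  have ii: "integrable ?J (\<lambda>s. indicator (?E y) s * f s)" if "integrable ?J f" for y and f :: "real \<Rightarrow> real"
    by (rule integrable_lebesgue_on_indicator_mult[OF E that])
  have dq: "(LINT x|lebesgue_on D. (v s x - v (s - h) x) * y x) = ?g y s - ?g y (s - h)"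
    if "s \<in> {0..T}" "s - h \<in> {0..T}" "y \<in> H1 D" for s h y
    using Lp2_integrable_mult[OF v_L2[OF that(1)] W1p_2_D(1)[OF D that(3)]] Lp2_integrable_mult[OF v_L2[OF that(2)] W1p_2_D(1)[OF D that(3)]]
    by (simp add: left_diff_distrib)
  have qi: "integrable ?J (\<lambda>s. (?g y s - ?g y (s - h)) / h)" if "y \<in> H1 D" "0 < h" "h < a / 2" for y h
    by (intro continuous_imp_integrable_real continuous_on_difference_quotient[OF gc[OF that(1)]]) (use that in auto)
  have eq: "(\<Sum>y\<in>?R. indicator (?E y) s * ((?g y s - ?g y (s - h)) / h)) = (LINT x|lebesgue_on D. (v s x - v (s - h) x) * \<sigma> s x) / h"
    if "s \<in> {a..b}" "0 < h" "h < a / 2" for s h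
  proof -
    have s: "s \<in> {0<..<T}" using that sub by auto
    then have "\<sigma> s \<in> H1 D" using R by auto
    then show ?thesis using sum_eq[OF s, of "\<lambda>y s. (?g y s - ?g y (s - h)) / h"] dq[of s h "\<sigma> s"] that s ab by simp
  qed
  have "integrable ?J (\<lambda>s. \<Sum>y\<in>?R. indicator (?E y) s * ((?g y s - ?g y (s - h)) / h))" if "0 < h" "h < a / 2" for h
    using R that by (intro Bochner_Integration.integrable_sum ii qi) auto
  then show "integrable ?J (\<lambda>s. (LINT x|lebesgue_on D. (v s x - v (s - h) x) * \<sigma> s x) / h)" if "0 < h" "h < a / 2"
    using that eq by (subst Bochner_Integration.integrable_cong[OF refl, where g="\<lambda>s. \<Sum>y\<in>?R. indicator (?E y) s * ((?g y s - ?g y (s - h)) / h)"]) auto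
  have "((\<lambda>h. \<Sum>y\<in>?R. LINT s|?J. indicator (?E y) s * ((?g y s - ?g y (s - h)) / h)) \<longlongrightarrow>
     (\<Sum>y\<in>?R. LINT s|?J. indicator (?E y) s * w s y)) (at_right 0)"
  proof (rule tendsto_sum)
    fix y assume "y \<in> ?R"
    then have y: "y \<in> H1 D" using R by auto
    show "((\<lambda>h. LINT s|?J. indicator (?E y) s * ((?g y s - ?g y (s - h)) / h)) \<longlongrightarrow> (LINT s|?J. indicator (?E y) s * w s y)) (at_right 0)"
    proof (rule difference_quotient_lebesgue_set_tendsto[OF a0(2) ab(2) gc[OF y]])
      show "integrable (lebesgue_on {a / 2..b}) (\<lambda>s. w s y)" "integrable (lebesgue_on {a / 2..b}) (\<lambda>s. (w s y)\<^sup>2)"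
        by (rule integrable_lebesgue_on_subset[OF dual_apply_square_integrable(2)[OF y] sub(1)]; simp)
          (rule integrable_lebesgue_on_subset[OF dual_apply_square_integrable(1)[OF y] sub(1)]; simp)
      show "?g y d - ?g y c = (LINT t|lebesgue_on {c..d}. w t y)" if "a / 2 \<le> c" "c \<le> d" "d \<le> b" for c d
        by (rule L2_inner_primitive[OF y]) (use that ab in auto)
    qed (rule E)
  qed
  moreover have "(\<Sum>y\<in>?R. LINT s|?J. indicator (?E y) s * w s y) = (LINT s|?J. w s (\<sigma> s))"
  proof -
    have wi: "integrable ?J (\<lambda>s. w s y)" if "y \<in> ?R" for y
      by (rule integrable_lebesgue_on_subset[OF dual_apply_square_integrable(2) sub(2)]) (use that R in auto)
    have "(\<Sum>y\<in>?R. LINT s|?J. indicator (?E y) s * w s y) = (LINT s|?J. (\<Sum>y\<in>?R. indicator (?E y) s * w s y))"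
      by (intro Bochner_Integration.integral_sum[symmetric] ii wi)
    also have "\<dots> = (LINT s|?J. w s (\<sigma> s))"
      using sub sum_eq[where G="\<lambda>y s. w s y"] by (intro Bochner_Integration.integral_cong) auto
    finally show ?thesis .
  qed
  moreover have "\<forall>\<^sub>F h in at_right 0. h \<in> {0<..<a / 2}"
    using ab by (intro eventually_at_right_real) auto
  then have "\<forall>\<^sub>F h in at_right 0. (\<Sum>y\<in>?R. LINT s|?J. indicator (?E y) s * ((?g y s - ?g y (s - h)) / h)) =
      (LINT s|?J. (LINT x|lebesgue_on D. (v s x - v (s - h) x) * \<sigma> s x) / h)"
  proof eventually_elim
    case (elim h)
    then have "(\<Sum>y\<in>?R. LINT s|?J. indicator (?E y) s * ((?g y s - ?g y (s - h)) / h)) =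
        (LINT s|?J. (\<Sum>y\<in>?R. indicator (?E y) s * ((?g y s - ?g y (s - h)) / h)))"
      using R by (intro Bochner_Integration.integral_sum[symmetric] ii qi) auto
    also have "\<dots> = (LINT s|?J. (LINT x|lebesgue_on D. (v s x - v (s - h) x) * \<sigma> s x) / h)"
      using elim eq by (intro Bochner_Integration.integral_cong) auto
    finally show ?case .
  qed
  ultimately show "((\<lambda>h. LINT s|?J. (LINT x|lebesgue_on D. (v s x - v (s - h) x) * \<sigma> s x) / h) \<longlongrightarrow> (LINT s|?J. w s (\<sigma> s))) (at_right 0)"
    using Lim_transform_eventually by fastforce
qed

lemma pairing_integrable: "integrable (I\<^sub>T T) (\<lambda>t. w t (u t))"
proof (rule Bochner_Integration.integrable_bound)
  show "integrable (I\<^sub>T T) (\<lambda>t. (H1_dual_norm D (w t))\<^sup>2 + (H1_norm D (u t))\<^sup>2)"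
    by (intro Bochner_Integration.integrable_add h.Bochner_L2D(3)[OF u] d.Bochner_L2D(3)[OF w])
  show "(\<lambda>t. w t (u t)) \<in> borel_measurable (I\<^sub>T T)"
    by (rule measurable_dual_pairing[OF D d.Bochner_L2D(1)[OF w] h.Bochner_L2D(1)[OF u]])
  show "AE t in I\<^sub>T T. norm (w t (u t)) \<le> norm ((H1_dual_norm D (w t))\<^sup>2 + (H1_norm D (u t))\<^sup>2)"
    using u_mem w_mem
  proof eventually_elim
    case (elim t)
    have "2 * (H1_dual_norm D (w t) * H1_norm D (u t)) \<le> (H1_dual_norm D (w t))\<^sup>2 + (H1_norm D (u t))\<^sup>2"
      using sum_squares_bound[of "H1_dual_norm D (w t)" "H1_norm D (u t)"] by simp
    moreover have "0 \<le> H1_dual_norm D (w t) * H1_norm D (u t)"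
      using H1_dual_norm_nonneg[OF D elim(2)] H1_norm_nonneg by (rule mult_nonneg_nonneg)
    ultimately have "H1_dual_norm D (w t) * H1_norm D (u t) \<le> (H1_dual_norm D (w t))\<^sup>2 + (H1_norm D (u t))\<^sup>2"
      by linarith
    then show ?case using H1_dual_bound[OF elim(2,1) D] by simp
  qed
qed

lemma energy_diff_le:
  assumes s: "s \<in> {0..T}" and r: "r \<in> {0..T}"
  shows "energy s - energy r \<le> 2 * (LINT x|lebesgue_on D. (v s x - v r x) * v s x)"
proof -
  note S = v_L2[OF s] and R = v_L2[OF r]
  have "energy s - energy r = (LINT x|lebesgue_on D. (v s x)\<^sup>2 - (v r x)\<^sup>2)"
    using S R by (simp add: energy_def Lp2_norm_power2 Lp2_iff)
  also have "\<dots> \<le> (LINT x|lebesgue_on D. 2 * ((v s x - v r x) * v s x))"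
  proof (rule integral_mono)
    show "integrable (lebesgue_on D) (\<lambda>x. (v s x)\<^sup>2 - (v r x)\<^sup>2)" using S R by (simp add: Lp2_iff)
    show "integrable (lebesgue_on D) (\<lambda>x. 2 * ((v s x - v r x) * v s x))"
      by (intro integrable_mult_right Lp2_integrable_mult Lp2_diff S R)
    fix x
    \<comment> \<open>The two integrands differ by exactly this square.\<close>
    have "0 \<le> (v s x - v r x)\<^sup>2" by simp
    then show "(v s x)\<^sup>2 - (v r x)\<^sup>2 \<le> 2 * ((v s x - v r x) * v s x)"
      by (simp add: power2_eq_square algebra_simps)
  qed
  finally show ?thesis by simp
qed

text \<open>One half of the Lions--Magenes lemma; the inequality suffices for energy estimates and needs
  only the one-sided bound \<open>energy_diff_le\<close>.\<close>

lemma energy_increment_le: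
  assumes ab: "0 < a" "a < b" "b < T"
  shows "energy b - energy a \<le> 2 * (LINT s|lebesgue_on {a..b}. w s (u s))"
proof -
  let ?J = "lebesgue_on {a..b}"
  define N2 where "N2 t = (H1_dual_norm D (w t))\<^sup>2" for t
  have sub: "{a / 2..b} \<subseteq> {0<..<T}" "{a..b} \<subseteq> {0<..<T}" using ab by auto
  have N2T: "integrable (I\<^sub>T T) N2" unfolding N2_def by (rule d.Bochner_L2D(3)[OF w])
  have N2i: "integrable (lebesgue_on {c..d}) N2" if "a / 2 \<le> c" "d \<le> b" for c d
    by (rule integrable_lebesgue_on_subset[OF N2T]) (use that ab in auto)
  obtain \<Psi> where \<Psi>c: "continuous_on {a / 2..b} \<Psi>"
    and \<Psi>d: "\<And>c d. a / 2 \<le> c \<Longrightarrow> c \<le> d \<Longrightarrow> d \<le> b \<Longrightarrow> (LINT t|lebesgue_on {c..d}. N2 t) = \<Psi> d - \<Psi> c"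
    using indefinite_LINT[OF N2i[of "a / 2" b]] by auto
  define K where "K = \<Psi> b - \<Psi> a"
  have K0: "0 \<le> K"
  proof -
    have "0 \<le> (LINT t|lebesgue_on {a..b}. N2 t)" by (simp add: N2_def)
    then show ?thesis using \<Psi>d[of a b] ab by (simp add: K_def)
  qed
  \<comment> \<open>The error consists of two halves e (1 + K): one from testing the increments with
    u - \<sigma>, one from replacing \<sigma> by u in the limiting pairing.\<close>
  have main: "energy b - energy a \<le> 2 * (LINT s|?J. w s (u s)) + e * (2 * (1 + K))" if e: "0 < e" for e
  proof -
    \<comment> \<open>The accuracy is e^2 because Young's inequality with weight e divides the
      squared error by e.\<close>
    have "0 < e\<^sup>2" using e by simp
    then obtain \<sigma> where \<sigma>: "simple_into (H1 D) T \<sigma>" "integrable (I\<^sub>T T) (\<lambda>t. (H1_norm D (\<lambda>x. u t x - \<sigma> t x))\<^sup>2)"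
      "(LINT t|I\<^sub>T T. (H1_norm D (\<lambda>x. u t x - \<sigma> t x))\<^sup>2) < e\<^sup>2"
      by (rule h.Bochner_L2_simple_approx[OF u])
    define R where "R t = (H1_norm D (\<lambda>x. u t x - \<sigma> t x))\<^sup>2" for t
    have Ri: "integrable ?J R" unfolding R_def
      by (rule integrable_lebesgue_on_subset[OF \<sigma>(2) sub(2)]) auto
    have Rb: "(LINT t|?J. R t) \<le> e\<^sup>2"
    proof -
      have "(LINT t|?J. R t) = (LINT t|lebesgue. indicator {a..b} t * R t)"
        by (simp add: integral_restrict_space)
      also have "\<dots> \<le> (LINT t|lebesgue. indicator {0<..<T} t * R t)"
      proof (rule integral_mono)
        show "integrable lebesgue (\<lambda>t. indicator {a..b} t * R t)"
          using Ri by (simp add: integrable_restrict_space)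
        show "integrable lebesgue (\<lambda>t. indicator {0<..<T} t * R t)"
          using \<sigma>(2) by (simp add: integrable_restrict_space R_def)
        show "indicator {a..b} t * R t \<le> indicator {0<..<T} t * R t" for t
          using ab by (auto simp: indicator_def R_def)
      qed
      also have "\<dots> = (LINT t|I\<^sub>T T. R t)" by (simp add: integral_restrict_space)
      finally show ?thesis using \<sigma>(3) by (simp add: R_def)
    qed
    have mem: "AE s in ?J. s \<in> {a..b} \<and> u s \<in> H1 D \<and> w s \<in> H1_dual D \<and> \<sigma> s \<in> H1 D \<and> (AE x in lebesgue_on D. v s x = u s x)"
    proof -
      have "AE t in I\<^sub>T T. u t \<in> H1 D \<and> w t \<in> H1_dual D \<and> \<sigma> t \<in> H1 D \<and> (AE x in lebesgue_on D. v t x = u t x)"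
        using u_mem w_mem h.AE_simple_into_mem[OF \<sigma>(1)] v_eq by eventually_elim simp
      then have "AE s in ?J. u s \<in> H1 D \<and> w s \<in> H1_dual D \<and> \<sigma> s \<in> H1 D \<and> (AE x in lebesgue_on D. v s x = u s x)"
        by (rule AE_lebesgue_on_subset) (use sub in auto)
      moreover have "AE s in ?J. s \<in> {a..b}" by (rule AE_I2) simp
      ultimately show ?thesis by eventually_elim simp
    qed
    have wT: "AE t in lebesgue_on {c..d}. w t \<in> H1_dual D" if "0 < c" "d < T" for c d
      by (rule AE_lebesgue_on_subset[OF w_mem]) (use that in auto)
    let ?B = "\<lambda>h s. (LINT x|lebesgue_on D. (v s x - v (s - h) x) * \<sigma> s x) / h"
    \<comment> \<open>At almost every s, \<open>v s\<close> is the sum of \<open>\<sigma> s\<close>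
      and \<phi> = u s - \<sigma> s. The part with \<sigma> is kept, as its limit is known. Against
      \<phi>, frozen at time s, the increment of v is an integral of w over [s - h, s], to which
      \<open>increment_bound\<close> applies with weight e.\<close>
    have pt: "AE s in ?J. (energy s - energy (s - h)) / h \<le> 2 * ?B h s + (R s / e + e * ((\<Psi> s - \<Psi> (s - h)) / h))"
      if h: "0 < h" "h < a / 2" for h
      using mem
    proof eventually_elim
      case (elim s)
      have s: "s \<in> {0..T}" "s - h \<in> {0..T}" "0 < s - h" "s - h \<le> s" "s < T" using elim h ab by auto
      define \<phi> where "\<phi> = (\<lambda>x. u s x - \<sigma> s x)"
      have \<phi>: "\<phi> \<in> H1 D" unfolding \<phi>_def using elim by (intro h.diff) auto
      let ?\<Delta> = "\<lambda>x. v s x - v (s - h) x"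
      have \<Delta>: "?\<Delta> \<in> L2 D" by (intro Lp2_diff v_L2 s)
      have m: "u s \<in> L2 D" "\<sigma> s \<in> L2 D" "\<phi> \<in> L2 D"
        using elim \<phi> W1p_2_D(1)[OF D] by auto
      have "(LINT x|lebesgue_on D. ?\<Delta> x * v s x) = (LINT x|lebesgue_on D. ?\<Delta> x * u s x)"
      proof (rule integral_cong_AE)
        show "(\<lambda>x. ?\<Delta> x * v s x) \<in> borel_measurable (lebesgue_on D)" "(\<lambda>x. ?\<Delta> x * u s x) \<in> borel_measurable (lebesgue_on D)"
          by (rule borel_measurable_times; rule Lp2_measurable[OF \<Delta>] Lp2_measurable[OF v_L2[OF s(1)]] Lp2_measurable[OF m(1)])+
        have "AE x in lebesgue_on D. v s x = u s x" using elim by simp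
        then show "AE x in lebesgue_on D. ?\<Delta> x * v s x = ?\<Delta> x * u s x" by eventually_elim simp
      qed
      also have "\<dots> = (LINT x|lebesgue_on D. ?\<Delta> x * \<sigma> s x + ?\<Delta> x * \<phi> x)"
        by (simp add: \<phi>_def algebra_simps)
      also have "\<dots> = (LINT x|lebesgue_on D. ?\<Delta> x * \<sigma> s x) + (LINT x|lebesgue_on D. ?\<Delta> x * \<phi> x)"
        by (intro Bochner_Integration.integral_add Lp2_integrable_mult \<Delta> m)
      finally have split: "(LINT x|lebesgue_on D. ?\<Delta> x * v s x) = (LINT x|lebesgue_on D. ?\<Delta> x * \<sigma> s x) + (LINT x|lebesgue_on D. ?\<Delta> x * \<phi> x)" .
      have "(LINT x|lebesgue_on D. ?\<Delta> x * \<phi> x) = (LINT x|lebesgue_on D. v s x * \<phi> x - v (s - h) x * \<phi> x)"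
        by (simp add: left_diff_distrib)
      also have "\<dots> = (LINT x|lebesgue_on D. v s x * \<phi> x) - (LINT x|lebesgue_on D. v (s - h) x * \<phi> x)"
        by (intro Bochner_Integration.integral_diff Lp2_integrable_mult v_L2 s m)
      also have "\<dots> = (LINT t|lebesgue_on {s - h..s}. w t \<phi>)"
        by (rule L2_inner_primitive[OF \<phi> s(3,4,5)])
      finally have "(LINT x|lebesgue_on D. ?\<Delta> x * \<phi> x) \<le> \<bar>LINT t|lebesgue_on {s - h..s}. w t \<phi>\<bar>" by simp
      also have "\<dots> \<le> (s - (s - h)) * ((H1_norm D \<phi>)\<^sup>2 / (2 * e)) + e / 2 * (LINT t|lebesgue_on {s - h..s}. (H1_dual_norm D (w t))\<^sup>2)"
      proof (rule increment_bound[OF _ _ _ e s(4)])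
        show "integrable (lebesgue_on {s - h..s}) (\<lambda>t. w t \<phi>)"
          by (rule integrable_lebesgue_on_subset[OF dual_apply_square_integrable(2)[OF \<phi>]]) (use s in auto)
        show "integrable (lebesgue_on {s - h..s}) (\<lambda>t. (H1_dual_norm D (w t))\<^sup>2)"
          using N2i[of "s - h" s] elim h by (simp add: N2_def[abs_def])
        show "AE t in lebesgue_on {s - h..s}. \<bar>w t \<phi>\<bar> \<le> H1_norm D \<phi> * H1_dual_norm D (w t)"
          using wT[OF s(3,5)]
        proof eventually_elim
          case (elim t)
          then show ?case using H1_dual_bound[OF elim \<phi> D] by (simp add: mult.commute)
        qed
      qed
      also have "\<dots> = h * (R s / (2 * e)) + e / 2 * (\<Psi> s - \<Psi> (s - h))"
        using \<Psi>d[of "s - h" s] elim h by (simp add: R_def \<phi>_def N2_def)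
      finally have le: "(LINT x|lebesgue_on D. ?\<Delta> x * \<phi> x) \<le> h * (R s / (2 * e)) + e / 2 * (\<Psi> s - \<Psi> (s - h))" .
      have "energy s - energy (s - h) \<le> 2 * (LINT x|lebesgue_on D. ?\<Delta> x * v s x)"
        by (rule energy_diff_le[OF s(1,2)])
      also have "\<dots> \<le> 2 * (LINT x|lebesgue_on D. ?\<Delta> x * \<sigma> s x) + 2 * (h * (R s / (2 * e)) + e / 2 * (\<Psi> s - \<Psi> (s - h)))"
      proof -
        have "2 * (p + q) \<le> 2 * p + 2 * r" if "q \<le> r" for p q r :: real using that by simp
        then show ?thesis unfolding split using le by blast
      qed
      finally have "(energy s - energy (s - h)) / h \<le> (2 * (LINT x|lebesgue_on D. ?\<Delta> x * \<sigma> s x) + 2 * (h * (R s / (2 * e)) + e / 2 * (\<Psi> s - \<Psi> (s - h)))) / h"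
        using h(1) by (intro divide_right_mono) auto
      also have "\<dots> = 2 * ?B h s + (R s / e + e * ((\<Psi> s - \<Psi> (s - h)) / h))"
        using h(1) e by (simp add: field_simps)
      finally show ?case .
    qed
    let ?A = "\<lambda>h. LINT s|?J. (energy s - energy (s - h)) / h"
    let ?C = "\<lambda>h. LINT s|?J. (\<Psi> s - \<Psi> (s - h)) / h"
    have Ec: "continuous_on {a / 2..b} energy"
      by (rule continuous_on_subset[OF continuous_energy]) (use ab in auto)
    have le: "?A h \<le> 2 * (LINT s|?J. ?B h s) + ((LINT s|?J. R s) / e + e * ?C h)" if h: "0 < h" "h < a / 2" for h
    proof -
      have Bi: "integrable ?J (?B h)" by (rule difference_quotient_simple_tendsto(2)[OF \<sigma>(1) ab h])
      have Ci: "integrable ?J (\<lambda>s. (\<Psi> s - \<Psi> (s - h)) / h)"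
        by (intro continuous_imp_integrable_real continuous_on_difference_quotient[OF \<Psi>c]) (use h in auto)
      have "?A h \<le> (LINT s|?J. 2 * ?B h s + (R s / e + e * ((\<Psi> s - \<Psi> (s - h)) / h)))"
      proof (rule integral_mono_AE[OF _ _ pt[OF h]])
        show "integrable ?J (\<lambda>s. (energy s - energy (s - h)) / h)"
          by (intro continuous_imp_integrable_real continuous_on_difference_quotient[OF Ec]) (use h in auto)
        show "integrable ?J (\<lambda>s. 2 * ?B h s + (R s / e + e * ((\<Psi> s - \<Psi> (s - h)) / h)))"
          by (intro Bochner_Integration.integrable_add integrable_mult_right Bi Ci integrable_divide Ri)
      qed
      also have "\<dots> = (LINT s|?J. 2 * ?B h s) + (LINT s|?J. R s / e + e * ((\<Psi> s - \<Psi> (s - h)) / h))"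
        by (intro Bochner_Integration.integral_add Bochner_Integration.integrable_add integrable_mult_right Bi Ci integrable_divide Ri)
      also have "(LINT s|?J. R s / e + e * ((\<Psi> s - \<Psi> (s - h)) / h)) = (LINT s|?J. R s / e) + (LINT s|?J. e * ((\<Psi> s - \<Psi> (s - h)) / h))"
        by (intro Bochner_Integration.integral_add integrable_mult_right Ci integrable_divide Ri)
      finally show ?thesis by (simp only: integral_mult_right_zero integral_divide_zero)
    qed
    have lim: "((\<lambda>h. 2 * (LINT s|?J. ?B h s) + ((LINT s|?J. R s) / e + e * ?C h)) \<longlongrightarrow>
        2 * (LINT s|?J. w s (\<sigma> s)) + ((LINT s|?J. R s) / e + e * K)) (at_right 0)"
      unfolding K_def using ab
      by (intro tendsto_add tendsto_mult tendsto_const difference_quotient_simple_tendsto(1)[OF \<sigma>(1) ab]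
        difference_quotient_integral_tendsto[OF \<Psi>c]) auto
    have limA: "(?A \<longlongrightarrow> energy b - energy a) (at_right 0)"
      using ab by (intro difference_quotient_integral_tendsto[OF Ec]) auto
    have "\<forall>\<^sub>F h in at_right 0. h \<in> {0<..<a / 2}"
      using ab by (intro eventually_at_right_real) auto
    then have "\<forall>\<^sub>F h in at_right 0. ?A h \<le> 2 * (LINT s|?J. ?B h s) + ((LINT s|?J. R s) / e + e * ?C h)"
      by eventually_elim (rule le, auto)
    from tendsto_le[OF _ lim limA this]
    have 1: "energy b - energy a \<le> 2 * (LINT s|?J. w s (\<sigma> s)) + ((LINT s|?J. R s) / e + e * K)" by simp
    have 2: "(LINT s|?J. R s) / e \<le> e"
      using Rb e by (simp add: divide_le_eq power2_eq_square)
    have 3: "(LINT s|?J. w s (\<sigma> s)) \<le> (LINT s|?J. w s (u s)) + (e / 2 + e / 2 * K)"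
    proof -
      have wui: "integrable ?J (\<lambda>s. w s (u s))"
        by (rule integrable_lebesgue_on_subset[OF pairing_integrable sub(2)]) auto
      have ri: "integrable ?J (\<lambda>s. R s / (2 * e) + e / 2 * N2 s)"
        using ab by (intro Bochner_Integration.integrable_add integrable_mult_right integrable_divide Ri N2i) auto
      have wdiff: "AE s in ?J. \<bar>w s (\<sigma> s) - w s (u s)\<bar> \<le> R s / (2 * e) + e / 2 * N2 s"
        using mem
      proof eventually_elim
        case (elim s)
        then have m: "u s \<in> H1 D" "\<sigma> s \<in> H1 D" "w s \<in> H1_dual D" by auto
        have "\<bar>w s (\<sigma> s) - w s (u s)\<bar> = \<bar>w s (\<lambda>x. u s x - \<sigma> s x)\<bar>"
          using H1_dual_diff_arg[OF D m(3,1,2)] by simp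
        also have "\<dots> \<le> H1_norm D (\<lambda>x. u s x - \<sigma> s x) * H1_dual_norm D (w s)"
          using H1_dual_bound[OF m(3) h.diff[OF m(1,2)] D] by (simp add: mult.commute)
        also have "\<dots> \<le> R s / (2 * e) + e / 2 * N2 s"
          unfolding R_def N2_def by (rule young_ineq[OF e])
        finally show ?case .
      qed
      have "(\<lambda>s. w s (\<sigma> s)) \<in> borel_measurable ?J"
      proof -
        have "(\<lambda>s. w s (\<sigma> s)) \<in> borel_measurable (I\<^sub>T T)"
          using simple_into_measurable[OF \<sigma>(1), of "\<lambda>y t. w t y"] measurable_dual_apply[OF D d.Bochner_L2D(1)[OF w]] by simp
        then show ?thesis by (rule measurable_restrict_mono) (use sub in auto)
      qed
      then have dm: "(\<lambda>s. w s (\<sigma> s) - w s (u s)) \<in> borel_measurable ?J"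
        using wui by (intro borel_measurable_diff) (auto dest: borel_measurable_integrable)
      have di: "integrable ?J (\<lambda>s. w s (\<sigma> s) - w s (u s))"
        by (rule Bochner_Integration.integrable_bound[OF ri dm])
          (use wdiff in \<open>eventually_elim, simp\<close>)
      have "(LINT s|?J. w s (\<sigma> s)) = (LINT s|?J. w s (u s) + (w s (\<sigma> s) - w s (u s)))" by simp
      also have "\<dots> = (LINT s|?J. w s (u s)) + (LINT s|?J. w s (\<sigma> s) - w s (u s))"
        by (rule Bochner_Integration.integral_add[OF wui di])
      also have "(LINT s|?J. w s (\<sigma> s) - w s (u s)) \<le> (LINT s|?J. R s / (2 * e) + e / 2 * N2 s)"
        by (rule integral_mono_AE[OF di ri]) (use wdiff in \<open>auto elim: eventually_mono\<close>)
      also have "\<dots> = (LINT s|?J. R s / (2 * e)) + (LINT s|?J. e / 2 * N2 s)"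
        using ab by (intro Bochner_Integration.integral_add integrable_mult_right integrable_divide Ri N2i) auto
      also have "\<dots> = (LINT s|?J. R s) / (2 * e) + e / 2 * K"
        using \<Psi>d[of a b] ab unfolding K_def
        by (simp only: integral_mult_right_zero integral_divide_zero)
      also have "(LINT s|?J. R s) / (2 * e) \<le> e / 2" using 2 by simp
      finally show ?thesis by simp
    qed
    show ?thesis using 1 2 3 by (simp add: algebra_simps)
  qed
  have "energy b - energy a \<le> 2 * (LINT s|?J. w s (u s)) + e" if "0 < e" for e
    using main[of "e / (2 * (1 + K))"] that K0 by simp
  then show ?thesis by (rule field_le_epsilon)
qed

end

section \<open>Energy estimates\<close>

text \<open>With \<Phi> the primitive of z, the function (A + K \<Phi>) exp(-K x) has derivative K
  exp(-K x) (z - A - K \<Phi>), which the hypothesis makes nonpositive; at 0 its value is A.\<close>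

lemma gronwall_integral:
  fixes z :: "real \<Rightarrow> real"
  assumes z: "continuous_on {0..T} z" and K: "0 \<le> K"
    and le: "\<And>t. t \<in> {0..T} \<Longrightarrow> z t \<le> A + K * integral {0..t} z" and t: "t \<in> {0..T}"
  shows "z t \<le> A * exp (K * t)"
proof -
  define \<Phi> where "\<Phi> x = integral {0..x} z" for x
  define P where "P x = (A + K * \<Phi> x) * exp (- K * x)" for x
  have d\<Phi>: "(\<Phi> has_real_derivative z x) (at x within {0..T})" if "x \<in> {0..T}" for x
    unfolding \<Phi>_def by (rule integral_has_real_derivative[OF z that])
  have \<Phi>c: "continuous_on {0..T} \<Phi>" by (rule DERIV_continuous_on[OF d\<Phi>])
  have "P t \<le> P 0"
  proof -
    have "0 \<le> t" using t by simp
    then show ?thesis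
    proof (rule DERIV_nonpos_imp_decreasing_open)
      fix x assume x: "0 < x" "x < t"
      then have xT: "x \<in> {0<..<T}" using t by auto
      then have "(\<Phi> has_real_derivative z x) (at x)"
        using d\<Phi>[of x] at_within_interior[of x "{0..T}"] by simp
      then have "(P has_real_derivative (K * z x) * exp (- K * x) + (exp (- K * x) * (- K)) * (A + K * \<Phi> x)) (at x)"
        unfolding P_def[abs_def] by (auto intro!: derivative_eq_intros)
      moreover have "(K * z x) * exp (- K * x) + (exp (- K * x) * (- K)) * (A + K * \<Phi> x) = K * exp (- K * x) * (z x - (A + K * \<Phi> x))"
        by (simp add: algebra_simps)
      moreover have "\<dots> \<le> 0"
        using le[of x] xT K by (intro mult_nonneg_nonpos) (auto simp: \<Phi>_def)
      ultimately show "\<exists>y. (P has_real_derivative y) (at x) \<and> y \<le> 0" by metis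
    next
      show "continuous_on {0..t} P"
        unfolding P_def using t by (intro continuous_intros continuous_on_subset[OF \<Phi>c]) auto
    qed
  qed
  then have "(A + K * \<Phi> t) * exp (- K * t) \<le> A" by (simp add: P_def \<Phi>_def)
  then have "(A + K * \<Phi> t) * exp (- K * t) * exp (K * t) \<le> A * exp (K * t)" by (rule mult_right_mono) simp
  then have "A + K * \<Phi> t \<le> A * exp (K * t)" by (simp add: mult.assoc exp_add[symmetric])
  then show ?thesis using le[OF t] by (simp add: \<Phi>_def)
qed

text \<open>The energy inequality compares interior times only; continuity carries the comparison to
  the initial time and to the end of the interval.\<close>

lemma continuous_antimono_interior_le:
  fixes k :: "real \<Rightarrow> real"
  assumes k: "continuous_on {0..T} k" and T: "0 < T"
    and anti: "\<And>a b. 0 < a \<Longrightarrow> a < b \<Longrightarrow> b < T \<Longrightarrow> k b \<le> k a" and t: "t \<in> {0..T}"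
  shows "k t \<le> k 0"
proof -
  have inner: "k x \<le> k 0" if x: "x \<in> {0<..<T}" for x
  proof (rule continuous_ge_on_closure[where f=k and S="{0<..<x}"])
    have cl: "closure {0<..<x} = {0..x}" using x by (simp add: closure_greaterThanLessThan)
    show "continuous_on (closure {0<..<x}) k" unfolding cl by (rule continuous_on_subset[OF k]) (use x in auto)
    show "0 \<in> closure {0<..<x}" unfolding cl using x by simp
    show "k x \<le> k a" if "a \<in> {0<..<x}" for a using anti[of a x] that x by auto
  qed
  show ?thesis
  proof (rule continuous_le_on_closure[where f=k and S="{0<..<T}"])
    have cl: "closure {0<..<T} = {0..T}" using T by (simp add: closure_greaterThanLessThan)
    show "continuous_on (closure {0<..<T}) k" "t \<in> closure {0<..<T}" unfolding cl using k t by auto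
  qed (rule inner)
qed

context energy_path
begin

lemma energy_AE_eq: "AE t in I\<^sub>T T. energy t = (L2_norm D (u t))\<^sup>2"
proof -
  have "AE t in I\<^sub>T T. t \<in> {0<..<T}" by (rule AE_I2) simp
  then show ?thesis using v_eq u_mem
  proof eventually_elim
    case (elim t)
    have "v t \<in> borel_measurable (lebesgue_on D)" "u t \<in> borel_measurable (lebesgue_on D)"
      using v_L2[of t] W1p_2_D(1)[OF D elim(3)] elim(1) by (auto dest: Lp2_measurable)
    from Lp2_norm_cong_AE[OF this elim(2)] show ?case by (simp add: energy_def)
  qed
qed

lemma energy_nonneg: "0 \<le> energy t" by (simp add: energy_def)

text \<open>Gronwall's inequality is applied to the energy plus the squared gradient accumulated so
  far. One application then bounds the energy at every time and, at time T, the integral of the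
  squared gradient. The coefficient 1/2 of the dissipation becomes 1 since the energy changes by at
  most twice the integrated pairing.\<close>

lemma energy_estimate:
  assumes C: "0 \<le> C" and \<gamma>: "0 \<le> \<gamma>"
    and diss: "AE t in I\<^sub>T T. w t (u t) \<le> - (1/2) * (L2_norm D (weak_grad D (u t)))\<^sup>2
        + C * (L2_norm D (u t))\<^sup>2 + \<gamma>"
  shows "t \<in> {0..T} \<Longrightarrow> energy t \<le> (energy 0 + 2 * \<gamma> * T) * exp (2 * C * t)"
    and "(LINT t|I\<^sub>T T. (H1_norm D (u t))\<^sup>2) \<le> (1 + T) * (energy 0 + 2 * \<gamma> * T) * exp (2 * C * T)"
proof -
  define Gr where "Gr t = (L2_norm D (weak_grad D (u t)))\<^sup>2" for t
  have Gr0: "0 \<le> Gr t" for t by (simp add: Gr_def)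
  have Ei: "integrable (lebesgue_on {0..T}) energy" by (rule continuous_imp_integrable_real[OF continuous_energy])
  have EiT: "integrable (I\<^sub>T T) energy" by (rule integrable_lebesgue_on_subset[OF Ei]) auto
  \<comment> \<open>The measurability in time of the gradient norm is read off from the full H1 norm
    and the continuous energy.\<close>
  have HE: "AE t in I\<^sub>T T. (H1_norm D (u t))\<^sup>2 - energy t = Gr t"
    using energy_AE_eq by eventually_elim (simp add: H1_norm_power2 Gr_def)
  have HEi: "integrable (I\<^sub>T T) (\<lambda>t. (H1_norm D (u t))\<^sup>2 - energy t)"
    by (rule Bochner_Integration.integrable_diff[OF h.Bochner_L2D(3)[OF u] EiT])
  have Grm: "Gr \<in> borel_measurable (I\<^sub>T T)"
    by (rule complete_measure.borel_measurable_AE_cong[OF complete_measure_interval borel_measurable_integrable[OF HEi] HE])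
  have GriT: "integrable (I\<^sub>T T) Gr"
    by (rule integrable_cong_AE_imp[OF HEi Grm]) (use HE in \<open>eventually_elim, simp\<close>)
  have GrH: "Gr integrable_on {0..T}"
    using integrable_on_lebesgue_on[OF GriT] integrable_on_open_interval_real by auto
  have Grint: "Gr integrable_on {a..b}" if "0 \<le> a" "b \<le> T" for a b
    by (rule integrable_on_subinterval[OF GrH]) (use that in auto)
  define \<Gamma> where "\<Gamma> x = integral {0..x} Gr" for x
  have \<Gamma>c: "continuous_on {0..T} \<Gamma>" unfolding \<Gamma>_def by (rule indefinite_integral_continuous_1[OF GrH])
  define F where "F t = 2 * C * energy t + 2 * \<gamma>" for t
  have Fc: "continuous_on {0..T} F" unfolding F_def by (intro continuous_intros continuous_energy)
  have Fint: "F integrable_on {a..b}" if "0 \<le> a" "b \<le> T" for a b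
    by (rule integrable_continuous_interval, rule continuous_on_subset[OF Fc]) (use that in auto)
  define \<I> where "\<I> x = integral {0..x} F" for x
  have \<I>c: "continuous_on {0..T} \<I>" unfolding \<I>_def by (rule indefinite_integral_continuous_1[OF Fint]) auto
  \<comment> \<open>The energy balance: that k does not increase between interior times is
    \<open>energy_increment_le\<close> combined with the dissipation bound.\<close>
  define k where "k x = energy x + \<Gamma> x - \<I> x" for x
  have kc: "continuous_on {0..T} k" unfolding k_def by (intro continuous_intros continuous_energy \<Gamma>c \<I>c)
  have anti: "k b \<le> k a" if ab: "0 < a" "a < b" "b < T" for a b
  proof -
    let ?J = "lebesgue_on {a..b}"
    have sub: "{a..b} \<subseteq> {0<..<T}" using ab by auto
    have pi: "integrable ?J (\<lambda>s. w s (u s))"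
      by (rule integrable_lebesgue_on_subset[OF pairing_integrable sub]) auto
    have gi: "integrable ?J Gr" by (rule integrable_lebesgue_on_subset[OF GriT sub]) auto
    have fi: "integrable ?J F"
      by (rule continuous_imp_integrable_real, rule continuous_on_subset[OF Fc]) (use ab in auto)
    have "2 * (LINT s|?J. w s (u s)) = (LINT s|?J. 2 * w s (u s))" by simp
    also have "\<dots> \<le> (LINT s|?J. F s - Gr s)"
    proof (rule integral_mono_AE[OF integrable_mult_right[OF pi] Bochner_Integration.integrable_diff[OF fi gi]])
      have "AE t in I\<^sub>T T. 2 * w t (u t) \<le> F t - Gr t"
        using diss energy_AE_eq
      proof eventually_elim
        case (elim t)
        then have "w t (u t) \<le> - (1/2) * Gr t + C * energy t + \<gamma>" by (simp add: Gr_def)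
        then show ?case unfolding F_def by linarith
      qed
      then show "AE t in ?J. 2 * w t (u t) \<le> F t - Gr t"
        by (rule AE_lebesgue_on_subset[OF _ sub]) auto
    qed
    also have "\<dots> = integral {a..b} F - integral {a..b} Gr"
      using Bochner_Integration.integral_diff[OF fi gi] lebesgue_integral_eq_integral[OF fi] lebesgue_integral_eq_integral[OF gi] by simp
    also have "integral {a..b} F = \<I> b - \<I> a"
      using Henstock_Kurzweil_Integration.integral_combine[of 0 a b F] Fint[of 0 b] ab by (simp add: \<I>_def)
    also have "integral {a..b} Gr = \<Gamma> b - \<Gamma> a"
      using Henstock_Kurzweil_Integration.integral_combine[of 0 a b Gr] Grint[of 0 b] ab by (simp add: \<Gamma>_def)
    finally show ?thesis using energy_increment_le[OF ab] unfolding k_def by linarith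
  qed
  define z where "z t = energy t + \<Gamma> t" for t
  have zc: "continuous_on {0..T} z" unfolding z_def by (intro continuous_intros continuous_energy \<Gamma>c)
  have \<Gamma>0: "0 \<le> \<Gamma> t" if "t \<in> {0..T}" for t
    unfolding \<Gamma>_def using that Gr0 by (intro integral_nonneg Grint) auto
  have zle: "z t \<le> (energy 0 + 2 * \<gamma> * T) + 2 * C * integral {0..t} z" if t: "t \<in> {0..T}" for t
  proof -
    have "k t \<le> k 0" by (rule continuous_antimono_interior_le[OF kc T anti t])
    then have "z t \<le> energy 0 + \<I> t" by (simp add: k_def z_def \<Gamma>_def \<I>_def)
    also have "\<I> t \<le> integral {0..t} (\<lambda>s. 2 * C * z s + 2 * \<gamma>)"
      unfolding \<I>_def
    proof (rule integral_le)
      show "F integrable_on {0..t}" using t by (intro Fint) auto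
      show "(\<lambda>s. 2 * C * z s + 2 * \<gamma>) integrable_on {0..t}"
        using t by (intro integrable_continuous_interval continuous_intros continuous_on_subset[OF zc]) auto
      fix s assume "s \<in> {0..t}"
      then have "energy s \<le> z s" using \<Gamma>0[of s] t by (simp add: z_def)
      then show "F s \<le> 2 * C * z s + 2 * \<gamma>" unfolding F_def using C by (simp add: mult_left_mono)
    qed
    also have "\<dots> = 2 * C * integral {0..t} z + 2 * \<gamma> * t"
    proof -
      have "integral {0..t} (\<lambda>s. 2 * C * z s + 2 * \<gamma>) = integral {0..t} (\<lambda>s. 2 * C * z s) + integral {0..t} (\<lambda>s. 2 * \<gamma>)"
        using t by (intro Henstock_Kurzweil_Integration.integral_add integrable_continuous_interval continuous_intros continuous_on_subset[OF zc]) auto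
      then show ?thesis using t by simp
    qed
    also have "2 * \<gamma> * t \<le> 2 * \<gamma> * T" using t \<gamma> by (intro mult_left_mono) auto
    finally show ?thesis by simp
  qed
  have zexp: "z t \<le> (energy 0 + 2 * \<gamma> * T) * exp (2 * C * t)" if "t \<in> {0..T}" for t
    by (rule gronwall_integral[OF zc _ zle that]) (use C in auto)
  show E: "energy t \<le> (energy 0 + 2 * \<gamma> * T) * exp (2 * C * t)" if "t \<in> {0..T}" for t
    using zexp[OF that] \<Gamma>0[OF that] by (simp add: z_def)
  define A where "A = (energy 0 + 2 * \<gamma> * T) * exp (2 * C * T)"
  have A0: "0 \<le> energy 0 + 2 * \<gamma> * T" using energy_nonneg[of 0] \<gamma> T by simp
  have EA: "energy t \<le> A" if t: "t \<in> {0..T}" for t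
  proof -
    have "2 * C * t \<le> 2 * C * T" using t C by (intro mult_left_mono) auto
    then have "exp (2 * C * t) \<le> exp (2 * C * T)" by simp
    from mult_left_mono[OF this A0] show ?thesis using E[OF t] unfolding A_def by linarith
  qed
  have "(LINT t|I\<^sub>T T. (H1_norm D (u t))\<^sup>2) = (LINT t|I\<^sub>T T. energy t + Gr t)"
  proof (rule integral_cong_AE)
    show "(\<lambda>t. (H1_norm D (u t))\<^sup>2) \<in> borel_measurable (I\<^sub>T T)" using h.Bochner_L2D(3)[OF u] by (rule borel_measurable_integrable)
    show "(\<lambda>t. energy t + Gr t) \<in> borel_measurable (I\<^sub>T T)"
      by (intro borel_measurable_add borel_measurable_integrable EiT GriT)
    show "AE t in I\<^sub>T T. (H1_norm D (u t))\<^sup>2 = energy t + Gr t" using HE by eventually_elim simp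
  qed
  also have "\<dots> = (LINT t|I\<^sub>T T. energy t) + (LINT t|I\<^sub>T T. Gr t)"
    by (rule Bochner_Integration.integral_add[OF EiT GriT])
  also have "(LINT t|I\<^sub>T T. Gr t) = \<Gamma> T"
    unfolding \<Gamma>_def using lebesgue_integral_eq_integral[OF GriT] by (simp add: integral_open_interval_real)
  also have "(LINT t|I\<^sub>T T. energy t) = integral {0..T} energy"
    using lebesgue_integral_eq_integral[OF EiT] by (simp add: integral_open_interval_real)
  \<comment> \<open>The energy part costs T times the uniform bound A and the gradient part one more
    A, hence the factor 1 + T.\<close>
  also have "integral {0..T} energy \<le> integral {0..T} (\<lambda>t. A)"
    by (intro integral_le EA integrable_continuous_interval continuous_energy) auto
  also have "\<dots> = T * A" using T by simp
  also have "\<Gamma> T \<le> A" using zexp[of T] energy_nonneg[of T] T by (simp add: z_def A_def)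
  finally show "(LINT t|I\<^sub>T T. (H1_norm D (u t))\<^sup>2) \<le> (1 + T) * (energy 0 + 2 * \<gamma> * T) * exp (2 * C * T)"
    by (simp add: A_def algebra_simps)
qed

end

section \<open>The weak form at a fixed time\<close>

text \<open>The spatial part of the weak formulation, solved for the time derivative.\<close>

definition weak_rhs ::
    "'a::euclidean_space set \<Rightarrow> (real \<Rightarrow> real) \<Rightarrow> ('a \<Rightarrow> real) \<Rightarrow> ('a \<Rightarrow> real) \<Rightarrow> ('a \<Rightarrow> 'a) \<Rightarrow> ('a \<Rightarrow> real) \<Rightarrow> ('a \<Rightarrow> real) \<Rightarrow> real"
  where "weak_rhs D f \<alpha> \<beta> g u \<phi> =
    (LINT x|lebesgue_on D. (- weak_grad D u x + f (u x) *\<^sub>R g x) \<bullet> weak_grad D \<phi> x)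
    - (LINT x|lebesgue_on D. \<beta> x * u x * \<phi> x) + (LINT x|lebesgue_on D. \<alpha> x * f (u x) * \<phi> x)"

definition weak_integrand ::
    "'a::euclidean_space set \<Rightarrow> (real \<Rightarrow> real) \<Rightarrow> ('a \<Rightarrow> real) \<Rightarrow> ('a \<Rightarrow> real) \<Rightarrow> ('a \<Rightarrow> 'a) \<Rightarrow> ('a \<Rightarrow> real) \<Rightarrow> ('a \<Rightarrow> real) \<Rightarrow> 'a \<Rightarrow> real"
  where "weak_integrand D f \<alpha> \<beta> g u \<phi> x =
    (- weak_grad D u x + f (u x) *\<^sub>R g x) \<bullet> weak_grad D \<phi> x - \<beta> x * u x * \<phi> x + \<alpha> x * f (u x) * \<phi> x"

text \<open>The data frozen at one time, with g in the role of the gradient of the potential and M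
  bounding all three coefficients.\<close>

locale weak_form_data =
  fixes D :: "'a::euclidean_space set" and f :: "real \<Rightarrow> real" and L M :: real
    and \<alpha> \<beta> :: "'a \<Rightarrow> real" and g :: "'a \<Rightarrow> 'a"
  assumes D: "open D" and f_lip: "L-lipschitz_on UNIV f" and f0: "f 0 = 0" and L0: "0 \<le> L" and M0: "0 \<le> M"
    and \<alpha>: "\<alpha> \<in> borel_measurable (lebesgue_on D)" "AE x in lebesgue_on D. \<bar>\<alpha> x\<bar> \<le> M"
    and \<beta>: "\<beta> \<in> borel_measurable (lebesgue_on D)" "AE x in lebesgue_on D. \<bar>\<beta> x\<bar> \<le> M"
    and g: "g \<in> borel_measurable (lebesgue_on D)" "AE x in lebesgue_on D. norm (g x) \<le> M"
begin

lemma f_le: "\<bar>f a - f b\<bar> \<le> L * \<bar>a - b\<bar>" "\<bar>f a\<bar> \<le> L * \<bar>a\<bar>"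
  using lipschitz_onD[OF f_lip, of a b] lipschitz_onD[OF f_lip, of a 0] f0 by (auto simp: dist_real_def)

lemma f_measurable: "f \<in> borel_measurable borel"
  by (rule borel_measurable_continuous_onI) (rule lipschitz_on_continuous_on[OF f_lip])

lemma f_u_Lp2:
  assumes u: "u \<in> L2 D"
  shows "(\<lambda>x. f (u x)) \<in> L2 D"
proof (rule Lp2_bound[OF u])
  show "(\<lambda>x. f (u x)) \<in> borel_measurable (lebesgue_on D)"
    using measurable_compose[OF Lp2_measurable[OF u] f_measurable] .
  show "AE x in lebesgue_on D. norm (f (u x)) \<le> L * norm (u x)"
    using f_le(2) by (auto intro: AE_I2)
qed

lemma coefficients_Lp2:
  assumes u: "u \<in> H1 D"
  shows "(\<lambda>x. - weak_grad D u x + f (u x) *\<^sub>R g x) \<in> L2 D"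
    "(\<lambda>x. \<beta> x * u x) \<in> L2 D" "(\<lambda>x. \<alpha> x * f (u x)) \<in> L2 D"
proof -
  note u2 = W1p_2_D[OF D u]
  note fu = f_u_Lp2[OF u2(1)]
  have "(\<lambda>x. f (u x) *\<^sub>R g x) \<in> L2 D"
  proof (rule Lp2_bound[OF fu, where c=M])
    show "(\<lambda>x. f (u x) *\<^sub>R g x) \<in> borel_measurable (lebesgue_on D)"
      by (intro borel_measurable_scaleR Lp2_measurable[OF fu] g(1))
    show "AE x in lebesgue_on D. norm (f (u x) *\<^sub>R g x) \<le> M * norm (f (u x))"
      using g(2) by eventually_elim (simp add: mult.commute mult_right_mono)
  qed
  from Lp2_add[OF Lp2_scaleR[OF u2(2), of "-1"] this]
  show "(\<lambda>x. - weak_grad D u x + f (u x) *\<^sub>R g x) \<in> L2 D" by simp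
  show "(\<lambda>x. \<beta> x * u x) \<in> L2 D" by (rule Lp2_bounded_mult[OF \<beta> u2(1)])
  show "(\<lambda>x. \<alpha> x * f (u x)) \<in> L2 D" by (rule Lp2_bounded_mult[OF \<alpha> fu])
qed

lemma weak_rhs_integrable:
  assumes u: "u \<in> H1 D" and \<phi>: "\<phi> \<in> H1 D"
  shows "integrable (lebesgue_on D) (\<lambda>x. (- weak_grad D u x + f (u x) *\<^sub>R g x) \<bullet> weak_grad D \<phi> x)"
    "integrable (lebesgue_on D) (\<lambda>x. \<beta> x * u x * \<phi> x)" "integrable (lebesgue_on D) (\<lambda>x. \<alpha> x * f (u x) * \<phi> x)"
  using coefficients_Lp2[OF u] W1p_2_D[OF D \<phi>]
  by (auto intro: Lp2_integrable_inner Lp2_integrable_mult)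

lemma weak_rhs_single_integral:
  assumes u: "u \<in> H1 D" and \<phi>: "\<phi> \<in> H1 D"
  shows "weak_rhs D f \<alpha> \<beta> g u \<phi> = (LINT x|lebesgue_on D.
    weak_integrand D f \<alpha> \<beta> g u \<phi> x)"
    and "integrable (lebesgue_on D) (\<lambda>x.
    weak_integrand D f \<alpha> \<beta> g u \<phi> x)"
  using weak_rhs_integrable[OF u \<phi>] by (simp_all add: weak_rhs_def weak_integrand_def)

text \<open>Cauchy-Schwarz bounds each term by the H1 norm of the test function, and linearity holds
  because weak gradients are linear almost everywhere. Boundedness is what later allows passing to
  limits of test functions.\<close>

lemma weak_rhs_dual:
  assumes u: "u \<in> H1 D"
  shows "weak_rhs D f \<alpha> \<beta> g u \<in> H1_dual D"
proof -
  note c = coefficients_Lp2[OF u]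
  define P where "P = L2_norm D (\<lambda>x. - weak_grad D u x + f (u x) *\<^sub>R g x)"
  define Q where "Q = L2_norm D (\<lambda>x. \<beta> x * u x)"
  define R where "R = L2_norm D (\<lambda>x. \<alpha> x * f (u x))"
  show ?thesis
  proof (rule H1_dualI[where B="P + Q + R"])
    fix \<phi> assume \<phi>: "\<phi> \<in> H1 D"
    note p = W1p_2_D[OF D \<phi>]
    have "\<bar>weak_rhs D f \<alpha> \<beta> g u \<phi>\<bar> \<le> P * L2_norm D (weak_grad D \<phi>) + Q * L2_norm D \<phi> + R * L2_norm D \<phi>"
      using Cauchy_Schwarz_Lp2[OF c(1) p(2)] Cauchy_Schwarz_Lp2_real[OF c(2) p(1)] Cauchy_Schwarz_Lp2_real[OF c(3) p(1)]
      unfolding weak_rhs_def P_def Q_def R_def by linarith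
    also have "\<dots> \<le> P * H1_norm D \<phi> + Q * H1_norm D \<phi> + R * H1_norm D \<phi>"
      unfolding P_def Q_def R_def by (intro add_mono mult_left_mono Lp2_norm_le_H1_norm) auto
    finally show "\<bar>weak_rhs D f \<alpha> \<beta> g u \<phi>\<bar> \<le> (P + Q + R) * H1_norm D \<phi>" by (simp add: algebra_simps)
  next
    fix \<phi> \<psi> assume \<phi>: "\<phi> \<in> H1 D" and \<psi>: "\<psi> \<in> H1 D"
    note a = H1_add[OF D \<phi> \<psi>]
    note i = weak_rhs_single_integral(2)[OF u \<phi>] weak_rhs_single_integral(2)[OF u \<psi>]
    have "weak_rhs D f \<alpha> \<beta> g u (\<lambda>x. \<phi> x + \<psi> x) = (LINT x|lebesgue_on D.
        weak_integrand D f \<alpha> \<beta> g u \<phi> x +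
        weak_integrand D f \<alpha> \<beta> g u \<psi> x)"
      unfolding weak_rhs_single_integral(1)[OF u a(1)]
    proof (rule integral_cong_AE)
      show "AE x in lebesgue_on D. weak_integrand D f \<alpha> \<beta> g u (\<lambda>x. \<phi> x + \<psi> x) x =
        weak_integrand D f \<alpha> \<beta> g u \<phi> x +
        weak_integrand D f \<alpha> \<beta> g u \<psi> x"
        using a(2)
      proof eventually_elim
        case (elim x)
        show ?case unfolding weak_integrand_def elim[symmetric] inner_add_right by (simp add: algebra_simps)
      qed
    qed (intro borel_measurable_integrable weak_rhs_single_integral(2)[OF u a(1)] Bochner_Integration.integrable_add i)+
    then show "weak_rhs D f \<alpha> \<beta> g u (\<lambda>x. \<phi> x + \<psi> x) = weak_rhs D f \<alpha> \<beta> g u \<phi> + weak_rhs D f \<alpha> \<beta> g u \<psi>"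
      unfolding weak_rhs_single_integral(1)[OF u \<phi>] weak_rhs_single_integral(1)[OF u \<psi>]
      using Bochner_Integration.integral_add[OF i] by simp
  next
    fix \<phi> and c :: real assume \<phi>: "\<phi> \<in> H1 D"
    note a = H1_scale[OF D \<phi>, of c]
    note i = weak_rhs_single_integral(2)[OF u \<phi>]
    have "weak_rhs D f \<alpha> \<beta> g u (\<lambda>x. c * \<phi> x) = (LINT x|lebesgue_on D.
        c * weak_integrand D f \<alpha> \<beta> g u \<phi> x)"
      unfolding weak_rhs_single_integral(1)[OF u a(1)]
    proof (rule integral_cong_AE)
      show "AE x in lebesgue_on D. weak_integrand D f \<alpha> \<beta> g u (\<lambda>x. c * \<phi> x) x =
        c * weak_integrand D f \<alpha> \<beta> g u \<phi> x"
        using a(2)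
      proof eventually_elim
        case (elim x)
        show ?case unfolding weak_integrand_def elim[symmetric] inner_scaleR_right by (simp add: algebra_simps)
      qed
    qed (intro borel_measurable_integrable weak_rhs_single_integral(2)[OF u a(1)] integrable_mult_right i)+
    then show "weak_rhs D f \<alpha> \<beta> g u (\<lambda>x. c * \<phi> x) = c * weak_rhs D f \<alpha> \<beta> g u \<phi>"
      unfolding weak_rhs_single_integral(1)[OF u \<phi>] by simp
  qed
qed

end

section \<open>Estimates for the difference of two right-hand sides\<close>

lemma mult_le_squares: "(x::real) * y \<le> x\<^sup>2 + y\<^sup>2 / 4"
proof -
  have "0 \<le> (x - y / 2)\<^sup>2" by simp
  then show ?thesis by (simp add: power2_eq_square algebra_simps)
qed

lemma mult_le_half_squares: "(x::real) * y \<le> x\<^sup>2 / 2 + y\<^sup>2 / 2"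
  using sum_squares_bound[of x y] by simp

text \<open>Origin of the constants: each of the two drift terms takes a quarter of the squared
  gradient, which leaves -1/2. On (a - b)^2, the drift contributes L^2 M^2, the term with \<beta>1
  contributes M, the term with \<alpha>1 contributes M L, and the differences of \<alpha> and of
  \<beta> contribute 1/2 each. The coefficient of b^2 gathers the three differences of the
  data.\<close>

lemma pointwise_difference_estimate:
  fixes p r g1 g2 :: "'a::real_inner" and a b \<alpha>1 \<alpha>2 \<beta>1 \<beta>2 fa fb :: real
  assumes "0 \<le> L" "0 \<le> M" and fab: "\<bar>fa - fb\<bar> \<le> L * \<bar>a - b\<bar>" and fb: "\<bar>fb\<bar> \<le> L * \<bar>b\<bar>"
    and \<alpha>1: "\<bar>\<alpha>1\<bar> \<le> M" and \<beta>1: "\<bar>\<beta>1\<bar> \<le> M" and g1: "norm g1 \<le> M"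
    and d: "\<bar>\<alpha>1 - \<alpha>2\<bar> \<le> d\<alpha>" "\<bar>\<beta>1 - \<beta>2\<bar> \<le> d\<beta>" "norm (g1 - g2) \<le> dg"
  shows "((- p + fa *\<^sub>R g1) \<bullet> (p - r) - \<beta>1 * a * (a - b) + \<alpha>1 * fa * (a - b))
      - ((- r + fb *\<^sub>R g2) \<bullet> (p - r) - \<beta>2 * b * (a - b) + \<alpha>2 * fb * (a - b))
    \<le> - (1/2) * (norm (p - r))\<^sup>2 + (L\<^sup>2 * M\<^sup>2 + M + M * L + 1) * (a - b)\<^sup>2 + (L\<^sup>2 * dg\<^sup>2 + d\<beta>\<^sup>2 + L\<^sup>2 * d\<alpha>\<^sup>2) * b\<^sup>2"
proof -
  define e where "e = p - r"
  define c where "c = a - b"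
  \<comment> \<open>Products are split so that the first data multiply the difference of the states
    and the difference of the data multiplies the second state, as in fa g1 - fb g2 = (fa - fb) g1 +
    fb (g1 - g2).\<close>
  have eq: "((- p + fa *\<^sub>R g1) \<bullet> (p - r) - \<beta>1 * a * (a - b) + \<alpha>1 * fa * (a - b))
      - ((- r + fb *\<^sub>R g2) \<bullet> (p - r) - \<beta>2 * b * (a - b) + \<alpha>2 * fb * (a - b))
    = - (norm e)\<^sup>2 + (fa - fb) * (g1 \<bullet> e) + fb * ((g1 - g2) \<bullet> e) - \<beta>1 * c\<^sup>2 - (\<beta>1 - \<beta>2) * b * c
      + \<alpha>1 * (fa - fb) * c + (\<alpha>1 - \<alpha>2) * fb * c"
    unfolding e_def[symmetric] c_def[symmetric]
  proof -
    have "(- p + fa *\<^sub>R g1) \<bullet> e - (- r + fb *\<^sub>R g2) \<bullet> e = - (e \<bullet> e) + (fa - fb) * (g1 \<bullet> e) + fb * ((g1 - g2) \<bullet> e)"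
      by (simp add: e_def inner_add_left inner_diff_left algebra_simps)
    moreover have "a = b + c" by (simp add: c_def)
    ultimately show "((- p + fa *\<^sub>R g1) \<bullet> e - \<beta>1 * a * c + \<alpha>1 * fa * c) - ((- r + fb *\<^sub>R g2) \<bullet> e - \<beta>2 * b * c + \<alpha>2 * fb * c)
      = - (norm e)\<^sup>2 + (fa - fb) * (g1 \<bullet> e) + fb * ((g1 - g2) \<bullet> e) - \<beta>1 * c\<^sup>2 - (\<beta>1 - \<beta>2) * b * c
      + \<alpha>1 * (fa - fb) * c + (\<alpha>1 - \<alpha>2) * fb * c"
      unfolding power2_norm_eq_inner by (simp add: power2_eq_square algebra_simps)
  qed
  have dn: "0 \<le> d\<alpha>" "0 \<le> d\<beta>" "0 \<le> dg" using d by (auto intro: order_trans[OF abs_ge_zero] order_trans[OF norm_ge_zero])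
  have fab': "\<bar>fa - fb\<bar> \<le> L * \<bar>c\<bar>" using fab by (simp add: c_def)
  have t1: "(fa - fb) * (g1 \<bullet> e) \<le> L\<^sup>2 * M\<^sup>2 * c\<^sup>2 + (norm e)\<^sup>2 / 4"
  proof -
    have "(fa - fb) * (g1 \<bullet> e) \<le> \<bar>fa - fb\<bar> * \<bar>g1 \<bullet> e\<bar>" by (metis abs_ge_self abs_mult)
    also have "\<dots> \<le> (L * \<bar>c\<bar>) * (M * norm e)"
      using fab' assms(1) order_trans[OF Cauchy_Schwarz_ineq2[of g1 e] mult_right_mono[OF g1]]
      by (intro mult_mono) auto
    also have "\<dots> = (L * M * \<bar>c\<bar>) * norm e" by simp
    also have "\<dots> \<le> (L * M * \<bar>c\<bar>)\<^sup>2 + (norm e)\<^sup>2 / 4" by (rule mult_le_squares)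
    finally show ?thesis by (simp add: power_mult_distrib)
  qed
  have t2: "fb * ((g1 - g2) \<bullet> e) \<le> L\<^sup>2 * dg\<^sup>2 * b\<^sup>2 + (norm e)\<^sup>2 / 4"
  proof -
    have "fb * ((g1 - g2) \<bullet> e) \<le> \<bar>fb\<bar> * \<bar>(g1 - g2) \<bullet> e\<bar>" by (metis abs_ge_self abs_mult)
    also have "\<dots> \<le> (L * \<bar>b\<bar>) * (dg * norm e)"
      using fb assms(1) order_trans[OF Cauchy_Schwarz_ineq2[of "g1 - g2" e] mult_right_mono[OF d(3)]]
      by (intro mult_mono) auto
    also have "\<dots> = (L * dg * \<bar>b\<bar>) * norm e" by simp
    also have "\<dots> \<le> (L * dg * \<bar>b\<bar>)\<^sup>2 + (norm e)\<^sup>2 / 4" by (rule mult_le_squares)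
    finally show ?thesis by (simp add: power_mult_distrib)
  qed
  have t3: "- (\<beta>1 * c\<^sup>2) \<le> M * c\<^sup>2"
    using \<beta>1 mult_right_mono[of "- \<beta>1" M "c\<^sup>2"] by simp
  have t4: "- ((\<beta>1 - \<beta>2) * b * c) \<le> d\<beta>\<^sup>2 * b\<^sup>2 + c\<^sup>2 / 2"
  proof -
    have "- ((\<beta>1 - \<beta>2) * b * c) \<le> \<bar>\<beta>1 - \<beta>2\<bar> * \<bar>b\<bar> * \<bar>c\<bar>" by (metis abs_ge_minus_self abs_mult)
    also have "\<dots> \<le> (d\<beta> * \<bar>b\<bar>) * \<bar>c\<bar>" using d by (intro mult_right_mono) auto
    also have "\<dots> \<le> (d\<beta> * \<bar>b\<bar>)\<^sup>2 / 2 + \<bar>c\<bar>\<^sup>2 / 2" by (rule mult_le_half_squares)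
    also have "\<dots> \<le> (d\<beta> * \<bar>b\<bar>)\<^sup>2 + \<bar>c\<bar>\<^sup>2 / 2" by simp
    finally show ?thesis by (simp add: power_mult_distrib)
  qed
  have t5: "\<alpha>1 * (fa - fb) * c \<le> M * L * c\<^sup>2"
  proof -
    have "\<alpha>1 * (fa - fb) * c \<le> \<bar>\<alpha>1\<bar> * \<bar>fa - fb\<bar> * \<bar>c\<bar>" by (metis abs_ge_self abs_mult)
    also have "\<dots> \<le> M * (L * \<bar>c\<bar>) * \<bar>c\<bar>" using \<alpha>1 fab' assms(2) by (intro mult_right_mono mult_mono) auto
    finally show ?thesis by (simp add: power2_eq_square)
  qed
  have t6: "(\<alpha>1 - \<alpha>2) * fb * c \<le> L\<^sup>2 * d\<alpha>\<^sup>2 * b\<^sup>2 + c\<^sup>2 / 2"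
  proof -
    have "(\<alpha>1 - \<alpha>2) * fb * c \<le> \<bar>\<alpha>1 - \<alpha>2\<bar> * \<bar>fb\<bar> * \<bar>c\<bar>" by (metis abs_ge_self abs_mult)
    also have "\<dots> \<le> d\<alpha> * (L * \<bar>b\<bar>) * \<bar>c\<bar>" using d fb dn by (intro mult_right_mono mult_mono) auto
    also have "\<dots> = (L * d\<alpha> * \<bar>b\<bar>) * \<bar>c\<bar>" by simp
    also have "\<dots> \<le> (L * d\<alpha> * \<bar>b\<bar>)\<^sup>2 / 2 + \<bar>c\<bar>\<^sup>2 / 2" by (rule mult_le_half_squares)
    also have "\<dots> \<le> (L * d\<alpha> * \<bar>b\<bar>)\<^sup>2 + \<bar>c\<bar>\<^sup>2 / 2" by simp
    finally show ?thesis by (simp add: power_mult_distrib)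
  qed
  show ?thesis
    unfolding eq unfolding e_def[symmetric] c_def[symmetric]
    using t1 t2 t3 t4 t5 t6 unfolding distrib_right by linarith
qed

lemma weak_rhs_difference_estimate:
  assumes 1: "weak_form_data D f L M \<alpha>1 \<beta>1 g1" and 2: "weak_form_data D f L M \<alpha>2 \<beta>2 g2"
    and d: "AE x in lebesgue_on D. \<bar>\<alpha>1 x - \<alpha>2 x\<bar> \<le> d\<alpha>" "AE x in lebesgue_on D. \<bar>\<beta>1 x - \<beta>2 x\<bar> \<le> d\<beta>"
      "AE x in lebesgue_on D. norm (g1 x - g2 x) \<le> dg"
    and u: "u1 \<in> H1 D" "u2 \<in> H1 D"
  defines "\<phi> \<equiv> \<lambda>x. u1 x - u2 x"
  shows "weak_rhs D f \<alpha>1 \<beta>1 g1 u1 \<phi> - weak_rhs D f \<alpha>2 \<beta>2 g2 u2 \<phi> \<le>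
    - (1/2) * (L2_norm D (weak_grad D \<phi>))\<^sup>2 + (L\<^sup>2 * M\<^sup>2 + M + M * L + 1) * (L2_norm D \<phi>)\<^sup>2
    + (L\<^sup>2 * dg\<^sup>2 + d\<beta>\<^sup>2 + L\<^sup>2 * d\<alpha>\<^sup>2) * (L2_norm D u2)\<^sup>2"
proof -
  interpret w1: weak_form_data D f L M \<alpha>1 \<beta>1 g1 by (rule 1)
  interpret w2: weak_form_data D f L M \<alpha>2 \<beta>2 g2 by (rule 2)
  interpret h: seminormed_functions "H1 D" "H1_norm D" by (rule seminormed_H1[OF w1.D])
  note D = w1.D
  have \<phi>: "\<phi> \<in> H1 D" unfolding \<phi>_def by (rule h.diff[OF u])
  have gr: "AE x in lebesgue_on D. weak_grad D \<phi> x = weak_grad D u1 x - weak_grad D u2 x"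
  proof -
    have "has_weak_grad D (\<lambda>x. u1 x + (-1) * u2 x) (\<lambda>x. weak_grad D u1 x + (-1) *\<^sub>R weak_grad D u2 x)"
      by (intro has_weak_grad_add has_weak_grad_scale W1p_2_D D u)
    from weak_grad_eq(2)[OF D this] show ?thesis
      unfolding \<phi>_def by eventually_elim simp
  qed
  note i1 = w1.weak_rhs_single_integral[OF u(1) \<phi>] and i2 = w2.weak_rhs_single_integral[OF u(2) \<phi>]
  let ?M = "lebesgue_on D"
  let ?C = "L\<^sup>2 * M\<^sup>2 + M + M * L + 1" and ?\<kappa> = "L\<^sup>2 * dg\<^sup>2 + d\<beta>\<^sup>2 + L\<^sup>2 * d\<alpha>\<^sup>2"
  have n: "integrable ?M (\<lambda>x. (norm (weak_grad D \<phi> x))\<^sup>2)" "integrable ?M (\<lambda>x. (norm (\<phi> x))\<^sup>2)" "integrable ?M (\<lambda>x. (norm (u2 x))\<^sup>2)"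
    using W1p_2_D[OF D \<phi>] W1p_2_D[OF D u(2)] by (auto simp: Lp2_iff)
  have "weak_rhs D f \<alpha>1 \<beta>1 g1 u1 \<phi> - weak_rhs D f \<alpha>2 \<beta>2 g2 u2 \<phi> =
    (LINT x|?M. weak_integrand D f \<alpha>1 \<beta>1 g1 u1 \<phi> x
       - weak_integrand D f \<alpha>2 \<beta>2 g2 u2 \<phi> x)"
    unfolding i1(1) i2(1) by (rule Bochner_Integration.integral_diff[symmetric, OF i1(2) i2(2)])
  also have "\<dots> \<le> (LINT x|?M. - (1/2) * (norm (weak_grad D \<phi> x))\<^sup>2 + ?C * (norm (\<phi> x))\<^sup>2 + ?\<kappa> * (norm (u2 x))\<^sup>2)"
  proof (rule integral_mono_AE[OF Bochner_Integration.integrable_diff[OF i1(2) i2(2)]])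
    show "integrable ?M (\<lambda>x. - (1/2) * (norm (weak_grad D \<phi> x))\<^sup>2 + ?C * (norm (\<phi> x))\<^sup>2 + ?\<kappa> * (norm (u2 x))\<^sup>2)"
      by (intro Bochner_Integration.integrable_add integrable_mult_right n)
    show "AE x in ?M. weak_integrand D f \<alpha>1 \<beta>1 g1 u1 \<phi> x
       - weak_integrand D f \<alpha>2 \<beta>2 g2 u2 \<phi> x
       \<le> - (1/2) * (norm (weak_grad D \<phi> x))\<^sup>2 + ?C * (norm (\<phi> x))\<^sup>2 + ?\<kappa> * (norm (u2 x))\<^sup>2"
      using gr d w1.\<alpha>(2) w1.\<beta>(2) w1.g(2)
    proof eventually_elim
      case (elim x)
      from pointwise_difference_estimate[OF w1.L0 w1.M0 w1.f_le(1)[of "u1 x" "u2 x"] w1.f_le(2)[of "u2 x"] elim(5,6,7) elim(2,3,4),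
          of "weak_grad D u1 x" "weak_grad D u2 x"]
      show ?case unfolding weak_integrand_def elim(1) by (simp add: \<phi>_def)
    qed
  qed
  also have "\<dots> = (LINT x|?M. - (1/2) * (norm (weak_grad D \<phi> x))\<^sup>2 + ?C * (norm (\<phi> x))\<^sup>2) + (LINT x|?M. ?\<kappa> * (norm (u2 x))\<^sup>2)"
    by (intro Bochner_Integration.integral_add Bochner_Integration.integrable_add integrable_mult_right n)
  also have "(LINT x|?M. - (1/2) * (norm (weak_grad D \<phi> x))\<^sup>2 + ?C * (norm (\<phi> x))\<^sup>2) = (LINT x|?M. - (1/2) * (norm (weak_grad D \<phi> x))\<^sup>2) + (LINT x|?M. ?C * (norm (\<phi> x))\<^sup>2)"
    by (intro Bochner_Integration.integral_add integrable_mult_right n)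
  finally show ?thesis by (simp only: integral_mult_right_zero Lp2_norm_power2)
qed

text \<open>Comparison with the zero function under the same data: its right-hand side vanishes
  because f 0 = 0, and all differences of the data are 0.\<close>

lemma weak_rhs_energy_estimate:
  assumes 1: "weak_form_data D f L M \<alpha> \<beta> g" and u: "u \<in> H1 D"
  shows "weak_rhs D f \<alpha> \<beta> g u u \<le>
    - (1/2) * (L2_norm D (weak_grad D u))\<^sup>2 + (L\<^sup>2 * M\<^sup>2 + M + M * L + 1) * (L2_norm D u)\<^sup>2"
proof -
  interpret w: weak_form_data D f L M \<alpha> \<beta> g by (rule 1)
  have z: "AE x in lebesgue_on D. 0 = weak_grad D (\<lambda>x. 0) x"
    by (rule weak_grad_eq(2)[OF w.D has_weak_grad_zero])
  have "weak_rhs D f \<alpha> \<beta> g (\<lambda>x. 0) u = (LINT x|lebesgue_on D. 0)"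
    unfolding w.weak_rhs_single_integral(1)[OF H1_zero u]
  proof (rule integral_cong_AE)
    show "AE x in lebesgue_on D. weak_integrand D f \<alpha> \<beta> g (\<lambda>x. 0) u x = 0"
      using z by eventually_elim (simp add: weak_integrand_def w.f0)
  qed (rule borel_measurable_integrable[OF w.weak_rhs_single_integral(2)[OF H1_zero u]], simp)
  moreover have "L2_norm D (\<lambda>x. 0::real) = 0"
    using Lp2_norm_cmult[of "lebesgue_on D" 0 "\<lambda>x. 0"] by simp
  ultimately show ?thesis
    using weak_rhs_difference_estimate[OF 1 1 _ _ _ u H1_zero, of 0 0 0] by simp
qed

section \<open>Stability of solutions\<close>

text \<open>Lebesgue measure on the product space is the completion of a product measure, not a
  product of completions. The property is therefore moved to \<open>lborel\<close>, sliced there,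
  and moved back.\<close>

lemma AE_lebesgue_on_product:
  fixes S :: "real set" and D :: "'a::euclidean_space set"
  assumes S: "S \<in> sets borel" and D: "D \<in> sets borel"
    and ae: "AE z in lebesgue_on (S \<times> D). P z"
  shows "AE t in lebesgue_on S. AE x in lebesgue_on D. P (t, x)"
proof -
  have SD: "S \<times> D \<in> sets (borel :: (real \<times> 'a) measure)" using S D by (simp add: borel_Times)
  have "AE z in lebesgue. z \<in> S \<times> D \<longrightarrow> P z"
    using ae SD by (subst (asm) AE_restrict_space_iff) auto
  then have "AE z in lborel. z \<in> S \<times> D \<longrightarrow> P z" by (simp add: AE_completion_iff)
  then have "AE z in lborel \<Otimes>\<^sub>M lborel. z \<in> S \<times> D \<longrightarrow> P z" by (subst lborel_prod)
  then have "AE t in lborel. AE x in lborel. (t, x) \<in> S \<times> D \<longrightarrow> P (t, x)"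
    by (rule lborel_pair.AE_pair)
  then have "AE t in lebesgue. AE x in lebesgue. (t, x) \<in> S \<times> D \<longrightarrow> P (t, x)"
    by (simp add: AE_completion_iff)
  then have "AE t in lebesgue. t \<in> S \<longrightarrow> (AE x in lebesgue. x \<in> D \<longrightarrow> P (t, x))"
    by eventually_elim auto
  then show ?thesis using S D by (simp add: AE_restrict_space_iff)
qed

text \<open>A slice of a Lebesgue measurable function need not be measurable. A Borel version G has
  Borel slices, which for almost every t agree with \<open>F t\<close> almost everywhere, and
  completeness makes \<open>F t\<close> measurable.\<close>

lemma Linf_product_slices:
  fixes S :: "real set" and D :: "'a::euclidean_space set" and F :: "real \<Rightarrow> 'a \<Rightarrow> real"
  assumes S: "S \<in> sets borel" and D: "D \<in> sets borel"
    and F: "(\<lambda>(t, x). F t x) \<in> Linf (lebesgue_on (S \<times> D))"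
  shows "AE t in lebesgue_on S. F t \<in> borel_measurable (lebesgue_on D) \<and>
    (AE x in lebesgue_on D. \<bar>F t x\<bar> \<le> Linf_norm (lebesgue_on (S \<times> D)) (\<lambda>(t, x). F t x))"
proof -
  let ?c = "Linf_norm (lebesgue_on (S \<times> D)) (\<lambda>(t, x). F t x)"
  have SD: "S \<times> D \<in> sets (borel :: (real \<times> 'a) measure)" using S D by (simp add: borel_Times)
  have "AE z in lebesgue_on (S \<times> D). \<bar>case z of (t, x) \<Rightarrow> F t x\<bar> \<le> ?c"
    using Linf_AE_bound[OF F] by simp
  from AE_lebesgue_on_product[OF S D this]
  have bd: "AE t in lebesgue_on S. AE x in lebesgue_on D. \<bar>F t x\<bar> \<le> ?c" by simp
  have "(\<lambda>z. indicator (S \<times> D) z *\<^sub>R (case z of (t, x) \<Rightarrow> F t x)) \<in> borel_measurable lebesgue"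
    using F SD by (simp add: Linf_def borel_measurable_restrict_space_iff)
  then obtain G where G: "G \<in> borel_measurable lborel"
    and ae: "AE z in lborel. indicator (S \<times> D) z *\<^sub>R (case z of (t, x) \<Rightarrow> F t x) = G z"
    using completion_ex_borel_measurable_real by blast
  have "AE z in lebesgue_on (S \<times> D). (case z of (t, x) \<Rightarrow> F t x) = G z"
  proof -
    have "AE z in lebesgue. indicator (S \<times> D) z *\<^sub>R (case z of (t, x) \<Rightarrow> F t x) = G z"
      by (rule AE_completion[OF ae])
    then have "AE z in lebesgue. z \<in> S \<times> D \<longrightarrow> (case z of (t, x) \<Rightarrow> F t x) = G z"
      by eventually_elim (auto simp: indicator_def)
    then show ?thesis using SD by (subst AE_restrict_space_iff) auto
  qed
  from AE_lebesgue_on_product[OF S D this]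
  have eq: "AE t in lebesgue_on S. AE x in lebesgue_on D. F t x = G (t, x)" by simp
  have Gb: "G \<in> borel_measurable borel" using G by simp
  have Gt: "(\<lambda>x. G (t, x)) \<in> borel_measurable (lebesgue_on D)" for t
  proof -
    have "(\<lambda>x. G (t, x)) \<in> borel_measurable borel"
      by (rule measurable_compose[OF _ Gb]) (intro borel_measurable_continuous_onI continuous_intros)
    then show ?thesis by (intro measurable_restrict_space1 measurable_completion) simp
  qed
  have cm: "complete_measure (lebesgue_on D)" using D by (intro complete_measure_lebesgue_on) simp
  show ?thesis
    using bd eq
  proof eventually_elim
    case (elim t)
    have "AE x in lebesgue_on D. G (t, x) = F t x" using elim(2) by eventually_elim simp
    then show ?case using complete_measure.borel_measurable_AE_cong[OF cm Gt] elim(1) by blast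
  qed
qed

text \<open>The exceptional set of times depends on \<phi>. The values of the simple approximants of
  u form a countable set, so outside one null set the identity holds on all of them; there the
  bounded functional \<open>w t\<close> - \<open>R t\<close> vanishes along a sequence tending to
  \<open>u t\<close> in H1.\<close>

lemma dual_identity_at_path:
  assumes D: "open D" and u: "strongly_measurable (H1 D) (H1_norm D) T u"
    and w: "AE t in I\<^sub>T T. w t \<in> H1_dual D" and R: "AE t in I\<^sub>T T. R t \<in> H1_dual D"
    and eq: "\<And>\<phi>. \<phi> \<in> H1 D \<Longrightarrow> AE t in I\<^sub>T T. w t \<phi> = R t \<phi>"
  shows "AE t in I\<^sub>T T. w t (u t) = R t (u t)"
proof -
  interpret h: seminormed_functions "H1 D" "H1_norm D" by (rule seminormed_H1[OF D])
  interpret d: seminormed_functions "H1_dual D" "H1_dual_norm D" by (rule seminormed_H1_dual[OF D])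
  obtain s where s: "\<And>k. simple_into (H1 D) T (s k)" "AE t in I\<^sub>T T. u t \<in> H1 D"
    "AE t in I\<^sub>T T. (\<lambda>k. H1_norm D (\<lambda>x. s k t x - u t x)) \<longlonglongrightarrow> 0"
    using h.strongly_measurableE[OF u] by blast
  let ?Z = "\<Union>k. s k ` {0<..<T}"
  have "finite (s k ` {0<..<T})" "s k ` {0<..<T} \<subseteq> H1 D" for k using s(1)[of k] by (auto simp: simple_into_def)
  then have Z: "countable ?Z" "?Z \<subseteq> H1 D" by (auto intro: countable_UN[OF _ countable_finite])
  have ZAE: "AE t in I\<^sub>T T. \<forall>\<phi>\<in>?Z. w t \<phi> = R t \<phi>"
    using Z(2) eq by (subst AE_ball_countable[OF Z(1)]) blast
  have inT: "AE t in I\<^sub>T T. t \<in> {0<..<T}" by (rule AE_I2) simp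
  show ?thesis
    using ZAE s(2,3) w R inT
  proof eventually_elim
    case (elim t)
    define l where "l = (\<lambda>\<phi>. w t \<phi> - R t \<phi>)"
    have l: "l \<in> H1_dual D" unfolding l_def by (rule d.diff[OF elim(4,5)])
    have "\<bar>l (u t)\<bar> \<le> H1_dual_norm D l * H1_norm D (\<lambda>x. s k t x - u t x)" for k
    proof -
      have sk: "s k t \<in> H1 D" using h.simple_into_mem[OF s(1) elim(6)] .
      have "s k t \<in> ?Z" using elim(6) by blast
      from bspec[OF elim(1) this] have "l (s k t) = 0" by (simp add: l_def)
      then show ?thesis
        using H1_dual_bound[OF l h.diff[OF sk elim(2)] D] H1_dual_diff_arg[OF D l sk elim(2)] by simp
    qed
    moreover have "(\<lambda>k. H1_dual_norm D l * H1_norm D (\<lambda>x. s k t x - u t x)) \<longlonglongrightarrow> 0"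
      using elim(3) by (rule tendsto_mult_right_zero)
    ultimately have "\<bar>l (u t)\<bar> \<le> 0" by (intro LIMSEQ_le_const) auto
    then show ?case by (simp add: l_def)
  qed
qed

section \<open>Weak solutions as energy paths\<close>

locale solution =
  fixes D :: "'a::euclidean_space set" and T p \<alpha>0 \<beta>0 M L :: real and f :: "real \<Rightarrow> real"
    and \<alpha> \<beta> V u :: "real \<Rightarrow> 'a \<Rightarrow> real" and u0 :: "'a \<Rightarrow> real"
  assumes D: "open D" and T: "0 < T" and f_lip: "L-lipschitz_on UNIV f" and f0: "f 0 = 0"
    and data: "admissible_data D T p \<alpha>0 \<beta>0 \<alpha> \<beta> V u0" and bnd: "data_bounded D T M \<alpha> \<beta> V"
    and sol: "weak_solution D T f \<alpha> \<beta> V u" and init: "has_initial_value D T u u0"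
begin

definition "rhs t = weak_rhs D f (\<alpha> t) (\<beta> t) (weak_grad D (V t)) (u t)"

lemma M0: "0 \<le> M"
  using bnd order_trans[OF Linf_norm_nonneg] by (auto simp: data_bounded_def)

lemma weak_form_data_AE: "AE t in I\<^sub>T T. weak_form_data D f L M (\<alpha> t) (\<beta> t) (weak_grad D (V t))"
proof -
  interpret V: seminormed_functions "W1inf D" "W1inf_norm D" by (rule seminormed_W1inf[OF D])
  have Db: "D \<in> sets borel" "{0<..<T} \<in> sets borel" using D by auto
  have \<alpha>: "AE t in I\<^sub>T T. \<alpha> t \<in> borel_measurable (lebesgue_on D) \<and> (AE x in lebesgue_on D. \<bar>\<alpha> t x\<bar> \<le> Linf_norm (lebesgue_on ({0<..<T} \<times> D)) (\<lambda>(t, x). \<alpha> t x))"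
    using data by (intro Linf_product_slices Db) (simp add: admissible_data_def)
  have \<beta>: "AE t in I\<^sub>T T. \<beta> t \<in> borel_measurable (lebesgue_on D) \<and> (AE x in lebesgue_on D. \<bar>\<beta> t x\<bar> \<le> Linf_norm (lebesgue_on ({0<..<T} \<times> D)) (\<lambda>(t, x). \<beta> t x))"
    using data by (intro Linf_product_slices Db) (simp add: admissible_data_def)
  have V: "AE t in I\<^sub>T T. V t \<in> W1inf D \<and> W1inf_norm D (V t) \<le> Bochner_Linf_norm (W1inf_norm D) T V"
    using data by (intro V.Bochner_Linf_AE_bound) (simp add: admissible_data_def)
  have le: "Linf_norm (lebesgue_on ({0<..<T} \<times> D)) (\<lambda>(t, x). \<alpha> t x) \<le> M"
    "Linf_norm (lebesgue_on ({0<..<T} \<times> D)) (\<lambda>(t, x). \<beta> t x) \<le> M" "Bochner_Linf_norm (W1inf_norm D) T V \<le> M"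
    using bnd by (auto simp: data_bounded_def)
  show ?thesis
    using \<alpha> \<beta> V
  proof eventually_elim
    case (elim t)
    have g: "weak_grad D (V t) \<in> Linf (lebesgue_on D)" using W1inf_D(2)[OF D] elim(3) by blast
    have "Linf_norm (lebesgue_on D) (weak_grad D (V t)) \<le> W1inf_norm D (V t)" by (simp add: W1inf_norm_def)
    also have "\<dots> \<le> M" using elim(3) le(3) by linarith
    finally have gM: "Linf_norm (lebesgue_on D) (weak_grad D (V t)) \<le> M" .
    show ?case
    proof
      show "open D" "L-lipschitz_on UNIV f" "f 0 = 0" "0 \<le> M" by (fact D f_lip f0 M0)+
      show "0 \<le> L" using f_lip by (rule lipschitz_on_nonneg)
      show "\<alpha> t \<in> borel_measurable (lebesgue_on D)" "\<beta> t \<in> borel_measurable (lebesgue_on D)" using elim by auto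
      have "AE x in lebesgue_on D. \<bar>\<alpha> t x\<bar> \<le> Linf_norm (lebesgue_on ({0<..<T} \<times> D)) (\<lambda>(t, x). \<alpha> t x)" using elim by auto
      then show "AE x in lebesgue_on D. \<bar>\<alpha> t x\<bar> \<le> M" by eventually_elim (use le in linarith)
      have "AE x in lebesgue_on D. \<bar>\<beta> t x\<bar> \<le> Linf_norm (lebesgue_on ({0<..<T} \<times> D)) (\<lambda>(t, x). \<beta> t x)" using elim by auto
      then show "AE x in lebesgue_on D. \<bar>\<beta> t x\<bar> \<le> M" by eventually_elim (use le in linarith)
      show "weak_grad D (V t) \<in> borel_measurable (lebesgue_on D)" using g by (simp add: Linf_def)
      show "AE x in lebesgue_on D. norm (weak_grad D (V t) x) \<le> M"
        using Linf_AE_bound[OF g] by eventually_elim (use gM in linarith)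
    qed
  qed
qed

lemma u_Bochner: "u \<in> Bochner_L2 (H1 D) (H1_norm D) T"
  using sol by (simp add: weak_solution_def)

lemma solutionE:
  obtains w v where "energy_path D T u w v" "AE t in I\<^sub>T T. rhs t \<in> H1_dual D"
    "\<And>\<phi>. \<phi> \<in> H1 D \<Longrightarrow> AE t in I\<^sub>T T. w t \<phi> = rhs t \<phi>" "AE x in lebesgue_on D. v 0 x = u0 x"
proof -
  interpret h: seminormed_functions "H1 D" "H1_norm D" by (rule seminormed_H1[OF D])
  obtain w where w: "w \<in> Bochner_L2 (H1_dual D) (H1_dual_norm D) T" "has_time_derivative D T u w"
    and eq: "\<And>\<phi>. \<phi> \<in> H1 D \<Longrightarrow> AE t in I\<^sub>T T. w t \<phi>
          - (LINT x|lebesgue_on D.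
               (- weak_grad D (u t) x + f (u t x) *\<^sub>R weak_grad D (V t) x) \<bullet> weak_grad D \<phi> x)
          + (LINT x|lebesgue_on D. \<beta> t x * u t x * \<phi> x)
          - (LINT x|lebesgue_on D. \<alpha> t x * f (u t x) * \<phi> x) = 0"
    using sol unfolding weak_solution_def by blast
  obtain v where v: "\<And>t. t \<in> {0..T} \<Longrightarrow> v t \<in> L2 D"
    "\<And>t. t \<in> {0..T} \<Longrightarrow> ((\<lambda>s. L2_norm D (\<lambda>x. v s x - v t x)) \<longlongrightarrow> 0) (at t within {0..T})"
    "AE t in I\<^sub>T T. AE x in lebesgue_on D. v t x = u t x" "AE x in lebesgue_on D. v 0 x = u0 x"
    using init unfolding has_initial_value_def by blast
  have ev: "evolution_path D T u w v"
    using D T u_Bochner w(1) v by unfold_locales auto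
  have "energy_path D T u w v"
    by (rule energy_path.intro[OF ev])
      (intro energy_path_axioms.intro evolution_path.L2_inner_primitive_if_derivative[OF ev w(2)])
  moreover have "AE t in I\<^sub>T T. rhs t \<in> H1_dual D"
    using weak_form_data_AE h.Bochner_L2D(2)[OF u_Bochner]
    by eventually_elim (simp add: rhs_def weak_form_data.weak_rhs_dual)
  moreover have "AE t in I\<^sub>T T. w t \<phi> = rhs t \<phi>" if "\<phi> \<in> H1 D" for \<phi>
    using eq[OF that] by eventually_elim (simp add: rhs_def weak_rhs_def)
  ultimately show ?thesis using that v(4) by blast
qed

end

text \<open>All conditions on a path are linear, so the energy inequality is available for the
  difference of two solutions, although f is nonlinear and the difference solves no equation of the
  same form.\<close>

lemma energy_path_diff:
  assumes 1: "energy_path D T u1 w1 v1" and 2: "energy_path D T u2 w2 v2"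
  shows "energy_path D T (\<lambda>t x. u1 t x - u2 t x) (\<lambda>t \<phi>. w1 t \<phi> - w2 t \<phi>) (\<lambda>t x. v1 t x - v2 t x)"
proof -
  interpret p1: energy_path D T u1 w1 v1 by (rule 1)
  interpret p2: energy_path D T u2 w2 v2 by (rule 2)
  let ?M = "lebesgue_on D"
  show ?thesis
  proof
    show "open D" "0 < T" by (fact p1.D p1.T)+
    show "(\<lambda>t x. u1 t x - u2 t x) \<in> Bochner_L2 (H1 D) (H1_norm D) T" by (rule p1.h.Bochner_L2_diff[OF p1.u p2.u])
    show "(\<lambda>t \<phi>. w1 t \<phi> - w2 t \<phi>) \<in> Bochner_L2 (H1_dual D) (H1_dual_norm D) T" by (rule p1.d.Bochner_L2_diff[OF p1.w p2.w])
    show "(\<lambda>x. v1 t x - v2 t x) \<in> Lp 2 ?M" if "t \<in> {0..T}" for t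
      by (intro Lp2_diff p1.v_L2 p2.v_L2 that)
    show "((\<lambda>s. Lp_norm 2 ?M (\<lambda>x. v1 s x - v2 s x - (v1 t x - v2 t x))) \<longlongrightarrow> 0) (at t within {0..T})" if t: "t \<in> {0..T}" for t
    proof (rule Lim_null_comparison[OF _ tendsto_add_zero[OF p1.v_cont[OF t] p2.v_cont[OF t]]])
      show "\<forall>\<^sub>F s in at t within {0..T}. norm (Lp_norm 2 ?M (\<lambda>x. v1 s x - v2 s x - (v1 t x - v2 t x)))
          \<le> Lp_norm 2 ?M (\<lambda>x. v1 s x - v1 t x) + Lp_norm 2 ?M (\<lambda>x. v2 s x - v2 t x)"
        unfolding eventually_at_filter
      proof (intro always_eventually allI impI)
        fix s assume s: "s \<in> {0..T}"
        have "Lp_norm 2 ?M (\<lambda>x. (v1 s x - v1 t x) + (v2 t x - v2 s x)) \<le> Lp_norm 2 ?M (\<lambda>x. v1 s x - v1 t x) + Lp_norm 2 ?M (\<lambda>x. v2 t x - v2 s x)"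
          by (intro Lp2_norm_triangle Lp2_diff p1.v_L2 p2.v_L2 s t)
        moreover have "(\<lambda>x. (v1 s x - v1 t x) + (v2 t x - v2 s x)) = (\<lambda>x. v1 s x - v2 s x - (v1 t x - v2 t x))"
          by (simp add: fun_eq_iff)
        ultimately show "norm (Lp_norm 2 ?M (\<lambda>x. v1 s x - v2 s x - (v1 t x - v2 t x)))
          \<le> Lp_norm 2 ?M (\<lambda>x. v1 s x - v1 t x) + Lp_norm 2 ?M (\<lambda>x. v2 s x - v2 t x)"
          using Lp2_norm_minus_commute[of ?M "v2 s" "v2 t"] by simp
      qed
    qed
    show "AE t in I\<^sub>T T. AE x in ?M. v1 t x - v2 t x = u1 t x - u2 t x"
      using p1.v_eq p2.v_eq
    proof eventually_elim
      case (elim t)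
      then show ?case by eventually_elim simp
    qed
    fix \<phi> and c d :: real assume \<phi>: "\<phi> \<in> H1 D" and cd: "0 < c" "c \<le> d" "d < T"
    note \<phi>2 = W1p_2_D(1)[OF p1.D \<phi>]
    have split: "(LINT x|?M. (v1 t x - v2 t x) * \<phi> x) = (LINT x|?M. v1 t x * \<phi> x) - (LINT x|?M. v2 t x * \<phi> x)" if "t \<in> {0..T}" for t
      using Lp2_integrable_mult[OF p1.v_L2[OF that] \<phi>2] Lp2_integrable_mult[OF p2.v_L2[OF that] \<phi>2]
      by (simp add: left_diff_distrib)
    have "{c..d} \<subseteq> {0<..<T}" using cd by auto
    then have wi: "integrable (lebesgue_on {c..d}) (\<lambda>t. w1 t \<phi>)" "integrable (lebesgue_on {c..d}) (\<lambda>t. w2 t \<phi>)"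
      using integrable_lebesgue_on_subset[OF p1.dual_apply_square_integrable(2)[OF \<phi>]]
        integrable_lebesgue_on_subset[OF p2.dual_apply_square_integrable(2)[OF \<phi>]] by simp_all
    have cT: "c \<in> {0..T}" "d \<in> {0..T}" using cd by auto
    show "(LINT x|?M. (v1 d x - v2 d x) * \<phi> x) - (LINT x|?M. (v1 c x - v2 c x) * \<phi> x) = (LINT t|lebesgue_on {c..d}. w1 t \<phi> - w2 t \<phi>)"
      unfolding split[OF cT(1)] split[OF cT(2)] Bochner_Integration.integral_diff[OF wi]
      using p1.L2_inner_primitive[OF \<phi> cd] p2.L2_inner_primitive[OF \<phi> cd] by linarith
  qed
qed

text \<open>Testing with u itself gives the dissipation bound with zero source, so Gronwall's
  inequality multiplies the initial energy by an exponential. Initial values in [0, 1] make that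
  energy at most the volume of D.\<close>

lemma (in solution) energy_bound:
  assumes path: "energy_path D T u w v" and rhs: "AE t in I\<^sub>T T. rhs t \<in> H1_dual D"
    and eq: "\<And>\<phi>. \<phi> \<in> H1 D \<Longrightarrow> AE t in I\<^sub>T T. w t \<phi> = rhs t \<phi>" and v0: "AE x in lebesgue_on D. v 0 x = u0 x"
    and D_fin: "emeasure lebesgue D < \<infinity>"
  shows "AE t in I\<^sub>T T. (L2_norm D (u t))\<^sup>2 \<le> measure lebesgue D * exp (2 * (L\<^sup>2 * M\<^sup>2 + M + M * L + 1) * T)"
proof -
  interpret e: energy_path D T u w v by (rule path)
  let ?C = "L\<^sup>2 * M\<^sup>2 + M + M * L + 1"
  have L0: "0 \<le> L" using f_lip by (rule lipschitz_on_nonneg)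
  have C0: "0 \<le> ?C" using M0 L0 by simp
  have id: "AE t in I\<^sub>T T. w t (u t) = rhs t (u t)"
    by (rule dual_identity_at_path[OF D e.h.Bochner_L2D(1)[OF e.u] e.w_mem rhs eq])
  have diss: "AE t in I\<^sub>T T. w t (u t) \<le> - (1/2) * (L2_norm D (weak_grad D (u t)))\<^sup>2
        + ?C * (L2_norm D (u t))\<^sup>2 + 0"
    using id weak_form_data_AE e.u_mem
  proof eventually_elim
    case (elim t)
    show ?case unfolding elim(1) rhs_def using weak_rhs_energy_estimate[OF elim(2,3)] by simp
  qed
  have init_le: "e.energy 0 \<le> measure lebesgue D"
  proof -
    have fm: "finite_measure (lebesgue_on D)"
      using D D_fin by (intro finite_measure_lebesgue_on) (simp add: fmeasurable_def)
    have v0i: "integrable (lebesgue_on D) (\<lambda>x. (norm (v 0 x))\<^sup>2)"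
      using e.v_L2[of 0] T by (auto simp: Lp2_iff)
    have u01: "AE x in lebesgue_on D. 0 \<le> u0 x \<and> u0 x \<le> 1" using data by (simp add: admissible_data_def)
    have "e.energy 0 = (LINT x|lebesgue_on D. (norm (v 0 x))\<^sup>2)" by (simp add: e.energy_def Lp2_norm_power2)
    also have "\<dots> \<le> (LINT x|lebesgue_on D. 1)"
    proof (rule integral_mono_AE[OF v0i])
      show "integrable (lebesgue_on D) (\<lambda>x. 1::real)" using finite_measure.integrable_const[OF fm] by blast
      show "AE x in lebesgue_on D. (norm (v 0 x))\<^sup>2 \<le> 1"
        using v0 u01 by eventually_elim (simp add: power_le_one)
    qed
    also have "\<dots> = measure lebesgue D" using D by (simp add: measure_restrict_space)
    finally show ?thesis .
  qed
  have inT: "AE t in I\<^sub>T T. t \<in> {0<..<T}" by (rule AE_I2) simp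
  show ?thesis
    using e.energy_AE_eq inT
  proof eventually_elim
    case (elim t)
    then have "e.energy t \<le> e.energy 0 * exp (2 * ?C * t)"
      using e.energy_estimate(1)[OF C0 order_refl diss, of t] by simp
    also have "\<dots> \<le> measure lebesgue D * exp (2 * ?C * T)"
    proof (rule mult_mono[OF init_le])
      have "2 * ?C * t \<le> 2 * ?C * T" using elim(2) C0 by (intro mult_left_mono) auto
      then show "exp (2 * ?C * t) \<le> exp (2 * ?C * T)" by simp
    qed auto
    finally show ?case using elim(1) by simp
  qed
qed

text \<open>The difference path satisfies the dissipation bound with the constant source \<kappa> S,
  where \<kappa> collects the squared differences of the data and S bounds the squared L2 norm of
  \<open>u2\<close>. The inner exponential is that of \<open>u2\<close>, the outer one that of the
  difference.\<close>

lemma stability_estimate: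
  assumes 1: "solution D T p \<alpha>0 \<beta>0 M L f \<alpha>1 \<beta>1 V1 u1 u01" and 2: "solution D T p \<alpha>0 \<beta>0 M L f \<alpha>2 \<beta>2 V2 u2 u02"
    and D_fin: "emeasure lebesgue D < \<infinity>"
  defines "d\<alpha> \<equiv> Linf_norm (lebesgue_on ({0<..<T} \<times> D)) (\<lambda>(t, x). \<alpha>1 t x - \<alpha>2 t x)"
    and "d\<beta> \<equiv> Linf_norm (lebesgue_on ({0<..<T} \<times> D)) (\<lambda>(t, x). \<beta>1 t x - \<beta>2 t x)"
    and "dV \<equiv> Bochner_Linf_norm (W1inf_norm D) T (\<lambda>t x. V1 t x - V2 t x)"
    and "d0 \<equiv> L2_norm D (\<lambda>x. u01 x - u02 x)"
    and "C \<equiv> L\<^sup>2 * M\<^sup>2 + M + M * L + 1"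
  shows "(Bochner_L2_norm (H1_norm D) T (\<lambda>t x. u1 t x - u2 t x))\<^sup>2 \<le>
    (1 + T) * (d0\<^sup>2 + 2 * ((L\<^sup>2 * dV\<^sup>2 + d\<beta>\<^sup>2 + L\<^sup>2 * d\<alpha>\<^sup>2) * (measure lebesgue D * exp (2 * C * T))) * T) * exp (2 * C * T)"
proof -
  interpret s1: solution D T p \<alpha>0 \<beta>0 M L f \<alpha>1 \<beta>1 V1 u1 u01 by (rule 1)
  interpret s2: solution D T p \<alpha>0 \<beta>0 M L f \<alpha>2 \<beta>2 V2 u2 u02 by (rule 2)
  interpret Vn: seminormed_functions "W1inf D" "W1inf_norm D" by (rule seminormed_W1inf[OF s1.D])
  note D = s1.D
  obtain w1 v1 where e1: "energy_path D T u1 w1 v1" "AE t in I\<^sub>T T. s1.rhs t \<in> H1_dual D"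
    "\<And>\<phi>. \<phi> \<in> H1 D \<Longrightarrow> AE t in I\<^sub>T T. w1 t \<phi> = s1.rhs t \<phi>" "AE x in lebesgue_on D. v1 0 x = u01 x"
    by (rule s1.solutionE) blast
  obtain w2 v2 where e2: "energy_path D T u2 w2 v2" "AE t in I\<^sub>T T. s2.rhs t \<in> H1_dual D"
    "\<And>\<phi>. \<phi> \<in> H1 D \<Longrightarrow> AE t in I\<^sub>T T. w2 t \<phi> = s2.rhs t \<phi>" "AE x in lebesgue_on D. v2 0 x = u02 x"
    by (rule s2.solutionE) blast
  interpret p1: energy_path D T u1 w1 v1 by (rule e1)
  interpret p2: energy_path D T u2 w2 v2 by (rule e2)
  let ?u = "\<lambda>t x. u1 t x - u2 t x"
  interpret p: energy_path D T ?u "\<lambda>t \<phi>. w1 t \<phi> - w2 t \<phi>" "\<lambda>t x. v1 t x - v2 t x"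
    by (rule energy_path_diff[OF e1(1) e2(1)])
  have um: "strongly_measurable (H1 D) (H1_norm D) T ?u" by (rule p1.h.Bochner_L2D(1)[OF p.u])
  have id1: "AE t in I\<^sub>T T. w1 t (?u t) = s1.rhs t (?u t)"
    by (rule dual_identity_at_path[OF D um p1.w_mem e1(2,3)])
  have id2: "AE t in I\<^sub>T T. w2 t (?u t) = s2.rhs t (?u t)"
    by (rule dual_identity_at_path[OF D um p2.w_mem e2(2,3)])
  have Db: "D \<in> sets borel" "{0<..<T} \<in> sets borel" using D by auto
  \<comment> \<open>\<open>Linf_norm\<close> bounds a function almost everywhere only if the
    function belongs to \<open>Linf\<close>, so membership of the differences is secured
    here.\<close>
  have lin: "(\<lambda>(t, x). F t x - G t x) \<in> Linf N"
    if "(\<lambda>(t, x). F t x) \<in> Linf N" "(\<lambda>(t, x). G t x) \<in> Linf N" for F G :: "real \<Rightarrow> 'a \<Rightarrow> real" and N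
    using Linf_add(1)[OF that(1) Linf_scaleR(1)[OF that(2), of "-1"]] by (simp add: case_prod_beta')
  have A: "AE t in I\<^sub>T T. AE x in lebesgue_on D. \<bar>\<alpha>1 t x - \<alpha>2 t x\<bar> \<le> d\<alpha>"
    using Linf_product_slices[OF Db(2,1) lin[of \<alpha>1 _ \<alpha>2]] s1.data s2.data
    by (auto simp: admissible_data_def d\<alpha>_def elim: eventually_mono)
  have B: "AE t in I\<^sub>T T. AE x in lebesgue_on D. \<bar>\<beta>1 t x - \<beta>2 t x\<bar> \<le> d\<beta>"
    using Linf_product_slices[OF Db(2,1) lin[of \<beta>1 _ \<beta>2]] s1.data s2.data
    by (auto simp: admissible_data_def d\<beta>_def elim: eventually_mono)
  have Vb: "V1 \<in> Bochner_Linf (W1inf D) (W1inf_norm D) T" "V2 \<in> Bochner_Linf (W1inf D) (W1inf_norm D) T"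
    using s1.data s2.data by (auto simp: admissible_data_def)
  have G: "AE t in I\<^sub>T T. AE x in lebesgue_on D. norm (weak_grad D (V1 t) x - weak_grad D (V2 t) x) \<le> dV"
    using Vn.Bochner_Linf_AE_bound[OF Vb(1)] Vn.Bochner_Linf_AE_bound[OF Vb(2)]
      Vn.Bochner_Linf_AE_bound[OF Vn.Bochner_Linf_diff[OF Vb]]
  proof eventually_elim
    case (elim t)
    define W where "W = (\<lambda>x. V1 t x - V2 t x)"
    have W: "W \<in> W1inf D" "W1inf_norm D W \<le> dV" using elim(3) by (auto simp: W_def dV_def)
    \<comment> \<open>The bound concerns the chosen gradient of V1 - V2; uniqueness identifies it
      almost everywhere with the difference of the two chosen gradients.\<close>
    have "has_weak_grad D (\<lambda>x. V1 t x + (-1) * V2 t x) (\<lambda>x. weak_grad D (V1 t) x + (-1) *\<^sub>R weak_grad D (V2 t) x)"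
      using elim by (intro has_weak_grad_add has_weak_grad_scale W1inf_D D) auto
    from weak_grad_eq(2)[OF D this]
    have "AE x in lebesgue_on D. weak_grad D (V1 t) x - weak_grad D (V2 t) x = weak_grad D W x" by (simp add: W_def)
    moreover have "AE x in lebesgue_on D. norm (weak_grad D W x) \<le> Linf_norm (lebesgue_on D) (weak_grad D W)"
      by (rule Linf_AE_bound[OF W1inf_D(2)[OF D W(1)]])
    moreover have "Linf_norm (lebesgue_on D) (weak_grad D W) \<le> dV"
      using W(2) Linf_norm_nonneg[of "lebesgue_on D" W] unfolding W1inf_norm_def by linarith
    ultimately show ?case by (auto elim: eventually_elim2)
  qed
  define S where "S = measure lebesgue D * exp (2 * C * T)"
  define \<kappa> where "\<kappa> = L\<^sup>2 * dV\<^sup>2 + d\<beta>\<^sup>2 + L\<^sup>2 * d\<alpha>\<^sup>2"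
  have \<kappa>0: "0 \<le> \<kappa>" by (simp add: \<kappa>_def)
  have u2S: "AE t in I\<^sub>T T. (L2_norm D (u2 t))\<^sup>2 \<le> S"
    unfolding S_def C_def by (rule s2.energy_bound[OF e2 D_fin])
  have C0: "0 \<le> C" unfolding C_def using s1.M0 lipschitz_on_nonneg[OF s1.f_lip] by simp
  have diss: "AE t in I\<^sub>T T. w1 t (?u t) - w2 t (?u t) \<le> - (1/2) * (L2_norm D (weak_grad D (?u t)))\<^sup>2
        + C * (L2_norm D (?u t))\<^sup>2 + \<kappa> * S"
    using id1 id2 s1.weak_form_data_AE s2.weak_form_data_AE A B G p1.u_mem p2.u_mem u2S
  proof eventually_elim
    case (elim t)
    have "s1.rhs t (?u t) - s2.rhs t (?u t) \<le> - (1/2) * (L2_norm D (weak_grad D (?u t)))\<^sup>2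
        + C * (L2_norm D (?u t))\<^sup>2 + \<kappa> * (L2_norm D (u2 t))\<^sup>2"
      unfolding s1.rhs_def s2.rhs_def C_def \<kappa>_def by (rule weak_rhs_difference_estimate[OF elim(3-9)])
    also have "\<kappa> * (L2_norm D (u2 t))\<^sup>2 \<le> \<kappa> * S" using elim(10) \<kappa>0 by (rule mult_left_mono)
    finally show ?case unfolding elim(1,2) by simp
  qed
  have e0: "p.energy 0 = d0\<^sup>2"
  proof -
    have m: "v1 0 \<in> borel_measurable (lebesgue_on D)" "v2 0 \<in> borel_measurable (lebesgue_on D)"
      using p1.v_L2[of 0] p2.v_L2[of 0] s1.T by (auto dest: Lp2_measurable)
    have ae: "AE x in lebesgue_on D. v1 0 x - v2 0 x = u01 x - u02 x"
      using e1(4) e2(4) by eventually_elim simp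
    have m1: "(\<lambda>x. v1 0 x - v2 0 x) \<in> borel_measurable (lebesgue_on D)" using m by (rule borel_measurable_diff)
    \<comment> \<open>Measurability of the initial difference is inherited from the representative
      at time 0.\<close>
    have m2: "(\<lambda>x. u01 x - u02 x) \<in> borel_measurable (lebesgue_on D)"
      by (rule complete_measure.borel_measurable_AE_cong[OF complete_measure_lebesgue_on_open[OF D] m1 ae])
    show ?thesis unfolding p.energy_def d0_def using Lp2_norm_cong_AE[OF m1 m2 ae] by simp
  qed
  have S0: "0 \<le> S" by (simp add: S_def)
  have "(Bochner_L2_norm (H1_norm D) T ?u)\<^sup>2 = (LINT t|I\<^sub>T T. (H1_norm D (?u t))\<^sup>2)"
    unfolding Bochner_L2_norm_def Lp2_norm_power2 by simp
  also have "\<dots> \<le> (1 + T) * (p.energy 0 + 2 * (\<kappa> * S) * T) * exp (2 * C * T)"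
    by (rule p.energy_estimate(2)[OF C0 mult_nonneg_nonneg[OF \<kappa>0 S0] diss])
  finally show ?thesis unfolding e0 \<kappa>_def S_def .
qed

text \<open>The factors 1 + T and T are each absorbed by exp T, and exp (2 C T) occurs twice, whence
  the exponent (4 C + 2) T. The factor L^2 + 1 dominates the coefficient of every difference of the
  data.\<close>

lemma stability_constant_bound:
  fixes T C a b c d m :: real
  assumes "0 < T" "0 \<le> L" "0 \<le> m" "0 \<le> a" "0 \<le> b" "0 \<le> c" "0 \<le> d" "0 \<le> C"
  shows "(1 + T) * (d + 2 * ((L\<^sup>2 * c + b + L\<^sup>2 * a) * (m * exp (2 * C * T))) * T) * exp (2 * C * T)
    \<le> (1 + 2 * (L\<^sup>2 + 1) * m) * exp ((4 * C + 2) * T) * (a + b + c + d)"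
proof -
  define E where "E = exp (2 * C * T)"
  define s where "s = a + b + c + d"
  have E1: "1 \<le> E" using assms by (simp add: E_def)
  have T1: "1 + T \<le> exp T" by (rule exp_ge_add_one_self)
  then have T2: "T \<le> exp T" by linarith
  have e1: "1 \<le> exp T" using assms by simp
  have "L\<^sup>2 * c + b + L\<^sup>2 * a \<le> (L\<^sup>2 + 1) * s"
  proof -
    have "0 \<le> L\<^sup>2 * b + L\<^sup>2 * d + a + c + d" using assms by (intro add_nonneg_nonneg) auto
    then show ?thesis unfolding s_def by (simp add: algebra_simps)
  qed
  then have "2 * ((L\<^sup>2 * c + b + L\<^sup>2 * a) * (m * E)) * T \<le> 2 * (((L\<^sup>2 + 1) * s) * (m * E)) * exp T"
    using assms E1 T2 by (intro mult_mono mult_nonneg_nonneg) (auto simp: s_def)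
  moreover have "d \<le> s * (E * exp T)"
  proof -
    have "1 * 1 \<le> E * exp T" using E1 e1 by (intro mult_mono) auto
    then have "s * 1 \<le> s * (E * exp T)" using assms by (intro mult_left_mono) (auto simp: s_def)
    moreover have "d \<le> s" using assms by (simp add: s_def)
    ultimately show ?thesis by linarith
  qed
  ultimately have "d + 2 * ((L\<^sup>2 * c + b + L\<^sup>2 * a) * (m * E)) * T \<le> s * (E * exp T) + 2 * (((L\<^sup>2 + 1) * s) * (m * E)) * exp T"
    by linarith
  also have "\<dots> = (1 + 2 * (L\<^sup>2 + 1) * m) * s * (E * exp T)" by (simp add: algebra_simps)
  finally have le: "d + 2 * ((L\<^sup>2 * c + b + L\<^sup>2 * a) * (m * E)) * T \<le> (1 + 2 * (L\<^sup>2 + 1) * m) * s * (E * exp T)" .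
  have "(1 + T) * (d + 2 * ((L\<^sup>2 * c + b + L\<^sup>2 * a) * (m * E)) * T) * E \<le> exp T * ((1 + 2 * (L\<^sup>2 + 1) * m) * s * (E * exp T)) * E"
    using assms E1 by (intro mult_right_mono mult_mono[OF T1 le]) (auto intro!: add_nonneg_nonneg mult_nonneg_nonneg)
  also have "\<dots> = (1 + 2 * (L\<^sup>2 + 1) * m) * (exp T * exp T * E * E) * s" by simp
  also have "exp T * exp T * E * E = exp ((4 * C + 2) * T)"
    by (simp add: E_def exp_add[symmetric] algebra_simps)
  finally show ?thesis by (simp add: E_def s_def)
qed

text \<open>The constants are chosen before T, the data and the solutions, and depend on the data
  only through the common bound M. Chosen after the two solutions, they would express hardly more
  than uniqueness, since any positive right-hand side could be scaled up.\<close>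

theorem theorem3p3:
  fixes D :: "'a::euclidean_space set"
    and f :: "real \<Rightarrow> real"
    and L\<^sub>f p \<alpha>0 \<beta>0 M :: real
  assumes dim: "DIM('a) \<in> {1, 2, 3}"
    and dom: "bounded_lipschitz_domain D"
    and f_W: "f \<in> W1inf UNIV"
    and f_lip: "L\<^sub>f-lipschitz_on UNIV f"
    and f_zero: "f 0 = 0" "f 1 = 0"
    and f_nonneg: "\<And>s. 0 < s \<Longrightarrow> s < 1 \<Longrightarrow> 0 \<le> f s"
    and p: "2 < p" "p < 3"
    and pos: "0 < \<alpha>0" "0 < \<beta>0"
  shows "\<exists>C>0. \<exists>Ct>0. \<forall>T>0. \<forall>\<alpha>1 \<beta>1 V1 u01 u1 \<alpha>2 \<beta>2 V2 u02 u2.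
     admissible_data D T p \<alpha>0 \<beta>0 \<alpha>1 \<beta>1 V1 u01 \<longrightarrow>
     admissible_data D T p \<alpha>0 \<beta>0 \<alpha>2 \<beta>2 V2 u02 \<longrightarrow>
     data_bounded D T M \<alpha>1 \<beta>1 V1 \<longrightarrow>
     data_bounded D T M \<alpha>2 \<beta>2 V2 \<longrightarrow>
     weak_solution D T f \<alpha>1 \<beta>1 V1 u1 \<longrightarrow> has_initial_value D T u1 u01 \<longrightarrow>
     weak_solution D T f \<alpha>2 \<beta>2 V2 u2 \<longrightarrow> has_initial_value D T u2 u02 \<longrightarrow>
     (Bochner_L2_norm (H1_norm D) T (\<lambda>t x. u1 t x - u2 t x))\<^sup>2
     \<le> C * exp (Ct * T) *
        ((Linf_norm (lebesgue_on ({0<..<T} \<times> D)) (\<lambda>(t, x). \<alpha>1 t x - \<alpha>2 t x))\<^sup>2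
       + (Linf_norm (lebesgue_on ({0<..<T} \<times> D)) (\<lambda>(t, x). \<beta>1 t x - \<beta>2 t x))\<^sup>2
       + (Bochner_Linf_norm (W1inf_norm D) T (\<lambda>t x. V1 t x - V2 t x))\<^sup>2
       + (Lp_norm 2 (lebesgue_on D) (\<lambda>x. u01 x - u02 x))\<^sup>2)"
proof -
  have D: "open D" "bounded D" using dom by (auto simp: bounded_lipschitz_domain_def)
  have D_fin: "emeasure lebesgue D < \<infinity>"
    using emeasure_bounded_finite[OF D(2)] D(1) by simp
  have L0: "0 \<le> L\<^sub>f" using f_lip by (rule lipschitz_on_nonneg)
  \<comment> \<open>M is arbitrary here. The absolute value keeps K nonnegative, as positivity of
    the rate 4 K + 2 requires; it disappears once data bounded by M are given, since these force M
    to be nonnegative.\<close>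
  define K where "K = L\<^sub>f\<^sup>2 * \<bar>M\<bar>\<^sup>2 + \<bar>M\<bar> + \<bar>M\<bar> * L\<^sub>f + 1"
  have K0: "0 \<le> K" using L0 by (simp add: K_def)
  define C where "C = 1 + 2 * (L\<^sub>f\<^sup>2 + 1) * measure lebesgue D"
  have C0: "0 < C" unfolding C_def by (intro add_pos_nonneg mult_nonneg_nonneg) auto
  show ?thesis
  proof (rule exI[of _ C], rule conjI[OF C0], rule exI[of _ "4 * K + 2"], rule conjI; (intro allI impI)?)
    show "0 < 4 * K + 2" using K0 by simp
    fix T :: real and \<alpha>1 \<beta>1 V1 u01 u1 \<alpha>2 \<beta>2 V2 u02 u2
    assume T: "0 < T"
      and a: "admissible_data D T p \<alpha>0 \<beta>0 \<alpha>1 \<beta>1 V1 u01" "admissible_data D T p \<alpha>0 \<beta>0 \<alpha>2 \<beta>2 V2 u02"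
        "data_bounded D T M \<alpha>1 \<beta>1 V1" "data_bounded D T M \<alpha>2 \<beta>2 V2"
        "weak_solution D T f \<alpha>1 \<beta>1 V1 u1" "has_initial_value D T u1 u01"
        "weak_solution D T f \<alpha>2 \<beta>2 V2 u2" "has_initial_value D T u2 u02"
    have 1: "solution D T p \<alpha>0 \<beta>0 M L\<^sub>f f \<alpha>1 \<beta>1 V1 u1 u01" and 2: "solution D T p \<alpha>0 \<beta>0 M L\<^sub>f f \<alpha>2 \<beta>2 V2 u2 u02"
      using D T f_lip f_zero a by (auto intro: solution.intro)
    have M: "\<bar>M\<bar> = M" using solution.M0[OF 1] by simp
    show "(Bochner_L2_norm (H1_norm D) T (\<lambda>t x. u1 t x - u2 t x))\<^sup>2
     \<le> C * exp ((4 * K + 2) * T) *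
        ((Linf_norm (lebesgue_on ({0<..<T} \<times> D)) (\<lambda>(t, x). \<alpha>1 t x - \<alpha>2 t x))\<^sup>2
       + (Linf_norm (lebesgue_on ({0<..<T} \<times> D)) (\<lambda>(t, x). \<beta>1 t x - \<beta>2 t x))\<^sup>2
       + (Bochner_Linf_norm (W1inf_norm D) T (\<lambda>t x. V1 t x - V2 t x))\<^sup>2
       + (Lp_norm 2 (lebesgue_on D) (\<lambda>x. u01 x - u02 x))\<^sup>2)"
      unfolding C_def using K0
      by (intro order_trans[OF stability_estimate[OF 1 2 D_fin, folded K_def[unfolded M]] stability_constant_bound]) (use T L0 in auto)
  qed
qed

end
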